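(* Let $M=G/G_\Gamma$ be a good semisimple orbit with Kirillov-Kostant-Souriau bracket $v=v_\lambda$, and let $K\neq0$. Suppose $f_0$ is an invariant bracket on $M$ satisfying $[\![f_0,f_0]\!]=K^2\varphi_M$ and $[\![f_0,v]\!]=0$. Then the family $\pm f_0+sv$, where $s$ is an arbitrary complex number, consists of all invariant brackets $f$ on $M$ satisfying $$[\![f,f]\!]=K^2\varphi_M,\qquad [\![f,v]\!]=0 .$$ Almost all brackets from this family (all except a finite number) are nondegenerate.
   Context: Let $\mathfrak g$ be a simple complex Lie algebra, $\mathfrak h$ a Cartan subalgebra, $\Omega\subset\mathfrak h^*$ the root system, $\Omega^+$ a system of positive roots, $\Pi$ the simple roots. For $\alpha\in\Omega^+$ fix root vectors $E_\alpha,E_{-\alpha}$ with $(E_\alpha,E_{-\alpha})=1$ for the Killing form. For a proper subset $\Gamma\subsetneq\Pi$ let $\mathfrak h^*_\Gamma$ be the span of $\Gamma$, $\Omega_\Gamma=\Omega\cap\mathfrak h^*_\Gamma$, and let $\mathfrak g_\Gamma$ be the (Levi) subalgebra generated by $\mathfrak h$ and $E_{\pm\alpha}$, $\alpha\in\Gamma$. Let $\mathfrak m$ be the span of $E_{\pm\gamma}$, $\gamma\in\Omega^+\setminus\Omega_\Gamma$. Let $G$ be a connected complex Lie group with Lie algebra $\mathfrak g$, $G_\Gamma$ the connected subgroup with Lie algebra $\mathfrak g_\Gamma$, and $M=G/G_\Gamma$. Write $\mathfrak h^*=\mathfrak h^*_\Gamma\oplus\mathfrak h^*_{\Pi\setminus\Gamma}$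 and let $\alpha\mapsto\bar\alpha$ be the projection to $\mathfrak h^*_{\Pi\setminus\Gamma}$. The nonzero elements of the image of $\Omega$ are called quasiroots. $G$-invariant polyvector fields on $M$ are identified with $(\wedge^\bullet\mathfrak m)^{\mathfrak g_\Gamma}$, where $\mathfrak m\cong\mathfrak g/\mathfrak g_\Gamma\cong T_oM$. The Schouten bracket $[\![X_1\wedge\cdots\wedge X_p,Y_1\wedge\cdots\wedge Y_q]\!]=\sum(-1)^{i+j}[X_i,Y_j]\wedge X_1\wedge\cdots\hat X_i\cdots\hat Y_j\cdots\wedge Y_q$ on $\wedge^\bullet\mathfrak g$ induces (after projection of the result to $\wedge^\bullet\mathfrak m=\wedge^\bullet(\mathfrak g/\mathfrak g_\Gamma)$) the Schouten bracket of invariant polyvector fields on $M$. Put $r=\sum_{\alpha\in\Omega^+}E_\alpha\wedge E_{-\alpha}$, $\varphi=[\![r,r]\!]\in\wedge^3\mathfrak g$ (a $\mathfrak g$-invariant element), and let $\varphi_M$ be the image of $\varphi$ in $\wedge^3\mathfrak m$. An invariant bracket on $M$ is a $G$-invariant bivector field; it has the form $\sum_{\alpha\in\Omega^+\setminus\Omega_\Gamma}c(\bar\alpha)E_\alpha\wedge E_{-\alpha}$, and it is nondegenerate if it is nondegenerate as a bivector. The orbit structure on $M$ is given by a linear form $\lambda$ on $\mathfrak h^*_{\Pi\setminus\Gamma}$ nonzero on all quasiroots, and the Kirillov-Kostant-Souriau bracket is $v_\lambda=\sum_{\alpha\in\Omega^+\setminus\Omega_\Gamma}\frac1{\lambda(\bar\alpha)}E_\alpha\wedge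 E_{-\alpha}$. The orbit $M$ is called good if there exists an invariant bracket $f$ on $M$ with $[\![f,f]\!]=K^2\varphi_M$ and $[\![f,v_\lambda]\!]=0$, where $K$ is a nonzero complex number. *)

theory Defs
  imports Complex_Main "HOL-Library.Function_Algebras" "HOL-Combinatorics.Permutations"
begin

section \<open>Complex Lie algebras\<close>

class complex_lie_algebra = ab_group_add +
  fixes scaleC :: "complex \<Rightarrow> 'a \<Rightarrow> 'a"  (infixr "*\<^sub>C" 75)
    and lie :: "'a \<Rightarrow> 'a \<Rightarrow> 'a"
  assumes scaleC_add_right: "c *\<^sub>C (x + y) = c *\<^sub>C x + c *\<^sub>C y"
    and scaleC_add_left: "(c + d) *\<^sub>C x = c *\<^sub>C x + d *\<^sub>C x"
    and scaleC_scaleC: "c *\<^sub>C d *\<^sub>C x = (c * d) *\<^sub>C x"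
    and scaleC_one: "1 *\<^sub>C x = x"
    and finite_dim: "\<exists>B. finite B \<and> (\<forall>x. \<exists>c. x = (\<Sum>b\<in>B. c b *\<^sub>C b))"
    and lie_add_left: "lie (x + y) z = lie x z + lie y z"
    and lie_add_right: "lie x (y + z) = lie x y + lie x z"
    and lie_scaleC_left: "lie (c *\<^sub>C x) y = c *\<^sub>C lie x y"
    and lie_scaleC_right: "lie x (c *\<^sub>C y) = c *\<^sub>C lie x y"
    and lie_self: "lie x x = 0"
    and jacobi: "lie x (lie y z) + lie y (lie z x) + lie z (lie x y) = 0"

global_interpretation clie: vector_space "scaleC :: complex \<Rightarrow> 'a \<Rightarrow> 'a :: complex_lie_algebra"
  by unfold_locales (rule scaleC_add_right scaleC_add_left scaleC_scaleC scaleC_one)+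

definition (in complex_lie_algebra) lie_ideal :: "'a set \<Rightarrow> bool" where
  "lie_ideal I \<longleftrightarrow> 0 \<in> I \<and> (\<forall>x\<in>I. \<forall>y\<in>I. x + y \<in> I) \<and> (\<forall>c. \<forall>x\<in>I. c *\<^sub>C x \<in> I)
     \<and> (\<forall>x. \<forall>y\<in>I. lie x y \<in> I)"

class simple_complex_lie_algebra = complex_lie_algebra +
  assumes nonabelian: "\<exists>x y. lie x y \<noteq> 0"
    and simple: "lie_ideal I \<Longrightarrow> I = {0} \<or> I = UNIV"

definition lie_subalgebra :: "'g :: complex_lie_algebra set \<Rightarrow> bool" where
  "lie_subalgebra S \<longleftrightarrow> clie.subspace S \<and> (\<forall>x\<in>S. \<forall>y\<in>S. lie x y \<in> S)"

definition lie_generated :: "'g :: complex_lie_algebra set \<Rightarrow> 'g set" where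
  "lie_generated A = \<Inter> {S. lie_subalgebra S \<and> A \<subseteq> S}"

text \<open>Traces, and later tensor components, are taken in one arbitrary basis; neither depends on
  which one.\<close>

definition lie_basis :: "'g :: complex_lie_algebra set" where
  "lie_basis = clie.extend_basis {}"

definition dual_vector :: "'g :: complex_lie_algebra \<Rightarrow> 'g \<Rightarrow> complex" where
  "dual_vector b x = clie.representation lie_basis x b"

definition endo_trace :: "('g :: complex_lie_algebra \<Rightarrow> 'g) \<Rightarrow> complex" where
  "endo_trace T = (\<Sum>b\<in>lie_basis. dual_vector b (T b))"

definition killing :: "'g :: complex_lie_algebra \<Rightarrow> 'g \<Rightarrow> complex" where
  "killing x y = endo_trace (\<lambda>z. lie x (lie y z))"


section \<open>Spaces of complex-valued functions\<close>

definition fscale :: "complex \<Rightarrow> ('b \<Rightarrow> complex) \<Rightarrow> 'b \<Rightarrow> complex" where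
  "fscale c u = (\<lambda>x. c * u x)"

global_interpretation cfun: vector_space "fscale :: complex \<Rightarrow> ('b \<Rightarrow> complex) \<Rightarrow> 'b \<Rightarrow> complex"
  by unfold_locales (auto simp: fscale_def fun_eq_iff algebra_simps)

text \<open>The dual of a subspace \<open>V\<close>: functionals are set to 0 outside \<open>V\<close>, so that equality of
  functionals on \<open>V\<close> is equality of functions.\<close>

definition dual_space :: "'g :: complex_lie_algebra set \<Rightarrow> ('g \<Rightarrow> complex) set" where
  "dual_space V = {\<xi>. (\<forall>x\<in>V. \<forall>y\<in>V. \<xi> (x + y) = \<xi> x + \<xi> y)
     \<and> (\<forall>c. \<forall>x\<in>V. \<xi> (c *\<^sub>C x) = c * \<xi> x) \<and> (\<forall>x. x \<notin> V \<longrightarrow> \<xi> x = 0)}"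


section \<open>Roots\<close>

text \<open>A Cartan subalgebra of a semisimple complex Lie algebra: a maximal abelian subalgebra all of
  whose elements are ad-semisimple, that is, ad-diagonalizable.\<close>

definition abelian_subalgebra :: "'g :: complex_lie_algebra set \<Rightarrow> bool" where
  "abelian_subalgebra K \<longleftrightarrow> clie.subspace K \<and> (\<forall>x\<in>K. \<forall>y\<in>K. lie x y = 0)"

definition cartan_subalgebra :: "'g :: complex_lie_algebra set \<Rightarrow> bool" where
  "cartan_subalgebra H \<longleftrightarrow> abelian_subalgebra H
     \<and> (\<forall>K. abelian_subalgebra K \<and> H \<subseteq> K \<longrightarrow> K = H)
     \<and> (\<forall>h\<in>H. clie.span {x. \<exists>c. lie h x = c *\<^sub>C x} = UNIV)"

definition root_space :: "'g :: complex_lie_algebra set \<Rightarrow> ('g \<Rightarrow> complex) \<Rightarrow> 'g set" where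
  "root_space H \<alpha> = {x. \<forall>h\<in>H. lie h x = \<alpha> h *\<^sub>C x}"

definition roots :: "'g :: complex_lie_algebra set \<Rightarrow> ('g \<Rightarrow> complex) set" where
  "roots H = {\<alpha> \<in> dual_space H. \<alpha> \<noteq> 0 \<and> root_space H \<alpha> \<noteq> {0}}"

text \<open>Positive systems come from regular elements \<open>t\<close> of the real form of the Cartan subalgebra
  on which all roots are real.\<close>

definition positive_system ::
    "'g :: complex_lie_algebra set \<Rightarrow> ('g \<Rightarrow> complex) set \<Rightarrow> bool" where
  "positive_system H P \<longleftrightarrow> (\<exists>t\<in>H. (\<forall>\<alpha>\<in>roots H. \<alpha> t \<in> \<real> \<and> \<alpha> t \<noteq> 0)
     \<and> P = {\<alpha> \<in> roots H. 0 < Re (\<alpha> t)})"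

definition simple_roots :: "('g \<Rightarrow> complex) set \<Rightarrow> ('g \<Rightarrow> complex) set" where
  "simple_roots P = {\<alpha> \<in> P. \<not> (\<exists>\<beta>\<in>P. \<exists>\<gamma>\<in>P. \<alpha> = \<beta> + \<gamma>)}"

definition root_vectors ::
    "'g :: complex_lie_algebra set \<Rightarrow> ('g \<Rightarrow> complex) set \<Rightarrow> (('g \<Rightarrow> complex) \<Rightarrow> 'g) \<Rightarrow> bool" where
  "root_vectors H P E \<longleftrightarrow> (\<forall>\<alpha>\<in>P. E \<alpha> \<in> root_space H \<alpha> \<and> E (- \<alpha>) \<in> root_space H (- \<alpha>)
     \<and> killing (E \<alpha>) (E (- \<alpha>)) = 1)"


section \<open>The Levi subalgebra, its complement, and quasiroots\<close>

definition levi_roots ::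
    "'g :: complex_lie_algebra set \<Rightarrow> ('g \<Rightarrow> complex) set \<Rightarrow> ('g \<Rightarrow> complex) set" where
  "levi_roots H \<Gamma> = roots H \<inter> cfun.span \<Gamma>"

definition levi :: "'g :: complex_lie_algebra set \<Rightarrow> (('g \<Rightarrow> complex) \<Rightarrow> 'g)
    \<Rightarrow> ('g \<Rightarrow> complex) set \<Rightarrow> 'g set" where
  "levi H E \<Gamma> = lie_generated (H \<union> E ` \<Gamma> \<union> (\<lambda>\<alpha>. E (- \<alpha>)) ` \<Gamma>)"

definition levi_compl :: "'g :: complex_lie_algebra set \<Rightarrow> ('g \<Rightarrow> complex) set
    \<Rightarrow> (('g \<Rightarrow> complex) \<Rightarrow> 'g) \<Rightarrow> ('g \<Rightarrow> complex) set \<Rightarrow> 'g set" where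
  "levi_compl H P E \<Gamma> =
     clie.span (E ` (P - levi_roots H \<Gamma>) \<union> (\<lambda>\<gamma>. E (- \<gamma>)) ` (P - levi_roots H \<Gamma>))"

definition root_proj :: "('g \<Rightarrow> complex) set \<Rightarrow> ('g \<Rightarrow> complex) set
    \<Rightarrow> ('g \<Rightarrow> complex) \<Rightarrow> 'g \<Rightarrow> complex" where
  "root_proj P \<Gamma> \<alpha> =
     (THE \<beta>. \<beta> \<in> cfun.span (simple_roots P - \<Gamma>) \<and> \<alpha> - \<beta> \<in> cfun.span \<Gamma>)"

definition quasiroots :: "'g :: complex_lie_algebra set \<Rightarrow> ('g \<Rightarrow> complex) set
    \<Rightarrow> ('g \<Rightarrow> complex) set \<Rightarrow> ('g \<Rightarrow> complex) set" where
  "quasiroots H P \<Gamma> = root_proj P \<Gamma> ` roots H - {0}"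

definition linear_form_on ::
    "('b \<Rightarrow> complex) set \<Rightarrow> (('b \<Rightarrow> complex) \<Rightarrow> complex) \<Rightarrow> bool" where
  "linear_form_on V l \<longleftrightarrow> (\<forall>u\<in>V. \<forall>w\<in>V. l (u + w) = l u + l w)
     \<and> (\<forall>c. \<forall>u\<in>V. l (fscale c u) = c * l u)"

definition orbit_form :: "'g :: complex_lie_algebra set \<Rightarrow> ('g \<Rightarrow> complex) set
    \<Rightarrow> ('g \<Rightarrow> complex) set \<Rightarrow> (('g \<Rightarrow> complex) \<Rightarrow> complex) \<Rightarrow> bool" where
  "orbit_form H P \<Gamma> l \<longleftrightarrow> linear_form_on (cfun.span (simple_roots P - \<Gamma>)) l
     \<and> (\<forall>\<beta>\<in>quasiroots H P \<Gamma>. l \<beta> \<noteq> 0)"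


section \<open>Polyvectors and the Schouten bracket\<close>

text \<open>A polyvector is an alternating multilinear function of covectors, the arguments being given
  as a list whose length is the degree; the product \<open>x\<^sub>1 \<and> \<dots> \<and> x\<^sub>k\<close> is the function
  \<open>(\<xi>\<^sub>1, \<dots>, \<xi>\<^sub>k) \<mapsto> det (\<xi>\<^sub>i (x\<^sub>j))\<close>. As the algebra is finite-dimensional over a field of
  characteristic 0, the linear span of these functions is its exterior algebra.\<close>

type_synonym 'g polyvector = "('g \<Rightarrow> complex) list \<Rightarrow> complex"

definition wedge :: "'g :: complex_lie_algebra list \<Rightarrow> 'g polyvector" where
  "wedge xs \<xi>s = (if length \<xi>s = length xs \<and> set \<xi>s \<subseteq> dual_space UNIV
     then \<Sum>\<pi> | \<pi> permutes {..<length xs}. of_int (sign \<pi>) * (\<Prod>i<length xs. (\<xi>s ! i) (xs ! \<pi> i))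
     else 0)"

definition ext_power :: "nat \<Rightarrow> 'g :: complex_lie_algebra set \<Rightarrow> 'g polyvector set" where
  "ext_power k V = cfun.span {wedge xs | xs. length xs = k \<and> set xs \<subseteq> V}"

text \<open>The derivation of the exterior algebra that extends \<open>ad x\<close>.\<close>

definition ext_ad :: "'g :: complex_lie_algebra \<Rightarrow> 'g polyvector \<Rightarrow> 'g polyvector" where
  "ext_ad x u \<xi>s = (if set \<xi>s \<subseteq> dual_space UNIV
     then \<Sum>i<length \<xi>s. u (\<xi>s[i := (\<lambda>y. (\<xi>s ! i) (lie x y))])
     else 0)"

definition omit :: "nat \<Rightarrow> 'b list \<Rightarrow> 'b list" where
  "omit i xs = take i xs @ drop (Suc i) xs"

definition schouten_decomp ::
    "'g :: complex_lie_algebra list \<Rightarrow> 'g list \<Rightarrow> 'g polyvector" where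
  "schouten_decomp xs ys = (\<Sum>i<length xs. \<Sum>j<length ys.
     fscale ((- 1) ^ (i + j)) (wedge (lie (xs ! i) (ys ! j) # omit i xs @ omit j ys)))"

text \<open>The bilinear extension of the formula for decomposable polyvectors: in terms of a basis
  \<open>(e\<^sub>i)\<close>, a polyvector \<open>u\<close> of degree \<open>p\<close> is the sum of
  \<open>u (e\<^sup>*\<^sub>i\<^sub>1, \<dots>, e\<^sup>*\<^sub>i\<^sub>p) / p! \<cdot> e\<^sub>i\<^sub>1 \<and> \<dots> \<and> e\<^sub>i\<^sub>p\<close> over all \<open>i\<^sub>1, \<dots>, i\<^sub>p\<close>.
  Theorem \<open>schouten_wedge\<close> below shows that the formula is recovered.\<close>

definition basis_lists :: "'g :: complex_lie_algebra list set" where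
  "basis_lists = {bs. set bs \<subseteq> lie_basis \<and> length bs \<le> card (lie_basis :: 'g set)}"

definition schouten ::
    "'g :: complex_lie_algebra polyvector \<Rightarrow> 'g polyvector \<Rightarrow> 'g polyvector" where
  "schouten u v = (\<Sum>bs\<in>basis_lists. \<Sum>cs\<in>basis_lists.
     fscale (u (map dual_vector bs) / fact (length bs) * (v (map dual_vector cs) / fact (length cs)))
       (schouten_decomp bs cs))"


section \<open>Invariant brackets on the orbit\<close>

definition r_bivector ::
    "('g :: complex_lie_algebra \<Rightarrow> complex) set \<Rightarrow> (('g \<Rightarrow> complex) \<Rightarrow> 'g) \<Rightarrow> 'g polyvector" where
  "r_bivector P E = (\<Sum>\<alpha>\<in>P. wedge [E \<alpha>, E (- \<alpha>)])"

text \<open>The annihilator of \<open>S\<close> is the dual of the quotient by \<open>S\<close>, so passing to the exterior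
  algebra of the quotient is restriction of polyvectors to covectors that annihilate \<open>S\<close>.\<close>

definition annihilator :: "'g :: complex_lie_algebra set \<Rightarrow> ('g \<Rightarrow> complex) set" where
  "annihilator S = {\<xi> \<in> dual_space UNIV. \<forall>x\<in>S. \<xi> x = 0}"

definition quot_polyvector :: "'g :: complex_lie_algebra set \<Rightarrow> 'g polyvector \<Rightarrow> 'g polyvector" where
  "quot_polyvector S u \<xi>s = (if set \<xi>s \<subseteq> annihilator S then u \<xi>s else 0)"

definition orbit_schouten :: "'g :: complex_lie_algebra set \<Rightarrow> (('g \<Rightarrow> complex) \<Rightarrow> 'g)
    \<Rightarrow> ('g \<Rightarrow> complex) set \<Rightarrow> 'g polyvector \<Rightarrow> 'g polyvector \<Rightarrow> 'g polyvector" where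
  "orbit_schouten H E \<Gamma> u v = quot_polyvector (levi H E \<Gamma>) (schouten u v)"

definition phi_orbit :: "'g :: complex_lie_algebra set \<Rightarrow> ('g \<Rightarrow> complex) set
    \<Rightarrow> (('g \<Rightarrow> complex) \<Rightarrow> 'g) \<Rightarrow> ('g \<Rightarrow> complex) set \<Rightarrow> 'g polyvector" where
  "phi_orbit H P E \<Gamma> =
     quot_polyvector (levi H E \<Gamma>) (schouten (r_bivector P E) (r_bivector P E))"

definition invariant_bracket :: "'g :: complex_lie_algebra set \<Rightarrow> ('g \<Rightarrow> complex) set
    \<Rightarrow> (('g \<Rightarrow> complex) \<Rightarrow> 'g) \<Rightarrow> ('g \<Rightarrow> complex) set \<Rightarrow> 'g polyvector \<Rightarrow> bool" where
  "invariant_bracket H P E \<Gamma> f \<longleftrightarrow> f \<in> ext_power 2 (levi_compl H P E \<Gamma>)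
     \<and> (\<forall>x\<in>levi H E \<Gamma>. ext_ad x f = 0)"

definition nondegenerate :: "'g :: complex_lie_algebra set \<Rightarrow> (('g \<Rightarrow> complex) \<Rightarrow> 'g)
    \<Rightarrow> ('g \<Rightarrow> complex) set \<Rightarrow> 'g polyvector \<Rightarrow> bool" where
  "nondegenerate H E \<Gamma> f \<longleftrightarrow> (\<forall>\<xi>\<in>annihilator (levi H E \<Gamma>).
     (\<forall>\<eta>\<in>annihilator (levi H E \<Gamma>). f [\<xi>, \<eta>] = 0) \<longrightarrow> \<xi> = 0)"

definition kks_bracket :: "'g :: complex_lie_algebra set \<Rightarrow> ('g \<Rightarrow> complex) set
    \<Rightarrow> (('g \<Rightarrow> complex) \<Rightarrow> 'g) \<Rightarrow> ('g \<Rightarrow> complex) set \<Rightarrow> (('g \<Rightarrow> complex) \<Rightarrow> complex)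
    \<Rightarrow> 'g polyvector" where
  "kks_bracket H P E \<Gamma> l = (\<Sum>\<alpha>\<in>P - levi_roots H \<Gamma>.
     fscale (1 / l (root_proj P \<Gamma> \<alpha>)) (wedge [E \<alpha>, E (- \<alpha>)]))"

definition good_orbit :: "'g :: complex_lie_algebra set \<Rightarrow> ('g \<Rightarrow> complex) set
    \<Rightarrow> (('g \<Rightarrow> complex) \<Rightarrow> 'g) \<Rightarrow> ('g \<Rightarrow> complex) set \<Rightarrow> (('g \<Rightarrow> complex) \<Rightarrow> complex) \<Rightarrow> bool" where
  "good_orbit H P E \<Gamma> l \<longleftrightarrow> (\<exists>f K. K \<noteq> 0 \<and> invariant_bracket H P E \<Gamma> f
     \<and> orbit_schouten H E \<Gamma> f f = fscale (K\<^sup>2) (phi_orbit H P E \<Gamma>)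
     \<and> orbit_schouten H E \<Gamma> f (kks_bracket H P E \<Gamma> l) = 0)"


section \<open>The Schouten bracket of decomposable polyvectors\<close>

lemma lie_basis:
  defines "B \<equiv> lie_basis :: 'a :: complex_lie_algebra set"
  shows "clie.independent B" "clie.span B = UNIV" "finite B"
proof -
  show i: "clie.independent B" and "clie.span B = UNIV"
    unfolding B_def lie_basis_def
    by (auto simp: clie.independent_extend_basis clie.span_extend_basis clie.independent_empty)
  obtain A :: "'a set" where A: "finite A" "\<forall>x. \<exists>c. x = (\<Sum>b\<in>A. c b *\<^sub>C b)"
    using finite_dim by blast
  have "B \<subseteq> clie.span A"
  proof
    fix x :: 'a
    obtain c where "x = (\<Sum>b\<in>A. c b *\<^sub>C b)" using A(2) by blast
    then show "x \<in> clie.span A"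
      by (simp add: clie.span_sum clie.span_scale clie.span_base)
  qed
  then show "finite B"
    using clie.independent_span_bound[OF A(1) i] by blast
qed

lemma sum_dual_vector: "(\<Sum>b\<in>lie_basis. dual_vector b x *\<^sub>C b) = x"
  unfolding dual_vector_def
  by (rule clie.sum_representation_eq) (use lie_basis in auto)

lemma dual_vector_mem: "dual_vector b \<in> dual_space UNIV"
  unfolding dual_space_def dual_vector_def
  by (auto simp: lie_basis clie.representation_add[OF lie_basis(1)]
      clie.representation_scale[OF lie_basis(1)])

definition mlin :: "nat \<Rightarrow> ('g :: complex_lie_algebra list \<Rightarrow> complex) \<Rightarrow> bool" where
  "mlin p D \<longleftrightarrow> (\<forall>xs i. length xs = p \<and> i < p \<longrightarrow>
     (\<forall>x y. D (xs[i := x + y]) = D (xs[i := x]) + D (xs[i := y])) \<and>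
     (\<forall>c x. D (xs[i := c *\<^sub>C x]) = c * D (xs[i := x])))"

definition alt_adj :: "nat \<Rightarrow> ('g list \<Rightarrow> complex) \<Rightarrow> bool" where
  "alt_adj p D \<longleftrightarrow> (\<forall>xs i. length xs = p \<and> Suc i < p \<and> xs ! i = xs ! Suc i \<longrightarrow> D xs = 0)"

lemma mlin_sum:
  assumes "mlin p D" "length xs = p" "i < p" "finite B"
  shows "D (xs[i := (\<Sum>b\<in>B. c b *\<^sub>C f b)]) = (\<Sum>b\<in>B. c b * D (xs[i := f b]))"
proof -
  have z: "D (xs[i := 0]) = 0"
    using assms(1-3) unfolding mlin_def
    by (metis add_cancel_right_right add.right_neutral)
  show ?thesis using assms(4)
  proof (induction B rule: finite_induct)
    case empty
    then show ?case using z by simp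
  next
    case (insert b B)
    then show ?case using assms(1-3) by (simp add: mlin_def)
  qed
qed

definition nlists :: "nat \<Rightarrow> 'g :: complex_lie_algebra list set" where
  "nlists p = {bs. set bs \<subseteq> lie_basis \<and> length bs = p}"

lemma finite_nlists: "finite (nlists p)"
  unfolding nlists_def by (rule finite_lists_length_eq[OF lie_basis(3)])

lemma sum_nlists_Suc:
  "(\<Sum>bs\<in>nlists (Suc k). f bs) = (\<Sum>bs\<in>nlists k. \<Sum>b\<in>lie_basis. f (bs @ [b]) :: complex)"
proof -
  have "(\<Sum>bs\<in>nlists (Suc k). f bs) = (\<Sum>(bs, b)\<in>nlists k \<times> lie_basis. f (bs @ [b]))"
    by (rule sum.reindex_bij_witness[of _ "\<lambda>(bs, b). bs @ [b]" "\<lambda>bs. (butlast bs, last bs)"])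
       (auto simp: nlists_def length_Suc_conv_rev dest: in_set_butlastD)
  then show ?thesis by (simp add: sum.cartesian_product)
qed

lemma mlin_expand:
  assumes D: "mlin p D" and xs: "length xs = p"
  shows "D xs = (\<Sum>bs\<in>nlists p. (\<Prod>i<p. dual_vector (bs ! i) (xs ! i)) * D bs)"
proof -
  have "k \<le> p \<Longrightarrow> D xs = (\<Sum>bs\<in>nlists k. (\<Prod>i<k. dual_vector (bs ! i) (xs ! i)) * D (bs @ drop k xs))" for k
  proof (induction k)
    case 0
    have "nlists 0 = {[] :: 'a list}" by (auto simp: nlists_def)
    then show ?case by simp
  next
    case (Suc k)
    have step: "D (bs @ drop k xs) =
        (\<Sum>b\<in>lie_basis. dual_vector b (xs ! k) * D (bs @ [b] @ drop (Suc k) xs))"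
      if "bs \<in> nlists k" for bs
    proof -
      have l: "length bs = k" using that by (simp add: nlists_def)
      have d: "drop k xs = xs ! k # drop (Suc k) xs"
        using Suc.prems xs by (simp add: Cons_nth_drop_Suc)
      have "D (bs @ drop k xs) =
          D ((bs @ drop k xs)[k := (\<Sum>b\<in>lie_basis. dual_vector b (xs ! k) *\<^sub>C b)])"
        unfolding d by (simp add: sum_dual_vector list_update_append flip: l)
      also have "\<dots> = (\<Sum>b\<in>lie_basis. dual_vector b (xs ! k) * D ((bs @ drop k xs)[k := b]))"
        by (rule mlin_sum[OF D]) (use l Suc.prems xs lie_basis in auto)
      also have "\<dots> = (\<Sum>b\<in>lie_basis. dual_vector b (xs ! k) * D (bs @ [b] @ drop (Suc k) xs))"
        unfolding d by (simp add: list_update_append flip: l)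
      finally show ?thesis .
    qed
    have "D xs = (\<Sum>bs\<in>nlists k. (\<Prod>i<k. dual_vector (bs ! i) (xs ! i)) * D (bs @ drop k xs))"
      using Suc by simp
    also have "\<dots> = (\<Sum>bs\<in>nlists k. \<Sum>b\<in>lie_basis. (\<Prod>i<k. dual_vector (bs ! i) (xs ! i)) *
        (dual_vector b (xs ! k) * D (bs @ [b] @ drop (Suc k) xs)))"
      by (rule sum.cong) (auto simp: step sum_distrib_left)
    also have "\<dots> = (\<Sum>bs\<in>nlists (Suc k).
        (\<Prod>i<Suc k. dual_vector (bs ! i) (xs ! i)) * D (bs @ drop (Suc k) xs))"
      unfolding sum_nlists_Suc
      by (intro sum.cong refl) (auto simp: nlists_def nth_append)
    finally show ?case .
  qed
  from this[of p] show ?thesis using xs by simp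
qed

lemma alt_adj_swap:
  assumes D: "mlin p D" "alt_adj p D" and xs: "length xs = p" "Suc i < p"
  shows "D (xs[i := a, Suc i := b]) = - D (xs[i := b, Suc i := a])"
proof -
  have add1: "D (ys[i := x + y]) = D (ys[i := x]) + D (ys[i := y])" if "length ys = p" for ys x y
    using D(1) xs that by (simp add: mlin_def)
  have add2: "D (ys[Suc i := x + y]) = D (ys[Suc i := x]) + D (ys[Suc i := y])"
    if "length ys = p" for ys x y
    using D(1) xs that by (simp add: mlin_def)
  have z: "D (xs[i := x, Suc i := x]) = 0" for x
    using D(2) xs unfolding alt_adj_def
    by (elim allE[of _ "xs[i := x, Suc i := x]"] allE[of _ i]) simp
  have add1': "D (xs[i := x + y, Suc i := w]) = D (xs[i := x, Suc i := w]) + D (xs[i := y, Suc i := w])"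
    for x y w
    using add1[of "xs[Suc i := w]" x y] xs by (simp add: list_update_swap)
  have "0 = D (xs[i := a + b, Suc i := a + b])" by (simp add: z)
  also have "\<dots> = D (xs[i := a, Suc i := b]) + D (xs[i := b, Suc i := a])"
    using z[of a] z[of b] xs by (simp only: add2 length_list_update add1') simp
  finally show ?thesis by (metis eq_neg_iff_add_eq_0)
qed

lemma alt_transpose:
  assumes D: "mlin p D" "alt_adj p D" and "a < b" "b < p"
  shows "D (map (x \<circ> transpose a b) [0..<p]) = - D (map x [0..<p])"
  using assms(3,4)
proof (induction "b - a" arbitrary: a b x rule: less_induct)
  case less
  have adj: "D (map (x \<circ> transpose a (Suc a)) [0..<p]) = - D (map x [0..<p])"
    if "Suc a < p" for a x
  proof -
    have 1: "map (x \<circ> transpose a (Suc a)) [0..<p] = (map x [0..<p])[a := x (Suc a), Suc a := x a]"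
      using that by (intro nth_equalityI) (auto simp: nth_list_update transpose_def)
    have 2: "map x [0..<p] = (map x [0..<p])[a := x a, Suc a := x (Suc a)]"
      using that by (intro nth_equalityI) (auto simp: nth_list_update)
    show ?thesis
      unfolding 1 by (subst (2) 2) (rule alt_adj_swap[OF D], use that in auto)
  qed
  show ?case
  proof (cases "b = Suc a")
    case True
    then show ?thesis using adj less.prems by simp
  next
    case False
    then obtain c where c: "b = Suc c" "a < c" using less.prems by (cases b) auto
    have t: "transpose a b = transpose c b \<circ> transpose a c \<circ> transpose c b"
      using c by (auto simp: fun_eq_iff transpose_def)
    have "D (map (x \<circ> transpose a b) [0..<p]) =
        D (map ((x \<circ> transpose c b \<circ> transpose a c) \<circ> transpose c (Suc c)) [0..<p])"
      unfolding t by (simp add: c comp_assoc)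
    also have "\<dots> = - D (map (x \<circ> transpose c b \<circ> transpose a c) [0..<p])"
      using adj c less.prems by blast
    also have "\<dots> = D (map (x \<circ> transpose c b) [0..<p])"
      using less.hyps[of c a "x \<circ> transpose c b"] c less.prems by simp
    also have "\<dots> = - D (map x [0..<p])"
      using adj c less.prems by simp
    finally show ?thesis .
  qed
qed

lemma alt_permutes:
  assumes D: "mlin p D" "alt_adj p D" and "\<pi> permutes {..<p}"
  shows "D (map (x \<circ> \<pi>) [0..<p]) = of_int (sign \<pi>) * D (map x [0..<p])"
  using assms(3) finite_lessThan
proof (induction arbitrary: x rule: permutes_induct)
  case id
  then show ?case by simp
next
  case (swap a b \<pi>)
  have perm: "permutation \<pi>" using swap by (auto simp: permutation_permutes)
  have "D (map (x \<circ> (transpose a b \<circ> \<pi>)) [0..<p]) = D (map ((x \<circ> transpose a b) \<circ> \<pi>) [0..<p])"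
    by (simp add: comp_assoc)
  also have "\<dots> = of_int (sign \<pi>) * D (map (x \<circ> transpose a b) [0..<p])"
    using swap by blast
  also have "\<dots> = of_int (sign (transpose a b \<circ> \<pi>)) * D (map x [0..<p])"
  proof (cases "a = b")
    case True
    then show ?thesis by simp
  next
    case False
    have "D (map (x \<circ> transpose a b) [0..<p]) = - D (map x [0..<p])"
      using alt_transpose[OF D, of a b x] alt_transpose[OF D, of b a x] False swap
      by (cases "a < b") (auto simp: transpose_commute)
    then show ?thesis
      using False perm by (simp add: sign_compose permutation_swap_id sign_swap_id)
  qed
  finally show ?case .
qed

lemma alt_expand:
  assumes D: "mlin p D" "alt_adj p D" and xs: "length xs = p"
  shows "D xs = (\<Sum>bs\<in>nlists p. wedge xs (map dual_vector bs) / fact p * D bs)"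
proof -
  have "(\<Sum>bs\<in>nlists p. wedge xs (map dual_vector bs) * D bs)
      = (\<Sum>bs\<in>nlists p. \<Sum>\<pi> | \<pi> permutes {..<p}.
          of_int (sign \<pi>) * ((\<Prod>i<p. dual_vector (bs ! i) (xs ! \<pi> i)) * D bs))"
  proof (rule sum.cong)
    fix bs :: "'a list" assume "bs \<in> nlists p"
    then have "length bs = p" by (simp add: nlists_def)
    then show "wedge xs (map dual_vector bs) * D bs = (\<Sum>\<pi> | \<pi> permutes {..<p}.
          of_int (sign \<pi>) * ((\<Prod>i<p. dual_vector (bs ! i) (xs ! \<pi> i)) * D bs))"
      using xs by (auto simp: wedge_def dual_vector_mem sum_distrib_right mult.assoc intro!: sum.cong prod.cong)
  qed simp
  also have "\<dots> = (\<Sum>\<pi> | \<pi> permutes {..<p}. of_int (sign \<pi>) *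
      (\<Sum>bs\<in>nlists p. (\<Prod>i<p. dual_vector (bs ! i) (xs ! \<pi> i)) * D bs))"
    by (subst sum.swap) (simp add: sum_distrib_left)
  also have "\<dots> = (\<Sum>\<pi> | \<pi> permutes {..<p}. D xs)"
  proof (rule sum.cong)
    fix \<pi> assume "\<pi> \<in> {\<pi>. \<pi> permutes {..<p}}"
    then have \<pi>: "\<pi> permutes {..<p}" by simp
    have "(\<Sum>bs\<in>nlists p. (\<Prod>i<p. dual_vector (bs ! i) (xs ! \<pi> i)) * D bs)
        = D (map ((!) xs \<circ> \<pi>) [0..<p])"
      using mlin_expand[OF D(1), of "map ((!) xs \<circ> \<pi>) [0..<p]"] by simp
    also have "\<dots> = of_int (sign \<pi>) * D (map ((!) xs) [0..<p])"
      by (rule alt_permutes[OF D \<pi>])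
    also have "map ((!) xs) [0..<p] = xs" using xs map_nth by blast
    finally have "(\<Sum>bs\<in>nlists p. (\<Prod>i<p. dual_vector (bs ! i) (xs ! \<pi> i)) * D bs) = of_int (sign \<pi>) * D xs" .
    moreover have "(of_int (sign \<pi>) :: complex) * of_int (sign \<pi>) = 1"
      by (simp flip: of_int_mult)
    ultimately show "of_int (sign \<pi>) * (\<Sum>bs\<in>nlists p. (\<Prod>i<p. dual_vector (bs ! i) (xs ! \<pi> i)) * D bs) = D xs"
      by (simp flip: mult.assoc)
  qed simp
  also have "\<dots> = fact p * D xs"
    by (simp add: card_permutations)
  finally have "D xs = (\<Sum>bs\<in>nlists p. wedge xs (map dual_vector bs) * D bs) / fact p"
    by simp
  then show ?thesis by (simp add: sum_divide_distrib)
qed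

lemma alt_repeat:
  assumes D: "mlin p D" "alt_adj p D" and xs: "length xs = p" and "\<not> distinct xs"
  shows "D xs = 0"
proof -
  obtain i j where ij: "i < j" "j < p" "xs ! i = xs ! j"
    using assms(3,4) unfolding distinct_conv_nth by (metis nat_neq_iff)
  have "map ((!) xs \<circ> transpose i j) [0..<p] = map ((!) xs) [0..<p]"
    using ij by (auto simp: transpose_def)
  then have "D (map ((!) xs) [0..<p]) = - D (map ((!) xs) [0..<p])"
    using alt_transpose[OF D ij(1,2), of "(!) xs"] by (simp only:)
  then have "D (map ((!) xs) [0..<p]) = 0" by (simp add: eq_neg_iff_add_eq_0)
  then show ?thesis using xs map_nth by metis
qed

lemma wedge_transposed:
  assumes "length \<xi>s = length xs" "set \<xi>s \<subseteq> dual_space UNIV"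
  shows "wedge xs \<xi>s = (\<Sum>\<pi> | \<pi> permutes {..<length xs}.
     of_int (sign \<pi>) * (\<Prod>i<length xs. (\<xi>s ! \<pi> i) (xs ! i)))"
proof -
  let ?n = "length xs"
  have "wedge xs \<xi>s = (\<Sum>\<pi> | \<pi> permutes {..<?n}.
      of_int (sign (inv \<pi>)) * (\<Prod>i<?n. (\<xi>s ! i) (xs ! inv \<pi> i)))"
    using assms by (simp add: wedge_def)
      (rule sum_permutations_inverse)
  also have "\<dots> = (\<Sum>\<pi> | \<pi> permutes {..<?n}. of_int (sign \<pi>) * (\<Prod>i<?n. (\<xi>s ! \<pi> i) (xs ! i)))"
  proof (rule sum.cong)
    fix \<pi> assume "\<pi> \<in> {\<pi>. \<pi> permutes {..<?n}}"
    then have \<pi>: "\<pi> permutes {..<?n}" by simp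
    have "(\<Prod>i<?n. (\<xi>s ! i) (xs ! inv \<pi> i)) = (\<Prod>i<?n. (\<xi>s ! \<pi> i) (xs ! i))"
      by (subst prod.permute[OF \<pi>]) (simp add: o_def permutes_inverses[OF \<pi>])
    moreover have "sign (inv \<pi>) = sign \<pi>"
      using \<pi> by (intro sign_inverse) (auto simp: permutation_permutes)
    ultimately show "of_int (sign (inv \<pi>)) * (\<Prod>i<?n. (\<xi>s ! i) (xs ! inv \<pi> i))
        = of_int (sign \<pi>) * (\<Prod>i<?n. (\<xi>s ! \<pi> i) (xs ! i))" by simp
  qed simp
  finally show ?thesis .
qed

lemma mlin_wedge: "mlin p (\<lambda>xs. wedge xs \<xi>s)"
proof (cases "length \<xi>s = p \<and> set \<xi>s \<subseteq> dual_space UNIV")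
  case False
  then show ?thesis by (auto simp: mlin_def wedge_def)
next
  case True
  show ?thesis unfolding mlin_def
  proof (intro allI impI, elim conjE)
    fix xs :: "'a list" and k assume k: "length xs = p" "k < p"
    have exp: "wedge (xs[k := x]) \<xi>s = (\<Sum>\<pi> | \<pi> permutes {..<p}. of_int (sign \<pi>) *
        ((\<xi>s ! \<pi> k) x * (\<Prod>i\<in>{..<p} - {k}. (\<xi>s ! \<pi> i) (xs ! i))))" for x
    proof -
      have "(\<Prod>i<p. (\<xi>s ! \<pi> i) (xs[k := x] ! i))
          = (\<xi>s ! \<pi> k) x * (\<Prod>i\<in>{..<p} - {k}. (\<xi>s ! \<pi> i) (xs ! i))" for \<pi>
        using k by (subst prod.remove[of _ k]) (auto intro!: prod.cong)
      then show ?thesis using True k by (simp add: wedge_transposed)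
    qed
    have lin: "(\<xi>s ! \<pi> k) (x + y) = (\<xi>s ! \<pi> k) x + (\<xi>s ! \<pi> k) y"
       "(\<xi>s ! \<pi> k) (c *\<^sub>C x) = c * (\<xi>s ! \<pi> k) x" if "\<pi> permutes {..<p}" for \<pi> x y c
    proof -
      have "\<pi> k < p" using permutes_in_image[OF that, of k] k by simp
      then have "\<xi>s ! \<pi> k \<in> dual_space UNIV" using True by (metis nth_mem subsetD)
      then show "(\<xi>s ! \<pi> k) (x + y) = (\<xi>s ! \<pi> k) x + (\<xi>s ! \<pi> k) y"
       "(\<xi>s ! \<pi> k) (c *\<^sub>C x) = c * (\<xi>s ! \<pi> k) x" by (simp_all add: dual_space_def)
    qed
    show "(\<forall>x y. wedge (xs[k := x + y]) \<xi>s = wedge (xs[k := x]) \<xi>s + wedge (xs[k := y]) \<xi>s) \<and>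
       (\<forall>c x. wedge (xs[k := c *\<^sub>C x]) \<xi>s = c * wedge (xs[k := x]) \<xi>s)"
      unfolding exp
      by (auto simp: lin sum.distrib[symmetric] sum_distrib_left algebra_simps intro!: sum.cong)
  qed
qed

lemma alt_adj_wedge: "alt_adj p (\<lambda>xs. wedge xs \<xi>s)"
  unfolding alt_adj_def
proof (intro allI impI, elim conjE)
  fix xs :: "'a list" and k
  assume xs: "length xs = p" and k: "Suc k < p" "xs ! k = xs ! Suc k"
  show "wedge xs \<xi>s = 0"
  proof (cases "length \<xi>s = p \<and> set \<xi>s \<subseteq> dual_space UNIV")
    case False
    then show ?thesis using xs by (auto simp: wedge_def)
  next
    case True
    let ?t = "transpose k (Suc k)"
    have t: "?t permutes {..<p}" using k by (intro permutes_swap_id) auto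
    have "wedge xs \<xi>s = (\<Sum>\<pi> | \<pi> permutes {..<p}.
        of_int (sign (?t \<circ> \<pi>)) * (\<Prod>i<p. (\<xi>s ! i) (xs ! (?t \<circ> \<pi>) i)))"
      using True xs by (simp add: wedge_def del: o_apply)
        (rule setum_permutations_compose_left[OF t])
    also have "\<dots> = (\<Sum>\<pi> | \<pi> permutes {..<p}.
        - (of_int (sign \<pi>) * (\<Prod>i<p. (\<xi>s ! i) (xs ! \<pi> i))))"
    proof (rule sum.cong)
      fix \<pi> assume "\<pi> \<in> {\<pi>. \<pi> permutes {..<p}}"
      then have "permutation \<pi>" by (auto simp: permutation_permutes)
      then have "sign (?t \<circ> \<pi>) = - sign \<pi>"
        by (simp add: sign_compose permutation_swap_id sign_swap_id)
      moreover have "xs ! (?t \<circ> \<pi>) i = xs ! \<pi> i" for i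
        using k by (auto simp: transpose_def)
      ultimately show "of_int (sign (?t \<circ> \<pi>)) * (\<Prod>i<p. (\<xi>s ! i) (xs ! (?t \<circ> \<pi>) i))
          = - (of_int (sign \<pi>) * (\<Prod>i<p. (\<xi>s ! i) (xs ! \<pi> i)))" by simp
    qed simp
    also have "\<dots> = - wedge xs \<xi>s"
      using True xs by (simp add: wedge_def sum_negf)
    finally show ?thesis by (simp add: eq_neg_iff_add_eq_0)
  qed
qed

lemma wedge_repeat: "\<not> distinct xs \<Longrightarrow> wedge xs \<xi>s = 0"
  using alt_repeat[OF mlin_wedge alt_adj_wedge] by blast

lemma mlin_sum_fun: "(\<And>a. a \<in> A \<Longrightarrow> mlin p (D a)) \<Longrightarrow> mlin p (\<lambda>xs. \<Sum>a\<in>A. c a * D a xs)"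
  unfolding mlin_def by (simp add: sum.distrib[symmetric] sum_distrib_left algebra_simps)

lemma alt_adj_sum_fun: "(\<And>a. a \<in> A \<Longrightarrow> alt_adj p (D a)) \<Longrightarrow> alt_adj p (\<lambda>xs. \<Sum>a\<in>A. c a * D a xs)"
  unfolding alt_adj_def by simp

lemma length_omit [simp]: "i < length xs \<Longrightarrow> length (omit i xs) = length xs - 1"
  by (simp add: omit_def)

lemma nth_omit: "i < length xs \<Longrightarrow> m < length xs - 1 \<Longrightarrow>
    omit i xs ! m = (if m < i then xs ! m else xs ! Suc m)"
  by (auto simp: omit_def nth_append)

lemma omit_update:
  assumes "i < length xs" "k < length xs" "i \<noteq> k"
  shows "omit i (xs[k := x]) = (omit i xs)[(if k < i then k else k - 1) := x]"
  using assms by (intro nth_equalityI) (auto simp: nth_omit nth_list_update)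

lemma omit_update_same: "omit i (xs[i := x]) = omit i xs"
  by (simp add: omit_def)

definition contr :: "('g :: complex_lie_algebra \<Rightarrow> 'g) \<Rightarrow> 'g list \<Rightarrow> 'g list \<Rightarrow> ('g \<Rightarrow> complex) list
    \<Rightarrow> 'g list \<Rightarrow> complex" where
  "contr f pre post \<xi>s xs = (\<Sum>i<length xs.
     (- 1) ^ i * wedge (f (xs ! i) # pre @ omit i xs @ post) \<xi>s)"

lemma mlin_contr:
  assumes f: "\<And>x y. f (x + y) = f x + f y" "\<And>c x. f (c *\<^sub>C x) = c *\<^sub>C f x"
  shows "mlin p (contr f pre post \<xi>s)"
proof -
  have wadd: "wedge (ys[i := x + y]) \<xi>s = wedge (ys[i := x]) \<xi>s + wedge (ys[i := y]) \<xi>s"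
    and wsc: "wedge (ys[i := c *\<^sub>C x]) \<xi>s = c * wedge (ys[i := x]) \<xi>s"
    if "i < length ys" for ys :: "'a list" and i x y c
    using mlin_wedge[of "length ys" \<xi>s] that by (simp_all add: mlin_def)
  have "mlin p (\<lambda>xs. wedge (f (xs ! i) # pre @ omit i xs @ post) \<xi>s)" (is "mlin p ?W")
    if "i < p" for i
    unfolding mlin_def
  proof (intro allI impI, elim conjE)
    fix xs :: "'a list" and k assume k: "length xs = p" "k < p"
    show "(\<forall>x y. ?W (xs[k := x + y]) = ?W (xs[k := x]) + ?W (xs[k := y]))
        \<and> (\<forall>c x. ?W (xs[k := c *\<^sub>C x]) = c * ?W (xs[k := x]))"
    proof (cases "k = i")
      case True
      have "?W (xs[k := x]) = wedge ((0 # pre @ omit i xs @ post)[0 := f x]) \<xi>s" for x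
        using True k by (simp add: omit_update_same)
      then show ?thesis by (simp only: f wadd wsc length_Cons) simp
    next
      case False
      define m where "m = (if k < i then k else k - 1)"
      have m: "m < length (omit i xs)" using False k that by (auto simp: m_def)
      have eq: "?W (xs[k := x]) =
          wedge ((f (xs ! i) # pre @ omit i xs @ post)[Suc (length pre + m) := x]) \<xi>s" for x
        using False k that m
        by (simp add: omit_update m_def[symmetric] list_update_append)
      have "Suc (length pre + m) < length (f (xs ! i) # pre @ omit i xs @ post)"
        using m by simp
      then show ?thesis unfolding eq by (simp only: wadd wsc) simp
    qed
  qed
  then have "mlin p (\<lambda>xs. \<Sum>i<p. (- 1) ^ i * wedge (f (xs ! i) # pre @ omit i xs @ post) \<xi>s)"
    by (intro mlin_sum_fun) simp
  then show ?thesis by (simp add: mlin_def contr_def)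
qed

lemma alt_adj_contr: "alt_adj p (contr f pre post \<xi>s)"
  unfolding alt_adj_def
proof (intro allI impI, elim conjE)
  fix xs :: "'a list" and k
  assume xs: "length xs = p" and k: "Suc k < p" "xs ! k = xs ! Suc k"
  let ?g = "\<lambda>i. (- 1) ^ i * wedge (f (xs ! i) # pre @ omit i xs @ post) \<xi>s"
  have z: "?g i = 0" if i: "i \<in> {..<p} - {k, Suc k}" for i
  proof -
    define m where "m = (if k < i then k else k - 1)"
    have m: "Suc m < length (omit i xs)" "omit i xs ! m = omit i xs ! Suc m"
      using i xs k by (auto simp: m_def nth_omit)
    then have "\<not> distinct (omit i xs)"
      by (metis Suc_lessD n_not_Suc_n nth_eq_iff_index_eq)
    then show ?thesis by (simp add: wedge_repeat)
  qed
  have "omit k xs = omit (Suc k) xs"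
    using xs k by (intro nth_equalityI) (auto simp: nth_omit less_Suc_eq)
  then have c: "?g k + ?g (Suc k) = 0" using k by simp
  have "contr f pre post \<xi>s xs = (\<Sum>i<p. ?g i)" by (simp add: contr_def xs)
  also have "\<dots> = (\<Sum>i\<in>{k, Suc k}. ?g i)"
    by (rule sum.mono_neutral_right) (use k z in auto)
  also have "\<dots> = 0" using c by simp
  finally show "contr f pre post \<xi>s xs = 0" .
qed

lemma sum_apply: "(\<Sum>a\<in>A. u a) \<xi>s = (\<Sum>a\<in>A. u a \<xi>s :: complex)"
  by (induction A rule: infinite_finite_induct) auto

lemma schouten_decomp_left: "schouten_decomp xs ys \<xi>s =
    (\<Sum>j<length ys. (- 1) ^ j * contr (\<lambda>x. lie x (ys ! j)) [] (omit j ys) \<xi>s xs)"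
  unfolding schouten_decomp_def contr_def
  by (subst sum.swap) (simp add: sum_apply fscale_def sum_distrib_left power_add algebra_simps)

lemma schouten_decomp_right: "schouten_decomp xs ys \<xi>s =
    (\<Sum>i<length xs. (- 1) ^ i * contr (lie (xs ! i)) (omit i xs) [] \<xi>s ys)"
  unfolding schouten_decomp_def contr_def
  by (simp add: sum_apply fscale_def sum_distrib_left power_add algebra_simps)

lemma schouten_decomp_mlin:
  "mlin p (\<lambda>xs. schouten_decomp xs ys \<xi>s)" "alt_adj p (\<lambda>xs. schouten_decomp xs ys \<xi>s)"
  "mlin q (\<lambda>ys. schouten_decomp xs ys \<xi>s)" "alt_adj q (\<lambda>ys. schouten_decomp xs ys \<xi>s)"
  unfolding schouten_decomp_left
   apply (intro mlin_sum_fun mlin_contr, simp_all add: lie_add_left lie_scaleC_left)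
  apply (intro alt_adj_sum_fun alt_adj_contr)
  unfolding schouten_decomp_left[symmetric] schouten_decomp_right
  apply (intro mlin_sum_fun mlin_contr, simp_all add: lie_add_right lie_scaleC_right)
  apply (intro alt_adj_sum_fun alt_adj_contr)
  done

lemma alt_expand_basis_lists:
  fixes xs :: "'a :: complex_lie_algebra list"
  assumes D: "mlin (length xs) D" "alt_adj (length xs) D"
  shows "(\<Sum>bs\<in>basis_lists. wedge xs (map dual_vector bs) / fact (length bs) * D bs) = D xs"
proof -
  let ?p = "length xs"
  let ?g = "\<lambda>bs. wedge xs (map dual_vector bs) / fact (length bs) * D bs"
  have fin: "finite (basis_lists :: 'a list set)"
    unfolding basis_lists_def by (rule finite_lists_length_le[OF lie_basis(3)])
  have "(\<Sum>bs\<in>basis_lists. ?g bs) = (\<Sum>bs\<in>basis_lists \<inter> nlists ?p. ?g bs)"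
    by (rule sum.mono_neutral_right[OF fin])
       (auto simp: basis_lists_def nlists_def wedge_def)
  also have "\<dots> = (\<Sum>bs\<in>nlists ?p. ?g bs)"
  proof (rule sum.mono_neutral_left[OF finite_nlists])
    show "\<forall>bs\<in>nlists ?p - basis_lists \<inter> nlists ?p. ?g bs = 0"
    proof
      fix bs :: "'a list" assume bs: "bs \<in> nlists ?p - basis_lists \<inter> nlists ?p"
      then have "card (set bs) < length bs"
        using card_mono[OF lie_basis(3), of "set bs"] by (auto simp: basis_lists_def nlists_def)
      then have "\<not> distinct bs" by (metis distinct_card less_irrefl)
      then have "D bs = 0" using alt_repeat[OF D, of bs] bs by (simp add: nlists_def)
      then show "?g bs = 0" by simp
    qed
  qed simp
  also have "\<dots> = (\<Sum>bs\<in>nlists ?p. wedge xs (map dual_vector bs) / fact ?p * D bs)"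
    by (rule sum.cong) (auto simp: nlists_def)
  also have "\<dots> = D xs" using alt_expand[OF D refl] by simp
  finally show ?thesis .
qed

theorem schouten_wedge: "schouten (wedge xs) (wedge ys) = schouten_decomp xs ys"
proof
  fix \<xi>s
  have "schouten (wedge xs) (wedge ys) \<xi>s =
      (\<Sum>bs\<in>basis_lists. wedge xs (map dual_vector bs) / fact (length bs) *
        (\<Sum>cs\<in>basis_lists. wedge ys (map dual_vector cs) / fact (length cs) * schouten_decomp bs cs \<xi>s))"
    unfolding schouten_def by (simp add: sum_apply fscale_def sum_distrib_left algebra_simps)
  also have "\<dots> = (\<Sum>bs\<in>basis_lists. wedge xs (map dual_vector bs) / fact (length bs) *
      schouten_decomp bs ys \<xi>s)"
    by (simp only: alt_expand_basis_lists[OF schouten_decomp_mlin(3,4)])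
  also have "\<dots> = schouten_decomp xs ys \<xi>s"
    by (rule alt_expand_basis_lists[OF schouten_decomp_mlin(1,2)])
  finally show "schouten (wedge xs) (wedge ys) \<xi>s = schouten_decomp xs ys \<xi>s" .
qed

end

theory Submission
  imports Defs
begin

text \<open>Invariant brackets are the bivectors \<open>\<Sum> c\<^sub>\<alpha> E\<^sub>\<alpha> \<and> E\<^sub>-\<^sub>\<alpha>\<close> whose coefficients are odd in \<open>\<alpha>\<close>, vanish on
  the Levi roots and do not change when a Levi root is added to \<open>\<alpha>\<close> (\<open>invariant_bracket_coefs\<close>,
  \<open>bivector_invariant\<close>). Covectors are \<open>\<kappa>(\<cdot>, y)\<close> for the Killing form \<open>\<kappa>\<close>, and in these terms the
  Schouten bracket of two such bivectors is supported on triples of roots with sum zero; so the two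
  conditions on \<open>f\<close> become equations for each pair \<open>\<alpha>, \<beta>\<close> with \<open>\<alpha>, \<beta>, \<alpha> + \<beta>\<close> outside the Levi roots
  (\<open>orbit_schouten_iff\<close>).

  Write \<open>\<lambda>\<close> for the linear form of the orbit. The equation for \<open>\<lbrakk>f, v\<rbrakk> = 0\<close> says that \<open>c \<lambda>\<^sup>2\<close> is additive
  on such pairs (\<open>kks_triple_sum\<close>); given this, \<open>\<lbrakk>f, f\<rbrakk> = K\<^sup>2 \<phi>\<close> says that
  \<open>c\<^sub>\<alpha> \<lambda>(\<alpha>) - c\<^sub>\<beta> \<lambda>(\<beta>) = \<plusminus>K \<lambda>(\<alpha> + \<beta>)\<close> (\<open>solution_square\<close>), and the right side is not zero. If \<open>c\<close> and
  \<open>d\<close> are two solutions, then for each pair exactly one of the functions \<open>(c - d) \<lambda>\<close> and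
  \<open>(c + d) \<lambda>\<close> takes the same value at \<open>\<alpha>\<close> and \<open>\<beta>\<close>. By the Jacobi identity the same one of them works
  for all pairs through a given root (\<open>no_mixed_root\<close>), and because the algebra is simple it
  is constant on all roots outside the Levi roots (\<open>roots_exhausted\<close>, \<open>averaging_dichotomy\<close>). As the
  coefficients of \<open>v\<close> are \<open>1 / \<lambda>\<close>, this says \<open>c = \<plusminus>d + s / \<lambda>\<close>. Conversely \<open>\<lbrakk>v, v\<rbrakk> = 0\<close>, so the whole
  family consists of solutions. A bracket is nondegenerate when none of its coefficients vanishes,
  and each of the finitely many roots excludes one value of \<open>s\<close>.

  The facts about roots that this uses are proved first. The Killing form is nondegenerate
  without Cartan's criterion: it is not zero, because root vectors are normalized by it, and its
  radical is an ideal. One calculation with root strings gives that root spaces are lines and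
  that \<open>[E\<^sub>\<alpha>, E\<^sub>\<beta>] \<noteq> 0\<close> when \<open>\<alpha> + \<beta>\<close> is a root. Independence of the simple roots makes the
  projection to quasiroots and the description of the Levi subalgebra by roots possible.\<close>

section \<open>Lie brackets, traces and the Killing form\<close>

lemma lie_hom: "module_hom scaleC scaleC (lie x)"
  by unfold_locales (simp_all add: lie_add_right lie_scaleC_right)

lemma lie_hom_left: "module_hom scaleC scaleC (\<lambda>x. lie x y)"
  by unfold_locales (simp_all add: lie_add_left lie_scaleC_left)

lemmas lie_zero_right [simp] = module_hom.zero[OF lie_hom]
lemmas lie_zero_left [simp] = module_hom.zero[OF lie_hom_left]
lemmas lie_minus_right = module_hom.neg[OF lie_hom]
lemmas lie_minus_left = module_hom.neg[OF lie_hom_left]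
lemmas lie_diff_right = module_hom.diff[OF lie_hom]
lemmas lie_sum_right = module_hom.sum[OF lie_hom]
lemmas lie_sum_left = module_hom.sum[OF lie_hom_left]

lemma lie_swap: "lie x y = - lie (y :: 'a :: complex_lie_algebra) x"
proof -
  have "lie (x + y) (x + y) = lie x y + lie y x"
    using lie_self[of x] lie_self[of y] by (simp only: lie_add_left lie_add_right) simp
  then show ?thesis by (simp add: lie_self eq_neg_iff_add_eq_0)
qed

lemma lie_derivation: "lie x (lie y z) = lie (lie x y) z + lie y (lie (x :: 'a :: complex_lie_algebra) z)"
proof -
  have "lie z (lie x y) = - lie (lie x y) z" and "lie y (lie z x) = - lie y (lie x z)"
    using lie_swap[of z "lie x y"] lie_swap[of z x] by (simp_all add: lie_minus_right)
  then show ?thesis using jacobi[of x y z] by (simp add: algebra_simps)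
qed

lemma dual_space_hom:
  assumes "\<xi> \<in> dual_space (UNIV :: 'a :: complex_lie_algebra set)"
  shows "module_hom scaleC (*) \<xi>"
  using assms by unfold_locales (auto simp: dual_space_def algebra_simps)

lemma hom_dual_space: "module_hom scaleC (*) \<xi> \<Longrightarrow> \<xi> \<in> dual_space UNIV"
  by (simp add: dual_space_def module_hom.add module_hom.scale)

lemma functional_expand:
  assumes "module_hom scaleC (*) \<xi>"
  shows "\<xi> x = (\<Sum>b\<in>lie_basis. dual_vector b x * \<xi> b)"
  by (subst (1) sum_dual_vector[of x, symmetric])
    (simp add: module_hom.sum[OF assms] module_hom.scale[OF assms])

lemma endo_trace_commute:
  fixes S T :: "'a :: complex_lie_algebra \<Rightarrow> 'a"
  assumes "module_hom scaleC scaleC S" "module_hom scaleC scaleC T"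
  shows "endo_trace (\<lambda>x. S (T x)) = endo_trace (\<lambda>x. T (S x))"
proof -
  have e: "dual_vector b (S (T x)) = (\<Sum>c\<in>lie_basis. dual_vector c (T x) * dual_vector b (S c))"
    if "module_hom scaleC scaleC S" for S T :: "'a \<Rightarrow> 'a" and b x
    by (subst (1) sum_dual_vector[of "T x", symmetric])
      (simp add: module_hom.sum[OF that] module_hom.scale[OF that]
        module_hom.sum[OF dual_space_hom[OF dual_vector_mem]]
        module_hom.scale[OF dual_space_hom[OF dual_vector_mem]])
  show ?thesis unfolding endo_trace_def e[OF assms(1)] e[OF assms(2)]
    by (subst sum.swap) (simp add: mult.commute)
qed

lemma endo_trace_add: "endo_trace (\<lambda>x. S x + T x) = endo_trace S + endo_trace T"
  by (simp add: endo_trace_def sum.distrib module_hom.add[OF dual_space_hom[OF dual_vector_mem]])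

lemma endo_trace_scale: "endo_trace (\<lambda>x. c *\<^sub>C T x) = c * endo_trace T"
  by (simp add: endo_trace_def sum_distrib_left module_hom.scale[OF dual_space_hom[OF dual_vector_mem]])

lemma endo_trace_zero: "endo_trace (\<lambda>x. 0) = 0"
  by (simp add: endo_trace_def module_hom.zero[OF dual_space_hom[OF dual_vector_mem]])

lemma endo_trace_sum: "endo_trace (\<lambda>x. \<Sum>a\<in>A. T a x) = (\<Sum>a\<in>A. endo_trace (T a))"
  by (induction A rule: infinite_finite_induct) (simp_all add: endo_trace_add endo_trace_zero)

lemma endo_trace_rank_one:
  assumes "module_hom scaleC (*) \<xi>"
  shows "endo_trace (\<lambda>x. \<xi> x *\<^sub>C e) = \<xi> e"
  unfolding functional_expand[OF assms, of e] endo_trace_def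
  by (simp add: mult.commute module_hom.scale[OF dual_space_hom[OF dual_vector_mem]])

lemma killing_sym: "killing x y = killing y x"
  unfolding killing_def by (rule endo_trace_commute[OF lie_hom lie_hom])

lemma killing_hom_left: "module_hom scaleC (*) (\<lambda>x. killing x y)"
  by unfold_locales (simp_all add: killing_def lie_add_left lie_scaleC_left
      endo_trace_add endo_trace_scale algebra_simps)

lemma killing_hom: "module_hom scaleC (*) (killing x)"
  by (subst killing_sym[abs_def]) (rule killing_hom_left)

lemmas killing_simps =
  module_hom.add[OF killing_hom] module_hom.scale[OF killing_hom] module_hom.zero[OF killing_hom]
  module_hom.neg[OF killing_hom] module_hom.diff[OF killing_hom] module_hom.sum[OF killing_hom]
  module_hom.add[OF killing_hom_left] module_hom.scale[OF killing_hom_left]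
  module_hom.zero[OF killing_hom_left] module_hom.neg[OF killing_hom_left]
  module_hom.diff[OF killing_hom_left] module_hom.sum[OF killing_hom_left]

lemma killing_invariant: "killing (lie x y) z = killing x (lie y z)"
proof -
  have eq: "lie (lie x y) w = lie x (lie y w) + (-1) *\<^sub>C lie y (lie x w)" for w
    using lie_derivation[of x y w] by (simp add: algebra_simps)
  have hom: "module_hom scaleC scaleC (\<lambda>w. lie x (lie z w))"
    by unfold_locales (simp_all add: lie_add_right lie_scaleC_right)
  have eq': "lie x (lie (lie y z) w) = lie x (lie y (lie z w)) + (-1) *\<^sub>C lie x (lie z (lie y w))" for w
    using lie_derivation[of y z w] by (simp add: lie_add_right)
  have "endo_trace (\<lambda>w. lie y (lie x (lie z w))) = endo_trace (\<lambda>w. lie x (lie z (lie y w)))"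
    by (rule endo_trace_commute[OF lie_hom hom])
  then show ?thesis
    unfolding killing_def eq eq' by (simp only: endo_trace_add endo_trace_scale)
qed

text \<open>In finite dimension nondegeneracy gives an isomorphism with the dual space. To apply the theorem
  that an injective endomorphism is surjective, covectors are transported to vectors by sending
  a dual basis vector to the basis vector.\<close>

lemma killing_surj:
  fixes \<xi> :: "'a :: complex_lie_algebra \<Rightarrow> complex"
  assumes nondeg: "\<And>y :: 'a. (\<And>x. killing x y = 0) \<Longrightarrow> y = 0"
    and \<xi>: "\<xi> \<in> dual_space UNIV"
  shows "\<exists>y. \<xi> = (\<lambda>x. killing x y)"
proof -
  interpret fd: finite_dimensional_vector_space "scaleC :: complex \<Rightarrow> 'a \<Rightarrow> 'a" lie_basis
    by unfold_locales (auto simp: lie_basis)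
  define \<Phi> where "\<Phi> y = (\<Sum>b\<in>lie_basis. killing b y *\<^sub>C b)" for y :: 'a
  have lin: "Vector_Spaces.linear scaleC scaleC \<Phi>"
    by unfold_locales (simp_all add: \<Phi>_def killing_simps scaleC_add_left sum.distrib
        clie.scale_sum_right scaleC_scaleC)
  have ind: "c b = d b" if eq: "(\<Sum>b\<in>lie_basis. c b *\<^sub>C b) = (\<Sum>b\<in>lie_basis. d b *\<^sub>C b)"
    and b: "b \<in> lie_basis" for c d :: "'a \<Rightarrow> complex" and b
  proof -
    have "(\<Sum>b\<in>lie_basis. (c b - d b) *\<^sub>C b) = 0"
      using eq by (simp add: clie.scale_left_diff_distrib sum_subtractf)
    then show ?thesis
      using clie.independentD[OF lie_basis(1) lie_basis(3) subset_refl, of "\<lambda>b. c b - d b"] b by auto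
  qed
  have "inj \<Phi>"
  proof (rule injI)
    fix u w assume "\<Phi> u = \<Phi> w"
    define y where "y = u - w"
    have "\<Phi> y = 0"
      using \<open>\<Phi> u = \<Phi> w\<close> by (simp add: y_def \<Phi>_def killing_simps clie.scale_left_diff_distrib sum_subtractf)
    then have "killing b y = 0" if "b \<in> lie_basis" for b
      using ind[of "\<lambda>b. killing b y" "\<lambda>_. 0"] that by (simp add: \<Phi>_def)
    then have "killing x y = 0" for x
      by (subst functional_expand[OF killing_hom_left]) simp
    then have "y = 0" by (rule nondeg)
    then show "u = w" by (simp add: y_def)
  qed
  then have "surj \<Phi>" using fd.linear_inj_imp_surj[OF lin] by blast
  then obtain y where y: "\<Phi> y = (\<Sum>b\<in>lie_basis. \<xi> b *\<^sub>C b)" by (metis surjD)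
  have "\<xi> x = killing x y" for x
    unfolding functional_expand[OF dual_space_hom[OF \<xi>], of x]
      functional_expand[OF killing_hom_left, of x y]
    using ind[of "\<lambda>b. killing b y" \<xi>] y by (simp add: \<Phi>_def)
  then show ?thesis by blast
qed

lemma lie_generated_base: "x \<in> A \<Longrightarrow> x \<in> lie_generated A"
  by (auto simp: lie_generated_def)

lemma lie_subalgebra_generated: "lie_subalgebra (lie_generated A)"
  by (auto simp: lie_subalgebra_def lie_generated_def clie.subspace_def)

lemma lie_generated_least: "lie_subalgebra S \<Longrightarrow> A \<subseteq> S \<Longrightarrow> lie_generated A \<subseteq> S"
  by (auto simp: lie_generated_def)

text \<open>The elements that the derivation \<open>ad x\<close> sends into the generated subalgebra form a subalgebra.\<close>

lemma lie_generated_normalized: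
  assumes gen: "\<And>y. y \<in> A \<Longrightarrow> lie x y \<in> lie_generated A" and y: "y \<in> lie_generated A"
  shows "lie x y \<in> lie_generated A"
proof -
  let ?J = "lie_generated A"
  have J: "clie.subspace ?J" "\<And>u v. u \<in> ?J \<Longrightarrow> v \<in> ?J \<Longrightarrow> lie u v \<in> ?J"
    using lie_subalgebra_generated[of A] by (auto simp: lie_subalgebra_def)
  have "lie_subalgebra {y \<in> ?J. lie x y \<in> ?J}"
    unfolding lie_subalgebra_def
    by (auto simp: clie.subspace_def lie_add_right lie_scaleC_right lie_derivation[of x]
        clie.subspace_0[OF J(1)] clie.subspace_add[OF J(1)] clie.subspace_scale[OF J(1)] J(2))
  then have "?J \<subseteq> {y \<in> ?J. lie x y \<in> ?J}"
    by (rule lie_generated_least) (auto simp: gen lie_generated_base)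
  then show ?thesis using y by blast
qed

section \<open>Weight spaces\<close>

lemma root_space_subspace: "clie.subspace (root_space S \<alpha>)"
  by (auto simp: clie.subspace_def root_space_def lie_add_right lie_scaleC_right
      scaleC_add_right scaleC_scaleC mult.commute)

lemma lie_root_space:
  assumes "x \<in> root_space S \<alpha>" "y \<in> root_space S \<beta>"
  shows "lie x y \<in> root_space S (\<alpha> + \<beta>)"
  using assms by (auto simp: root_space_def lie_derivation[of _ x y] lie_scaleC_left
      lie_scaleC_right scaleC_add_left)

text \<open>Applying \<open>ad h - \<delta>(h)\<close> to a vanishing sum removes the term of weight \<open>\<delta>\<close> and multiplies that of
  weight \<open>\<beta>\<close> by \<open>\<beta>(h) - \<delta>(h)\<close>, so induction on the number of weights applies. The set \<open>S\<close> may be a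
  single element, which gives the independence of eigenspaces.\<close>

lemma root_space_sum_zero:
  assumes "finite A" and "\<And>\<alpha>. \<alpha> \<in> A \<Longrightarrow> x \<alpha> \<in> root_space S \<alpha>"
    and "\<And>\<alpha> \<beta>. \<alpha> \<in> A \<Longrightarrow> \<beta> \<in> A \<Longrightarrow> \<alpha> \<noteq> \<beta> \<Longrightarrow> \<exists>h\<in>S. \<alpha> h \<noteq> \<beta> h"
    and "(\<Sum>\<alpha>\<in>A. x \<alpha>) = 0" and "\<alpha> \<in> A"
  shows "x \<alpha> = 0"
  using assms
proof (induction A arbitrary: x \<alpha> rule: finite_induct)
  case empty
  then show ?case by simp
next
  case (insert \<delta> A)
  have s: "x \<delta> + (\<Sum>\<alpha>\<in>A. x \<alpha>) = 0" using insert by simp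
  have z: "x \<beta> = 0" if \<beta>: "\<beta> \<in> A" for \<beta>
  proof -
    obtain h where h: "h \<in> S" "\<beta> h \<noteq> \<delta> h"
      using insert.prems(2)[of \<beta> \<delta>] \<beta> insert.hyps(2) by auto
    define y where "y \<alpha> = (\<alpha> h - \<delta> h) *\<^sub>C x \<alpha>" for \<alpha>
    have l: "lie h (x \<alpha>) = \<alpha> h *\<^sub>C x \<alpha>" if "\<alpha> \<in> insert \<delta> A" for \<alpha>
      using insert.prems(1)[OF that] h(1) by (simp add: root_space_def)
    have "(\<Sum>\<alpha>\<in>A. y \<alpha>) = (\<Sum>\<alpha>\<in>A. lie h (x \<alpha>)) - \<delta> h *\<^sub>C (\<Sum>\<alpha>\<in>A. x \<alpha>)"
      by (simp add: y_def l clie.scale_left_diff_distrib sum_subtractf clie.scale_sum_right)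
    also have "\<dots> = lie h (\<Sum>\<alpha>\<in>A. x \<alpha>) - \<delta> h *\<^sub>C (\<Sum>\<alpha>\<in>A. x \<alpha>)"
      by (simp add: lie_sum_right)
    also have "(\<Sum>\<alpha>\<in>A. x \<alpha>) = - x \<delta>" using s by (simp add: eq_neg_iff_add_eq_0 add.commute)
    finally have "(\<Sum>\<alpha>\<in>A. y \<alpha>) = 0" by (simp add: lie_minus_right l)
    have "y \<beta> = 0"
    proof (rule insert.IH)
      show "y \<alpha> \<in> root_space S \<alpha>" if "\<alpha> \<in> A" for \<alpha>
        unfolding y_def by (rule clie.subspace_scale[OF root_space_subspace])
          (rule insert.prems(1)[OF insertI2[OF that]])
      show "\<exists>h\<in>S. \<alpha> h \<noteq> \<beta> h" if "\<alpha> \<in> A" "\<beta> \<in> A" "\<alpha> \<noteq> \<beta>" for \<alpha> \<beta>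
        by (rule insert.prems(2)) (use that in simp_all)
    qed (fact \<open>(\<Sum>\<alpha>\<in>A. y \<alpha>) = 0\<close>, fact \<beta>)
    then show ?thesis using h(2) by (simp add: y_def)
  qed
  then have "x \<delta> = 0" using s by simp
  then show ?case using z insert.prems(4) by blast
qed

lemma root_space_unique:
  assumes "x \<in> root_space S \<alpha>" "x \<in> root_space S \<beta>" "h \<in> S" "\<alpha> h \<noteq> \<beta> h"
  shows "x = 0"
proof -
  have "(\<alpha> h - \<beta> h) *\<^sub>C x = 0"
    using assms by (auto simp: root_space_def clie.scale_left_diff_distrib)
  then show ?thesis using assms(4) by simp
qed

lemma eigen_decomp:
  assumes "x \<in> clie.span {x. \<exists>c. lie h x = c *\<^sub>C x}"
  shows "\<exists>M X. finite M \<and> x = (\<Sum>\<mu>\<in>M. X \<mu>) \<and> (\<forall>\<mu>. lie h (X \<mu>) = \<mu> *\<^sub>C X \<mu>)"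
  using assms
proof (induction rule: clie.span_induct_alt)
  case base
  then show ?case by (intro exI[of _ "{}"] exI[of _ "\<lambda>_. 0"]) simp
next
  case (step c x y)
  obtain \<nu> where \<nu>: "lie h x = \<nu> *\<^sub>C x" using step by blast
  obtain M Y where Y: "finite M" "y = (\<Sum>\<mu>\<in>M. Y \<mu>)" "\<And>\<mu>. lie h (Y \<mu>) = \<mu> *\<^sub>C Y \<mu>"
    using step by blast
  define Y' where "Y' \<mu> = (if \<mu> \<in> M then Y \<mu> else 0)" for \<mu>
  have y: "y = (\<Sum>\<mu>\<in>insert \<nu> M. Y' \<mu>)"
    unfolding Y(2) Y'_def by (rule sum.mono_neutral_cong_left) (use Y(1) in auto)
  define Z where "Z \<mu> = (if \<mu> = \<nu> then c *\<^sub>C x else 0) + Y' \<mu>" for \<mu>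
  have "c *\<^sub>C x + y = (\<Sum>\<mu>\<in>insert \<nu> M. Z \<mu>)"
    unfolding y Z_def sum.distrib using Y(1) by (subst sum.delta) auto
  moreover have "lie h (Z \<mu>) = \<mu> *\<^sub>C Z \<mu>" for \<mu>
    using \<nu> Y(3)[of \<mu>] by (auto simp: Z_def Y'_def lie_add_right lie_scaleC_right scaleC_add_right
        scaleC_scaleC mult.commute)
  ultimately show ?case using Y(1)
    by (intro exI[of _ "insert \<nu> M"] exI[of _ Z] conjI allI) (assumption | simp)+
qed

text \<open>If \<open>x\<close> is an eigenvector of \<open>ad b\<close> and \<open>[h, b] = 0\<close>, then the components of \<open>x\<close> in the eigenspaces
  of \<open>ad h\<close> are again eigenvectors of \<open>ad b\<close> with the same eigenvalue: \<open>ad b\<close> preserves these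
  eigenspaces, which are independent.\<close>

lemma simultaneous_eigenvectors_span:
  assumes "finite B" and comm: "\<And>h k. h \<in> B \<Longrightarrow> k \<in> B \<Longrightarrow> lie h k = 0"
    and diag: "\<And>h. h \<in> B \<Longrightarrow> clie.span {x. \<exists>c. lie h x = c *\<^sub>C x} = UNIV"
  shows "clie.span {x. \<forall>h\<in>B. \<exists>c. lie h x = c *\<^sub>C x} = (UNIV :: 'a :: complex_lie_algebra set)"
  using assms
proof (induction B rule: finite_induct)
  case empty
  then show ?case by simp
next
  case (insert h B)
  let ?W = "\<lambda>B. {x :: 'a. \<forall>h\<in>B. \<exists>c. lie h x = c *\<^sub>C x}"
  have "?W B \<subseteq> clie.span (?W (insert h B))"
  proof
    fix x assume x: "x \<in> ?W B"
    obtain M X where X: "finite M" "x = (\<Sum>\<mu>\<in>M. X \<mu>)" "\<And>\<mu>. lie h (X \<mu>) = \<mu> *\<^sub>C X \<mu>"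
      using eigen_decomp[of x h] insert.prems(2)[of h] by auto
    have "X \<mu> \<in> ?W (insert h B)" if \<mu>: "\<mu> \<in> M" for \<mu>
    proof -
      have "\<exists>c. lie b (X \<mu>) = c *\<^sub>C X \<mu>" if b: "b \<in> B" for b
      proof -
        obtain c where c: "lie b x = c *\<^sub>C x" using x b by blast
        define Y where "Y \<mu> = lie b (X \<mu>) - c *\<^sub>C X \<mu>" for \<mu>
        have "lie h (lie b (X \<mu>)) = \<mu> *\<^sub>C lie b (X \<mu>)" for \<mu>
          using insert.prems(1)[of h b] b
          by (simp add: lie_derivation[of h b] X(3) lie_scaleC_right)
        then have Y: "Y \<mu> \<in> root_space {h} (\<lambda>_. \<mu>)" for \<mu>
          by (simp add: root_space_def Y_def lie_diff_right lie_scaleC_right X(3)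
              clie.scale_right_diff_distrib scaleC_scaleC mult.commute)
        have sumY: "(\<Sum>\<mu>\<in>M. Y \<mu>) = 0"
          using c by (simp add: Y_def sum_subtractf X(2) lie_sum_right clie.scale_sum_right)
        have inj: "inj_on (\<lambda>\<mu> :: complex. (\<lambda>_ :: 'a. \<mu>)) M" by (rule inj_onI) metis
        have "Y \<mu> = 0"
          using root_space_sum_zero[of "(\<lambda>\<mu> _. \<mu>) ` M" "\<lambda>\<alpha>. Y (\<alpha> h)" "{h}" "\<lambda>_. \<mu>"]
            X(1) Y sumY \<mu> by (auto simp: sum.reindex[OF inj])
        then show ?thesis by (auto simp: Y_def)
      qed
      then show ?thesis using X(3) by auto
    qed
    then show "x \<in> clie.span (?W (insert h B))"
      unfolding X(2) by (intro clie.span_sum clie.span_base)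
  qed
  then have "clie.span (?W B) \<subseteq> clie.span (?W (insert h B))"
    by (rule clie.span_minimal) simp
  then show ?case using insert by auto
qed

text \<open>Otherwise \<open>H + \<complex>x\<close> would be a larger abelian subalgebra.\<close>

lemma cartan_self_centralizing:
  fixes H :: "'a :: complex_lie_algebra set"
  assumes H: "cartan_subalgebra H" and c: "\<And>h. h \<in> H \<Longrightarrow> lie h x = 0"
  shows "x \<in> H"
proof -
  have sub: "clie.subspace H" and ab: "\<And>h k. h \<in> H \<Longrightarrow> k \<in> H \<Longrightarrow> lie h k = 0"
    and mx: "\<And>K. abelian_subalgebra K \<Longrightarrow> H \<subseteq> K \<Longrightarrow> K = H"
    using H by (auto simp: cartan_subalgebra_def abelian_subalgebra_def)
  have c': "lie x h = 0" if "h \<in> H" for h using c[OF that] lie_swap[of x h] by simp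
  let ?K = "{h + c *\<^sub>C x | h c. h \<in> H}"
  have "?K = H"
  proof (rule mx)
    have "clie.subspace ?K"
      unfolding clie.subspace_def
    proof (intro conjI ballI allI)
      have "0 = 0 + 0 *\<^sub>C x \<and> 0 \<in> H" using clie.subspace_0[OF sub] by simp
      then show "0 \<in> ?K" by blast
    next
      fix u v assume "u \<in> ?K" "v \<in> ?K"
      then obtain h k c d where "h \<in> H" "k \<in> H" "u = h + c *\<^sub>C x" "v = k + d *\<^sub>C x" by blast
      then have "u + v = (h + k) + (c + d) *\<^sub>C x" "h + k \<in> H"
        by (auto simp: scaleC_add_left clie.subspace_add[OF sub])
      then show "u + v \<in> ?K" by blast
    next
      fix u a assume "u \<in> ?K"
      then obtain h c where "h \<in> H" "u = h + c *\<^sub>C x" by blast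
      then have "a *\<^sub>C u = a *\<^sub>C h + (a * c) *\<^sub>C x" "a *\<^sub>C h \<in> H"
        by (auto simp: scaleC_add_right scaleC_scaleC clie.subspace_scale[OF sub])
      then show "a *\<^sub>C u \<in> ?K" by blast
    qed
    then show "abelian_subalgebra ?K"
      using c c' ab
      by (auto simp: abelian_subalgebra_def lie_add_left lie_add_right lie_scaleC_left
          lie_scaleC_right lie_self)
    show "H \<subseteq> ?K"
    proof
      fix h assume "h \<in> H"
      then have "h = h + 0 *\<^sub>C x \<and> h \<in> H" by simp
      then show "h \<in> ?K" by blast
    qed
  qed
  moreover have "0 + 1 *\<^sub>C x \<in> ?K" using clie.subspace_0[OF sub] by blast
  ultimately show ?thesis by (simp add: scaleC_one)
qed

text \<open>The root space decomposition in the form in which it is used: linear statements have to be checked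
  on the Cartan subalgebra and on root spaces only.\<close>

lemma subspace_UNIV_weights:
  fixes H S :: "'a :: complex_lie_algebra set"
  assumes H: "cartan_subalgebra H" and S: "clie.subspace S" "H \<subseteq> S"
    and roots: "\<And>\<alpha>. \<alpha> \<in> roots H \<Longrightarrow> root_space H \<alpha> \<subseteq> S"
  shows "S = UNIV"
proof -
  have sub: "clie.subspace H" and ab: "\<And>h k. h \<in> H \<Longrightarrow> k \<in> H \<Longrightarrow> lie h k = 0"
    and diag: "\<And>h. h \<in> H \<Longrightarrow> clie.span {x. \<exists>c. lie h x = c *\<^sub>C x} = UNIV"
    using H by (auto simp: cartan_subalgebra_def abelian_subalgebra_def)
  obtain B where B: "B \<subseteq> H" "clie.independent B" "H \<subseteq> clie.span B"
    using clie.basis_exists by metis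
  have fin: "finite B"
    using clie.independent_span_bound[OF lie_basis(3) B(2)] lie_basis(2) by auto
  have "{x. \<forall>h\<in>B. \<exists>c. lie h x = c *\<^sub>C x} \<subseteq> S"
  proof safe
    fix x assume x: "\<forall>h\<in>B. \<exists>c. lie h x = c *\<^sub>C x"
    have ex: "\<exists>c. lie h x = c *\<^sub>C x" if "h \<in> H" for h
    proof -
      have "h \<in> clie.span B" using B(3) that by blast
      then show ?thesis
      proof (induction rule: clie.span_induct_alt)
        case base
        then show ?case by (intro exI[of _ 0]) simp
      next
        case (step c b y)
        then obtain d e where "lie b x = d *\<^sub>C x" "lie y x = e *\<^sub>C x" using x by blast
        then show ?case
          by (intro exI[of _ "c * d + e"])
            (simp add: lie_add_left lie_scaleC_left scaleC_add_left scaleC_scaleC)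
      qed
    qed
    show "x \<in> S"
    proof (cases "x = 0")
      case True
      then show ?thesis using S(1) by (simp add: clie.subspace_0)
    next
      case False
      define \<alpha> where "\<alpha> h = (if h \<in> H then SOME c. lie h x = c *\<^sub>C x else 0)" for h
      have \<alpha>: "lie h x = \<alpha> h *\<^sub>C x" if "h \<in> H" for h
        using someI_ex[OF ex[OF that]] that by (simp add: \<alpha>_def)
      have uniq: "c = d" if "c *\<^sub>C x = d *\<^sub>C x" for c d
        using that False by simp
      have "\<alpha> (h + k) = \<alpha> h + \<alpha> k" if "h \<in> H" "k \<in> H" for h k
      proof (rule uniq)
        have "\<alpha> (h + k) *\<^sub>C x = lie (h + k) x"
          by (rule \<alpha>[symmetric]) (rule clie.subspace_add[OF sub that])
        then show "\<alpha> (h + k) *\<^sub>C x = (\<alpha> h + \<alpha> k) *\<^sub>C x"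
          by (simp only: lie_add_left \<alpha>[OF that(1)] \<alpha>[OF that(2)] scaleC_add_left)
      qed
      moreover have "\<alpha> (c *\<^sub>C h) = c * \<alpha> h" if "h \<in> H" for h c
      proof (rule uniq)
        have "\<alpha> (c *\<^sub>C h) *\<^sub>C x = lie (c *\<^sub>C h) x"
          by (rule \<alpha>[symmetric]) (rule clie.subspace_scale[OF sub that])
        then show "\<alpha> (c *\<^sub>C h) *\<^sub>C x = (c * \<alpha> h) *\<^sub>C x"
          by (simp only: lie_scaleC_left \<alpha>[OF that] scaleC_scaleC)
      qed
      ultimately have dual: "\<alpha> \<in> dual_space H" by (auto simp: dual_space_def \<alpha>_def)
      have mem: "x \<in> root_space H \<alpha>" using \<alpha> by (auto simp: root_space_def)
      show ?thesis
      proof (cases "\<alpha> = 0")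
        case True
        then have "lie h x = 0" if "h \<in> H" for h using \<alpha>[OF that] by simp
        then have "x \<in> H" by (rule cartan_self_centralizing[OF H])
        then show ?thesis using S(2) by blast
      next
        case False
        then have "\<alpha> \<in> roots H" using dual mem \<open>x \<noteq> 0\<close> by (auto simp: roots_def)
        then show ?thesis using roots mem by blast
      qed
    qed
  qed
  then have "clie.span {x. \<forall>h\<in>B. \<exists>c. lie h x = c *\<^sub>C x} \<subseteq> S"
    by (rule clie.span_minimal) (rule S(1))
  moreover have "clie.span {x. \<forall>h\<in>B. \<exists>c. lie h x = c *\<^sub>C x} = UNIV"
    by (rule simultaneous_eigenvectors_span[OF fin]) (use B(1) ab diag in blast)+
  ultimately show ?thesis by auto
qed

lemma root_distinct: "\<alpha> \<in> dual_space H \<Longrightarrow> \<beta> \<in> dual_space H \<Longrightarrow> \<alpha> \<noteq> \<beta> \<Longrightarrow> \<exists>h\<in>H. \<alpha> h \<noteq> \<beta> h"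
proof (rule ccontr)
  assume dual: "\<alpha> \<in> dual_space H" "\<beta> \<in> dual_space H" and "\<alpha> \<noteq> \<beta>" "\<not> (\<exists>h\<in>H. \<alpha> h \<noteq> \<beta> h)"
  then have "\<alpha> h = \<beta> h" for h by (cases "h \<in> H") (auto simp: dual_space_def)
  then show False using \<open>\<alpha> \<noteq> \<beta>\<close> by blast
qed

text \<open>Nonzero vectors from different root spaces are independent.\<close>

lemma finite_roots: "finite (roots (H :: 'a :: complex_lie_algebra set))"
proof (rule ccontr)
  assume "infinite (roots H)"
  then obtain A where A: "A \<subseteq> roots H" "finite A"
     "card A = Suc (card (lie_basis :: 'a set))"
    using infinite_arbitrarily_large[of "roots H" "Suc (card (lie_basis :: 'a set))"] by blast
  have "\<forall>\<alpha>\<in>roots H. \<exists>x. x \<in> root_space H \<alpha> \<and> x \<noteq> 0"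
    using clie.subspace_0[OF root_space_subspace] by (auto simp: roots_def)
  then obtain e where e: "\<And>\<alpha>. \<alpha> \<in> roots H \<Longrightarrow> e \<alpha> \<in> root_space H \<alpha>" 
    "\<And>\<alpha>. \<alpha> \<in> roots H \<Longrightarrow> e \<alpha> \<noteq> 0"
    by metis
  have dist: "\<exists>h\<in>H. \<alpha> h \<noteq> \<beta> h" if "\<alpha> \<in> A" "\<beta> \<in> A" "\<alpha> \<noteq> \<beta>" for \<alpha> \<beta>
    by (rule root_distinct) (use that A(1) in \<open>auto simp: roots_def\<close>)
  have inj: "inj_on e A"
  proof (rule inj_onI)
    fix \<alpha> \<beta> assume mem: "\<alpha> \<in> A" "\<beta> \<in> A" and "e \<alpha> = e \<beta>"
    have "e \<alpha> \<in> root_space H \<alpha>" "e \<beta> \<in> root_space H \<beta>" "e \<alpha> \<noteq> 0"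
      using mem A(1) e by blast+
    then show "\<alpha> = \<beta>"
      using dist[of \<alpha> \<beta>] root_space_unique[of "e \<alpha>" H \<alpha> \<beta>] mem \<open>e \<alpha> = e \<beta>\<close> by metis
  qed
  have "clie.independent (e ` A)"
  proof (rule clie.independent_if_scalars_zero)
    fix f x assume s: "(\<Sum>x\<in>e ` A. f x *\<^sub>C x) = 0" and "x \<in> e ` A"
    then obtain \<alpha> where \<alpha>: "\<alpha> \<in> A" "x = e \<alpha>" by blast
    have "f (e \<alpha>) *\<^sub>C e \<alpha> = 0"
    proof (rule root_space_sum_zero[of A "\<lambda>\<alpha>. f (e \<alpha>) *\<^sub>C e \<alpha>" H])
      show "f (e \<beta>) *\<^sub>C e \<beta> \<in> root_space H \<beta>" if "\<beta> \<in> A" for \<beta>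
        by (rule clie.subspace_scale[OF root_space_subspace]) (use e(1) A(1) that in blast)
      show "(\<Sum>\<beta>\<in>A. f (e \<beta>) *\<^sub>C e \<beta>) = 0" using s by (simp add: sum.reindex[OF inj])
    qed (fact A(2) dist \<alpha>(1))+
    then show "f x = 0" using e(2) \<alpha> A(1) by auto
  qed (use A in auto)
  then have "card (e ` A) \<le> card (lie_basis :: 'a set)"
    using clie.independent_span_bound[OF lie_basis(3)] lie_basis(2) by auto
  then show False using A(3) card_image[OF inj] by simp
qed

lemma killing_root_orthogonal:
  assumes "x \<in> root_space H \<alpha>" "y \<in> root_space H \<beta>" "h \<in> H" "\<alpha> h + \<beta> h \<noteq> 0"
  shows "killing x y = 0"
proof -
  have "killing (lie x h) y = killing x (lie h y)" by (rule killing_invariant)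
  moreover have "lie x h = (- \<alpha> h) *\<^sub>C x" 
    using assms lie_swap[of x h] by (simp add: root_space_def)
  moreover have "lie h y = \<beta> h *\<^sub>C y" using assms by (simp add: root_space_def)
  ultimately have "- (\<alpha> h * killing x y) = \<beta> h * killing x y" by (simp add: killing_simps)
  then have "(\<alpha> h + \<beta> h) * killing x y = 0" by (metis add.right_inverse distrib_right)
  then show ?thesis using assms(4) by simp
qed

section \<open>Root strings\<close>

locale rooted_algebra =
  fixes H :: "'g :: simple_complex_lie_algebra set"
    and P :: "('g \<Rightarrow> complex) set" and E :: "('g \<Rightarrow> complex) \<Rightarrow> 'g"
  assumes cartan: "cartan_subalgebra H" and positive: "positive_system H P"
    and vectors: "root_vectors H P E" and nonempty: "P \<noteq> {}"
begin

abbreviation \<Omega> :: "('g \<Rightarrow> complex) set" where "\<Omega> \<equiv> roots H"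

text \<open>The element of the Cartan subalgebra that represents \<open>\<alpha>\<close> under the Killing form.\<close>

definition tvec :: "('g \<Rightarrow> complex) \<Rightarrow> 'g" where
  "tvec \<alpha> = lie (E \<alpha>) (E (- \<alpha>))"

lemma H_sub: "clie.subspace H" and H_abelian: "h \<in> H \<Longrightarrow> k \<in> H \<Longrightarrow> lie h k = 0"
  using cartan by (auto simp: cartan_subalgebra_def abelian_subalgebra_def)

lemma H_root_space: "H = root_space H 0"
  using cartan_self_centralizing[OF cartan] H_abelian by (auto simp: root_space_def)

lemma UNIV_by_weights:
  assumes "clie.subspace S" "H \<subseteq> S" "\<And>\<alpha>. \<alpha> \<in> \<Omega> \<Longrightarrow> root_space H \<alpha> \<subseteq> S"
  shows "x \<in> S"
  using subspace_UNIV_weights[OF cartan assms] by blast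

lemma zero_not_root: "0 \<notin> \<Omega>"
  by (simp add: roots_def)

lemma root_dual: "\<alpha> \<in> \<Omega> \<Longrightarrow> \<alpha> \<in> dual_space H"
  by (simp add: roots_def)

lemma dual_add: "\<alpha> \<in> dual_space H \<Longrightarrow> \<beta> \<in> dual_space H \<Longrightarrow> \<alpha> + \<beta> \<in> dual_space H"
  by (auto simp: dual_space_def algebra_simps)

lemma dual_scale: "\<alpha> \<in> dual_space H \<Longrightarrow> fscale c \<alpha> \<in> dual_space H"
  by (auto simp: dual_space_def fscale_def algebra_simps)

lemma dual_zero: "0 \<in> dual_space H"
  by (auto simp: dual_space_def)

lemma dual_nonzero: "\<alpha> \<in> dual_space H \<Longrightarrow> \<alpha> \<noteq> 0 \<Longrightarrow> \<exists>h\<in>H. \<alpha> h \<noteq> 0"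
  using root_distinct[of \<alpha> H 0] dual_zero by auto

lemma root_spaces_orthogonal:
  assumes "\<alpha> \<in> dual_space H" "\<beta> \<in> dual_space H" "\<alpha> + \<beta> \<noteq> 0"
    "x \<in> root_space H \<alpha>" "y \<in> root_space H \<beta>"
  shows "killing x y = 0"
  using dual_nonzero[OF dual_add[OF assms(1,2)] assms(3)]
    killing_root_orthogonal[OF assms(4,5)] by auto

lemma not_root_space_zero:
  assumes "\<alpha> \<in> dual_space H" "\<alpha> \<noteq> 0" "\<alpha> \<notin> \<Omega>" "x \<in> root_space H \<alpha>"
  shows "x = 0"
  using assms by (auto simp: roots_def)

lemma center_trivial:
  assumes "\<And>y. lie x y = 0"
  shows "x = (0 :: 'g)"
proof -
  let ?I = "{x :: 'g. \<forall>y. lie x y = 0}"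
  have "lie_ideal ?I"
    unfolding lie_ideal_def
  proof (intro conjI ballI allI)
    fix x y assume y: "y \<in> ?I"
    then have "lie x y = 0" using lie_swap[of x y] by simp
    then show "lie x y \<in> ?I" by simp
  qed (auto simp: lie_add_left lie_scaleC_left)
  then have "?I = {0} \<or> ?I = UNIV" by (rule simple)
  moreover have "?I \<noteq> UNIV" using nonabelian by auto
  moreover have "x \<in> ?I" using assms by simp
  ultimately show ?thesis by blast
qed

lemma P_subset: "P \<subseteq> \<Omega>"
  using positive by (auto simp: positive_system_def)

text \<open>The radical is an ideal, and the normalization of the root vectors shows that it is not everything.\<close>

lemma killing_nondegenerate:
  assumes "\<And>x. killing x y = 0"
  shows "y = (0 :: 'g)"
proof -
  let ?I = "{y :: 'g. \<forall>x. killing x y = 0}"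
  have "lie_ideal ?I"
    unfolding lie_ideal_def
    by (auto simp: killing_simps killing_invariant[symmetric])
  then have "?I = {0} \<or> ?I = UNIV" by (rule simple)
  moreover have "?I \<noteq> UNIV"
  proof
    assume "?I = UNIV"
    moreover obtain \<alpha> where "\<alpha> \<in> P" using nonempty by blast
    then have "killing (E \<alpha>) (E (- \<alpha>)) = 1" using vectors by (auto simp: root_vectors_def)
    ultimately show False using UNIV_I zero_neq_one by (metis (mono_tags, lifting) mem_Collect_eq)
  qed
  ultimately show ?thesis using assms by auto
qed

lemma killing_kernel_subspace: "clie.subspace {y. killing x y = 0}"
  by (auto simp: clie.subspace_def killing_simps)

text \<open>The Killing form pairs the root space of \<open>\<alpha>\<close> with no weight other than \<open>-\<alpha>\<close>.\<close>

lemma root_minus: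
  assumes \<alpha>: "\<alpha> \<in> \<Omega>"
  shows "- \<alpha> \<in> \<Omega>"
proof (rule ccontr)
  assume n: "- \<alpha> \<notin> \<Omega>"
  obtain x where x: "x \<in> root_space H \<alpha>" "x \<noteq> 0"
    using \<alpha> clie.subspace_0[OF root_space_subspace] by (auto simp: roots_def)
  have "killing x y = 0" for y
  proof -
    have "y \<in> {y. killing x y = 0}"
    proof (rule UNIV_by_weights[OF killing_kernel_subspace])
      show "H \<subseteq> {y. killing x y = 0}"
        using root_spaces_orthogonal[OF root_dual[OF \<alpha>] dual_zero _ x(1)] H_root_space \<alpha> zero_not_root
        by auto
      fix \<beta> assume \<beta>: "\<beta> \<in> \<Omega>"
      then have "\<alpha> + \<beta> \<noteq> 0" using n by (metis add_eq_0_iff)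
      then show "root_space H \<beta> \<subseteq> {y. killing x y = 0}"
        using root_spaces_orthogonal[OF root_dual[OF \<alpha>] root_dual[OF \<beta>] _ x(1)] by auto
    qed
    then show ?thesis by simp
  qed
  then have "x = 0" using killing_nondegenerate[of x] killing_sym[of x] by simp
  then show False using x(2) by simp
qed

lemma root_cases: "\<alpha> \<in> \<Omega> \<Longrightarrow> \<alpha> \<in> P \<or> - \<alpha> \<in> P"
proof -
  obtain t where t: "t \<in> H" "\<And>\<alpha>. \<alpha> \<in> \<Omega> \<Longrightarrow> \<alpha> t \<in> \<real> \<and> \<alpha> t \<noteq> 0" "P = {\<alpha> \<in> \<Omega>. 0 < Re (\<alpha> t)}"
    using positive by (auto simp: positive_system_def)
  assume \<alpha>: "\<alpha> \<in> \<Omega>"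
  then have "Re (\<alpha> t) \<noteq> 0" using t(2) by (metis Reals_cases Re_complex_of_real of_real_0)
  then show ?thesis using \<alpha> root_minus[OF \<alpha>] by (auto simp: t(3))
qed

lemma P_minus: "\<alpha> \<in> P \<Longrightarrow> - \<alpha> \<notin> P"
  using positive by (auto simp: positive_system_def)

lemma P_add: "\<alpha> \<in> P \<Longrightarrow> \<beta> \<in> P \<Longrightarrow> \<alpha> + \<beta> \<in> \<Omega> \<Longrightarrow> \<alpha> + \<beta> \<in> P"
  using positive by (auto simp: positive_system_def)

lemma E_root_space: "\<alpha> \<in> \<Omega> \<Longrightarrow> E \<alpha> \<in> root_space H \<alpha>"
  using root_cases[of \<alpha>] vectors unfolding root_vectors_def by (metis minus_minus)

lemma killing_E: "\<alpha> \<in> \<Omega> \<Longrightarrow> killing (E \<alpha>) (E (- \<alpha>)) = 1"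
  using root_cases[of \<alpha>] vectors killing_sym[of "E \<alpha>"] unfolding root_vectors_def by (metis minus_minus)

lemma E_nonzero: "\<alpha> \<in> \<Omega> \<Longrightarrow> E \<alpha> \<noteq> 0"
  using killing_E[of \<alpha>] by (auto simp: killing_simps)

lemma lie_H_E: "h \<in> H \<Longrightarrow> \<alpha> \<in> \<Omega> \<Longrightarrow> lie h (E \<alpha>) = \<alpha> h *\<^sub>C E \<alpha>"
  using E_root_space by (auto simp: root_space_def)

lemma killing_E_E: "\<alpha> \<in> \<Omega> \<Longrightarrow> \<beta> \<in> \<Omega> \<Longrightarrow> killing (E \<alpha>) (E \<beta>) = (if \<beta> = - \<alpha> then 1 else 0)"
  using root_spaces_orthogonal[OF root_dual root_dual _ E_root_space E_root_space, of \<alpha> \<beta>]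
    killing_E[of \<alpha>] by (cases "\<beta> = - \<alpha>") (auto simp: add_eq_0_iff)

lemma killing_H_root: "h \<in> H \<Longrightarrow> \<alpha> \<in> \<Omega> \<Longrightarrow> x \<in> root_space H \<alpha> \<Longrightarrow> killing h x = 0"
  using root_spaces_orthogonal[OF dual_zero root_dual, of \<alpha> h x] H_root_space zero_not_root by auto

lemma killing_H_E: "h \<in> H \<Longrightarrow> \<alpha> \<in> \<Omega> \<Longrightarrow> killing h (E \<alpha>) = 0"
  using killing_H_root E_root_space by blast

lemma killing_H_nondegenerate:
  assumes "z \<in> H" "\<And>h. h \<in> H \<Longrightarrow> killing h z = 0"
  shows "z = 0"
proof (rule killing_nondegenerate)
  fix x
  have "x \<in> {x. killing z x = 0}"
  proof (rule UNIV_by_weights[OF killing_kernel_subspace])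
    show "H \<subseteq> {x. killing z x = 0}" using assms(2) by (auto simp: killing_sym[of z])
    show "root_space H \<alpha> \<subseteq> {x. killing z x = 0}" if "\<alpha> \<in> \<Omega>" for \<alpha>
      using killing_H_root[OF assms(1) that] by auto
  qed
  then show "killing x z = 0" by (simp add: killing_sym[of x])
qed

lemma lie_opposite_in_H:
  assumes "\<alpha> \<in> \<Omega>" "x \<in> root_space H \<alpha>" "y \<in> root_space H (- \<alpha>)"
  shows "lie x y \<in> H"
  using lie_root_space[OF assms(2,3)] H_root_space by simp

lemma tvec_H: "\<alpha> \<in> \<Omega> \<Longrightarrow> tvec \<alpha> \<in> H"
  unfolding tvec_def by (intro lie_opposite_in_H[of \<alpha>] E_root_space root_minus)

lemma tvec_minus: "tvec (- \<alpha>) = - tvec \<alpha>"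
  unfolding tvec_def using lie_swap[of "E (- \<alpha>)"] by simp

lemma killing_H_lie:
  assumes x: "x \<in> root_space H \<alpha>" and h: "h \<in> H"
  shows "killing h (lie x y) = \<alpha> h * killing x y"
proof -
  have "killing h (lie x y) = killing (lie h x) y" by (simp add: killing_invariant)
  also have "lie h x = \<alpha> h *\<^sub>C x" using x h by (simp add: root_space_def)
  finally show ?thesis by (simp add: killing_simps)
qed

lemma killing_tvec: "\<alpha> \<in> \<Omega> \<Longrightarrow> h \<in> H \<Longrightarrow> killing h (tvec \<alpha>) = \<alpha> h"
  unfolding tvec_def
  using killing_H_lie[OF E_root_space] killing_E by simp

lemma lie_opposite_eq:
  assumes \<alpha>: "\<alpha> \<in> \<Omega>" and x: "x \<in> root_space H \<alpha>" and y: "y \<in> root_space H (- \<alpha>)"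
  shows "lie x y = killing x y *\<^sub>C tvec \<alpha>"
proof -
  have "lie x y - killing x y *\<^sub>C tvec \<alpha> = 0"
    by (rule killing_H_nondegenerate)
      (use assms killing_H_lie killing_tvec lie_opposite_in_H tvec_H H_sub in
        \<open>auto simp: killing_simps clie.subspace_diff clie.subspace_scale\<close>)
  then show ?thesis by simp
qed

lemma tvec_nonzero: "\<alpha> \<in> \<Omega> \<Longrightarrow> tvec \<alpha> \<noteq> 0"
proof
  assume \<alpha>: "\<alpha> \<in> \<Omega>" and z: "tvec \<alpha> = 0"
  obtain h where "h \<in> H" "\<alpha> h \<noteq> 0" using dual_nonzero[OF root_dual[OF \<alpha>]] \<alpha> zero_not_root by blast
  then show False using killing_tvec[OF \<alpha>, of h] z by (simp add: killing_simps)
qed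

lemma string_root_space:
  assumes "\<alpha> \<in> \<Omega>" "w \<in> root_space H \<beta>"
  shows "(lie (E \<alpha>) ^^ k) w \<in> root_space H (\<beta> + fscale (of_nat k) \<alpha>)"
proof (induction k)
  case 0
  have "fscale 0 \<alpha> = 0" by (auto simp: fscale_def)
  then show ?case using assms by simp
next
  case (Suc k)
  have "\<alpha> + (\<beta> + fscale (of_nat k) \<alpha>) = \<beta> + fscale (of_nat (Suc k)) \<alpha>"
    by (auto simp: fscale_def fun_eq_iff algebra_simps)
  then show ?case using lie_root_space[OF E_root_space[OF assms(1)] Suc]
    by (simp only: funpow.simps o_apply)
qed

text \<open>The coefficient is minus the sum of the weights \<open>\<beta> + j\<alpha>\<close>, \<open>j \<le> k\<close>, evaluated at \<open>[E\<^sub>\<alpha>, E\<^sub>-\<^sub>\<alpha>]\<close>. This is the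
  familiar formula for \<open>sl\<^sub>2\<close>, without dividing by \<open>\<alpha>(tvec \<alpha>)\<close>, which is not yet known to be nonzero.\<close>

lemma string_lowering:
  assumes \<alpha>: "\<alpha> \<in> \<Omega>" and w: "w \<in> root_space H \<beta>" and low: "lie (E (- \<alpha>)) w = 0"
  shows "lie (E (- \<alpha>)) ((lie (E \<alpha>) ^^ Suc k) w) =
    (- (of_nat (Suc k) * (\<beta> (tvec \<alpha>) + of_nat k / 2 * \<alpha> (tvec \<alpha>)))) *\<^sub>C (lie (E \<alpha>) ^^ k) w"
proof (induction k)
  let ?u = "\<lambda>k. (lie (E \<alpha>) ^^ k) w"
  have step: "lie (E (- \<alpha>)) (?u (Suc k)) =
      (- (\<beta> (tvec \<alpha>) + of_nat k * \<alpha> (tvec \<alpha>))) *\<^sub>C ?u k + lie (E \<alpha>) (lie (E (- \<alpha>)) (?u k))" for k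
  proof -
    have "lie (tvec \<alpha>) (?u k) = (\<beta> (tvec \<alpha>) + of_nat k * \<alpha> (tvec \<alpha>)) *\<^sub>C ?u k"
      using string_root_space[OF \<alpha> w, of k] tvec_H[OF \<alpha>]
      by (simp add: root_space_def fscale_def)
    moreover have "lie (E (- \<alpha>)) (E \<alpha>) = - tvec \<alpha>"
      unfolding tvec_def by (rule lie_swap)
    ultimately show ?thesis
      by (simp only: funpow.simps o_apply lie_derivation[of "E (- \<alpha>)" "E \<alpha>" "?u k"]
          lie_minus_left clie.scale_minus_left)
  qed
  {
    case 0
    then show ?case unfolding step[of 0] by (simp add: low)
  next
    case (Suc k)
    show ?case
      unfolding step[of "Suc k"] Suc lie_scaleC_right
      unfolding funpow.simps o_apply scaleC_add_left[symmetric]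
      by (rule arg_cong[where f = "\<lambda>c. c *\<^sub>C _"]) (simp add: field_simps)
  }
qed

lemma string_stops:
  assumes \<alpha>: "\<alpha> \<in> \<Omega>" and \<beta>: "\<beta> \<in> dual_space H" and w: "w \<in> root_space H \<beta>"
  shows "\<exists>n. (lie (E \<alpha>) ^^ n) w = 0"
proof (rule ccontr)
  assume "\<not> ?thesis"
  then have nz: "(lie (E \<alpha>) ^^ n) w \<noteq> 0" for n by blast
  let ?f = "\<lambda>n :: nat. \<beta> + fscale (of_nat n) \<alpha>"
  have "?f n \<in> insert 0 \<Omega>" for n
    using string_root_space[OF \<alpha> w, of n] nz[of n] not_root_space_zero[of "?f n"]
      dual_add[OF \<beta> dual_scale[OF root_dual[OF \<alpha>]]] by auto
  moreover have "inj ?f"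
  proof (rule injI)
    fix m n assume "?f m = ?f n"
    moreover obtain h where "\<alpha> h \<noteq> 0" using dual_nonzero[OF root_dual] \<alpha> zero_not_root by metis
    ultimately show "m = n" by (auto simp: fscale_def fun_eq_iff)
  qed
  ultimately show False
    using finite_imageD[of ?f UNIV] finite_subset[of "range ?f" "insert 0 \<Omega>"] finite_roots[of H] by auto
qed

lemma string_top:
  assumes \<alpha>: "\<alpha> \<in> \<Omega>" and \<beta>: "\<beta> \<in> dual_space H" and w: "w \<in> root_space H \<beta>" "w \<noteq> 0"
  obtains n where "\<And>k. k \<le> n \<Longrightarrow> (lie (E \<alpha>) ^^ k) w \<noteq> 0" "lie (E \<alpha>) ((lie (E \<alpha>) ^^ n) w) = 0"
proof -
  let ?Z = "\<lambda>n. (lie (E \<alpha>) ^^ n) w = 0"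
  have ex: "\<exists>n. ?Z n" by (rule string_stops[OF \<alpha> \<beta> w(1)])
  define m where "m = (LEAST n. ?Z n)"
  have m: "?Z m" unfolding m_def by (rule LeastI_ex[OF ex])
  have "m \<noteq> 0" by (rule notI) (use m w(2) in simp)
  then obtain n where n: "m = Suc n" by (cases m) auto
  show ?thesis
  proof (rule that)
    show "(lie (E \<alpha>) ^^ k) w \<noteq> 0" if "k \<le> n" for k
      using not_less_Least[of k ?Z] that by (auto simp flip: m_def simp: n)
    show "lie (E \<alpha>) ((lie (E \<alpha>) ^^ n) w) = 0" using m by (simp add: n)
  qed
qed

text \<open>As there are finitely many roots the string stops, and at the first vanishing step the coefficient of
  \<open>string_lowering\<close> must be zero.\<close>

lemma string_length:
  assumes \<alpha>: "\<alpha> \<in> \<Omega>" and \<beta>: "\<beta> \<in> dual_space H" and w: "w \<in> root_space H \<beta>" "w \<noteq> 0"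
    and low: "lie (E (- \<alpha>)) w = 0"
  obtains n where "\<And>k. k \<le> n \<Longrightarrow> (lie (E \<alpha>) ^^ k) w \<noteq> 0"
    "2 * \<beta> (tvec \<alpha>) + of_nat n * \<alpha> (tvec \<alpha>) = 0"
proof -
  obtain n where n: "\<And>k. k \<le> n \<Longrightarrow> (lie (E \<alpha>) ^^ k) w \<noteq> 0" "lie (E \<alpha>) ((lie (E \<alpha>) ^^ n) w) = 0"
    using string_top[OF \<alpha> \<beta> w] by blast
  have "(lie (E \<alpha>) ^^ Suc n) w = 0" using n(2) by simp
  then have "(- (of_nat (Suc n) * (\<beta> (tvec \<alpha>) + of_nat n / 2 * \<alpha> (tvec \<alpha>)))) *\<^sub>C (lie (E \<alpha>) ^^ n) w = 0"
    using string_lowering[OF \<alpha> w(1) low, of n] by simp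
  then have "of_nat (Suc n) * (\<beta> (tvec \<alpha>) + of_nat n / 2 * \<alpha> (tvec \<alpha>)) = 0"
    using n(1)[of n] by simp
  then have "\<beta> (tvec \<alpha>) + of_nat n / 2 * \<alpha> (tvec \<alpha>) = 0"
    by (metis mult_eq_0_iff of_nat_eq_0_iff nat.distinct(1))
  then have "2 * \<beta> (tvec \<alpha>) + of_nat n * \<alpha> (tvec \<alpha>) = 0"
    by (simp add: field_simps)
  then show ?thesis using that n(1) by blast
qed

text \<open>Descend from \<open>E\<^sub>\<beta>\<close> by \<open>E\<^sub>-\<^sub>\<alpha>\<close> as far as possible and apply \<open>string_length\<close> to the last nonzero vector.\<close>

lemma weight_integral:
  assumes \<alpha>: "\<alpha> \<in> \<Omega>" and \<beta>: "\<beta> \<in> \<Omega>"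
  obtains z :: int where "2 * \<beta> (tvec \<alpha>) = of_int z * \<alpha> (tvec \<alpha>)"
proof -
  let ?a = "\<alpha> (tvec \<alpha>)"
  have \<alpha>': "- \<alpha> \<in> \<Omega>" by (rule root_minus[OF \<alpha>])
  obtain m where m: "\<And>k. k \<le> m \<Longrightarrow> (lie (E (- \<alpha>)) ^^ k) (E \<beta>) \<noteq> 0"
      "lie (E (- \<alpha>)) ((lie (E (- \<alpha>)) ^^ m) (E \<beta>)) = 0"
    using string_top[OF \<alpha>' root_dual[OF \<beta>] E_root_space[OF \<beta>] E_nonzero[OF \<beta>]] by blast
  let ?\<beta> = "\<beta> + fscale (of_nat m) (- \<alpha>)"
  obtain n where "2 * ?\<beta> (tvec \<alpha>) + of_nat n * ?a = 0"
    by (rule string_length[OF \<alpha> dual_add[OF root_dual[OF \<beta>] dual_scale[OF root_dual[OF \<alpha>']]]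
        string_root_space[OF \<alpha>' E_root_space[OF \<beta>], of m] m(1)[OF order_refl] m(2)])
  then have "2 * \<beta> (tvec \<alpha>) = of_int (2 * int m - int n) * ?a"
    by (simp add: fscale_def algebra_simps eq_neg_iff_add_eq_0)
  then show ?thesis using that by blast
qed

lemma centralizer_subspace: "clie.subspace {y. lie x y = 0}"
  by (auto simp: clie.subspace_def lie_add_right lie_scaleC_right)

lemma roots_separate:
  assumes "h \<in> H" "\<And>\<beta>. \<beta> \<in> \<Omega> \<Longrightarrow> \<beta> h = 0"
  shows "h = 0"
proof (rule center_trivial)
  fix y
  have "y \<in> {y. lie h y = 0}"
    by (rule UNIV_by_weights[OF centralizer_subspace])
      (use assms H_abelian in \<open>auto simp: root_space_def\<close>)
  then show "lie h y = 0" by simp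
qed

text \<open>If it were zero, then by \<open>weight_integral\<close> all roots would vanish on \<open>tvec \<alpha>\<close>, which would be central.\<close>

lemma root_tvec_nonzero:
  assumes \<alpha>: "\<alpha> \<in> \<Omega>"
  shows "\<alpha> (tvec \<alpha>) \<noteq> 0"
proof
  assume z: "\<alpha> (tvec \<alpha>) = 0"
  have "\<beta> (tvec \<alpha>) = 0" if "\<beta> \<in> \<Omega>" for \<beta>
    using weight_integral[OF \<alpha> that] z by auto
  then have "tvec \<alpha> = 0" by (rule roots_separate[OF tvec_H[OF \<alpha>]])
  then show False using tvec_nonzero[OF \<alpha>] by simp
qed

text \<open>Subtracting a multiple of \<open>E\<^sub>\<alpha>\<close> makes a vector of weight \<open>\<alpha>\<close> commute with \<open>E\<^sub>-\<^sub>\<alpha>\<close>; a lowest vector of positive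
  weight \<open>\<alpha>\<close> contradicts \<open>string_length\<close>.\<close>

lemma root_space_line:
  assumes \<alpha>: "\<alpha> \<in> \<Omega>" and x: "x \<in> root_space H \<alpha>"
  shows "x = killing x (E (- \<alpha>)) *\<^sub>C E \<alpha>"
proof -
  define y where "y = x - killing x (E (- \<alpha>)) *\<^sub>C E \<alpha>"
  have y: "y \<in> root_space H \<alpha>"
    unfolding y_def
    by (intro clie.subspace_diff clie.subspace_scale root_space_subspace x E_root_space \<alpha>)
  have "killing y (E (- \<alpha>)) = 0" by (simp add: y_def killing_simps killing_E \<alpha>)
  then have "lie y (E (- \<alpha>)) = 0"
    using lie_opposite_eq[OF \<alpha> y E_root_space[OF root_minus[OF \<alpha>]]] by simp
  then have low: "lie (E (- \<alpha>)) y = 0" using lie_swap[of "E (- \<alpha>)" y] by simp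
  have "y = 0"
  proof (rule ccontr)
    assume "y \<noteq> 0"
    then obtain n where "2 * \<alpha> (tvec \<alpha>) + of_nat n * \<alpha> (tvec \<alpha>) = 0"
      using string_length[OF \<alpha> root_dual[OF \<alpha>] y _ low] by metis
    then have "of_nat (n + 2) * \<alpha> (tvec \<alpha>) = 0" by (simp add: algebra_simps)
    then show False using root_tvec_nonzero[OF \<alpha>] by (metis mult_eq_0_iff of_nat_eq_0_iff add_is_0 zero_neq_numeral)
  qed
  then show ?thesis by (simp add: y_def)
qed

lemma lie_E_E:
  assumes "\<alpha> \<in> \<Omega>" "\<beta> \<in> \<Omega>" "\<alpha> + \<beta> \<in> \<Omega>"
  shows "lie (E \<alpha>) (E \<beta>) = killing (lie (E \<alpha>) (E \<beta>)) (E (- (\<alpha> + \<beta>))) *\<^sub>C E (\<alpha> + \<beta>)"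
  by (rule root_space_line[OF assms(3) lie_root_space[OF E_root_space E_root_space]]) fact+

lemma lie_E_E_zero:
  assumes "\<alpha> \<in> \<Omega>" "\<beta> \<in> \<Omega>" "\<alpha> + \<beta> \<notin> \<Omega>" "\<alpha> + \<beta> \<noteq> 0"
  shows "lie (E \<alpha>) (E \<beta>) = 0"
  by (rule not_root_space_zero[OF dual_add[OF root_dual root_dual] assms(4,3)
        lie_root_space[OF E_root_space E_root_space]]) fact+

text \<open>Suppose \<open>E\<^sub>\<alpha>\<close> kills \<open>E\<^sub>\<beta>\<close>, so that a representation of \<open>sl\<^sub>2\<close> with highest weight \<open>\<beta>\<close> ends there. The
  string through \<open>E\<^sub>\<alpha>\<^sub>+\<^sub>\<beta>\<close> has a higher top; descending from that top one passes through the line of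
  \<open>E\<^sub>\<beta>\<close> before the string ends, and there \<open>E\<^sub>\<alpha>\<close> acts with a nonzero coefficient.\<close>

lemma lie_E_E_nonzero:
  assumes \<alpha>: "\<alpha> \<in> \<Omega>" and \<beta>: "\<beta> \<in> \<Omega>" and \<alpha>\<beta>: "\<alpha> + \<beta> \<in> \<Omega>"
  shows "lie (E \<alpha>) (E \<beta>) \<noteq> 0"
proof
  assume kill: "lie (E \<alpha>) (E \<beta>) = 0"
  let ?a = "\<alpha> (tvec \<alpha>)" and ?\<gamma> = "\<alpha> + \<beta>"
  have \<alpha>': "- \<alpha> \<in> \<Omega>" by (rule root_minus[OF \<alpha>])
  obtain n' where n': "2 * \<beta> (tvec (- \<alpha>)) + of_nat n' * (- \<alpha>) (tvec (- \<alpha>)) = 0"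
    using string_length[OF \<alpha>' root_dual[OF \<beta>] E_root_space[OF \<beta>] E_nonzero[OF \<beta>]] kill by auto
  have neg: "\<delta> (- h) = - \<delta> h" if "\<delta> \<in> \<Omega>" "h \<in> H" for \<delta> h
    using root_dual[OF that(1)] that(2) by (auto simp: dual_space_def dest!: bspec spec[of _ "-1"])
  have tn: "\<beta> (tvec (- \<alpha>)) = - \<beta> (tvec \<alpha>)" "\<alpha> (tvec (- \<alpha>)) = - ?a"
    by (simp_all add: tvec_minus neg tvec_H \<alpha> \<beta>)
  obtain p where p: "\<And>k. k \<le> p \<Longrightarrow> (lie (E \<alpha>) ^^ k) (E ?\<gamma>) \<noteq> 0"
      "lie (E \<alpha>) ((lie (E \<alpha>) ^^ p) (E ?\<gamma>)) = 0"
    using string_top[OF \<alpha> root_dual[OF \<alpha>\<beta>] E_root_space[OF \<alpha>\<beta>] E_nonzero[OF \<alpha>\<beta>]] by blast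
  define u where "u = (lie (E \<alpha>) ^^ p) (E ?\<gamma>)"
  define \<delta> where "\<delta> = ?\<gamma> + fscale (of_nat p) \<alpha>"
  have \<delta>: "\<delta> \<in> dual_space H" unfolding \<delta>_def by (intro dual_add dual_scale root_dual \<alpha> \<beta>)
  have u: "u \<in> root_space H \<delta>" "u \<noteq> 0" "lie (E (- (- \<alpha>))) u = 0"
    using string_root_space[OF \<alpha> E_root_space[OF \<alpha>\<beta>], of p] p by (simp_all add: u_def \<delta>_def)
  obtain n where n: "\<And>k. k \<le> n \<Longrightarrow> (lie (E (- \<alpha>)) ^^ k) u \<noteq> 0"
    "2 * \<delta> (tvec (- \<alpha>)) + of_nat n * (- \<alpha>) (tvec (- \<alpha>)) = 0"
    using string_length[OF \<alpha>' \<delta> u] by metis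
  have d: "\<delta> (tvec (- \<alpha>)) = - (\<beta> (tvec \<alpha>) + (of_nat p + 1) * ?a)"
    by (simp add: \<delta>_def fscale_def tn algebra_simps)
  have "of_nat n * ?a = of_nat (n' + 2 * p + 2) * ?a"
    using n' n(2) unfolding d by (simp add: tn algebra_simps)
  then have nn: "n = n' + 2 * p + 2" using root_tvec_nonzero[OF \<alpha>] of_nat_eq_iff[of n "n' + 2 * p + 2"]
    by (metis mult_cancel_right)
  let ?v = "\<lambda>k. (lie (E (- \<alpha>)) ^^ k) u"
  \<comment> \<open>\<open>p + 1\<close> steps down from the top, at weight \<open>\<beta> + (p + 1)\<alpha>\<close>, lead to the line of \<open>E\<^sub>\<beta>\<close>.\<close>
  have "?v (Suc p) \<in> root_space H (\<delta> + fscale (of_nat (Suc p)) (- \<alpha>))"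
    by (rule string_root_space[OF \<alpha>' u(1)])
  also have "\<delta> + fscale (of_nat (Suc p)) (- \<alpha>) = \<beta>"
    by (auto simp: \<delta>_def fscale_def fun_eq_iff algebra_simps)
  finally have "?v (Suc p) = killing (?v (Suc p)) (E (- \<beta>)) *\<^sub>C E \<beta>"
    by (rule root_space_line[OF \<beta>])
  then have z: "lie (E (- (- \<alpha>))) (?v (Suc p)) = 0"
    using kill by (metis lie_scaleC_right minus_minus clie.scale_zero_right)
  have "(of_nat (Suc p) * (\<delta> (tvec (- \<alpha>)) + of_nat p / 2 * (- \<alpha>) (tvec (- \<alpha>)))) = 0"
    using string_lowering[OF \<alpha>' u(1,3), of p] z n(1)[of p] nn by auto
  then have "\<delta> (tvec (- \<alpha>)) + of_nat p / 2 * (- \<alpha>) (tvec (- \<alpha>)) = 0"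
    by (metis mult_eq_0_iff of_nat_eq_0_iff nat.distinct(1))
  then have "2 * \<delta> (tvec (- \<alpha>)) + of_nat p * (- \<alpha>) (tvec (- \<alpha>)) = 0"
    by (simp add: field_simps)
  then have "of_nat p * (- \<alpha>) (tvec (- \<alpha>)) = of_nat n * (- \<alpha>) (tvec (- \<alpha>))"
    by (metis add_left_cancel n(2))
  then have "of_nat p * ?a = of_nat n * ?a" by (simp add: tn)
  then have "n = p" using root_tvec_nonzero[OF \<alpha>] by (metis mult_cancel_right of_nat_eq_iff)
  then show False using nn by simp
qed

lemma structure_constant_nonzero:
  assumes "\<alpha> \<in> \<Omega>" "\<beta> \<in> \<Omega>" "\<alpha> + \<beta> \<in> \<Omega>"
  shows "killing (lie (E \<alpha>) (E \<beta>)) (E (- (\<alpha> + \<beta>))) \<noteq> 0"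
  using lie_E_E[OF assms] lie_E_E_nonzero[OF assms] by (metis clie.scale_zero_left)

end

section \<open>Positivity and independence of the simple roots\<close>

context rooted_algebra
begin

lemma root_expansion: "y - (\<Sum>\<alpha>\<in>\<Omega>. killing y (E (- \<alpha>)) *\<^sub>C E \<alpha>) \<in> H"
proof -
  let ?p = "\<lambda>y. y - (\<Sum>\<alpha>\<in>\<Omega>. killing y (E (- \<alpha>)) *\<^sub>C E \<alpha>)"
  have add: "?p (x + y) = ?p x + ?p y" for x y
    by (simp add: killing_simps scaleC_add_left sum.distrib algebra_simps)
  have scale: "?p (c *\<^sub>C x) = c *\<^sub>C ?p x" for c x
    by (simp add: killing_simps clie.scale_right_diff_distrib clie.scale_sum_right scaleC_scaleC)
  have "y \<in> {y. ?p y \<in> H}"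
  proof (rule UNIV_by_weights)
    show "clie.subspace {y. ?p y \<in> H}"
      unfolding clie.subspace_def mem_Collect_eq add scale
      using clie.subspace_0[OF H_sub] clie.subspace_add[OF H_sub] clie.subspace_scale[OF H_sub]
      by (simp add: killing_simps)
    show "H \<subseteq> {y. ?p y \<in> H}"
      by (auto simp: killing_H_E root_minus)
    fix \<alpha> assume \<alpha>: "\<alpha> \<in> \<Omega>"
    show "root_space H \<alpha> \<subseteq> {y. ?p y \<in> H}"
    proof
      fix x assume "x \<in> root_space H \<alpha>"
      then have x: "x = killing x (E (- \<alpha>)) *\<^sub>C E \<alpha>" by (rule root_space_line[OF \<alpha>])
      have "?p (E \<alpha>) = E \<alpha> - (\<Sum>\<beta>\<in>\<Omega>. (if \<beta> = \<alpha> then 1 else 0) *\<^sub>C E \<beta>)"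
        using \<alpha> by (intro arg_cong2[where f = minus] refl sum.cong)
          (auto simp: killing_E_E root_minus)
      also have "(\<Sum>\<beta>\<in>\<Omega>. (if \<beta> = \<alpha> then 1 else 0) *\<^sub>C E \<beta>) = (\<Sum>\<beta>\<in>\<Omega>. if \<beta> = \<alpha> then E \<beta> else 0)"
        by (rule sum.cong) (auto simp: scaleC_one)
      also have "\<dots> = E \<alpha>" using \<alpha> by (simp add: finite_roots)
      finally have "?p (E \<alpha>) = 0" by (simp del: uminus_apply)
      then have "?p (killing x (E (- \<alpha>)) *\<^sub>C E \<alpha>) = 0" unfolding scale by simp
      then have "?p x = 0" using x by simp
      then show "x \<in> {y. ?p y \<in> H}" using clie.subspace_0[OF H_sub] by simp
    qed
  qed
  then show ?thesis by simp
qed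

lemma UNIV_by_root_vectors:
  assumes "clie.subspace S" "H \<subseteq> S" "\<And>\<alpha>. \<alpha> \<in> \<Omega> \<Longrightarrow> E \<alpha> \<in> S"
  shows "x \<in> S"
proof (rule UNIV_by_weights[OF assms(1,2)])
  fix \<alpha> assume \<alpha>: "\<alpha> \<in> \<Omega>"
  show "root_space H \<alpha> \<subseteq> S"
  proof
    fix x assume "x \<in> root_space H \<alpha>"
    then have "x = killing x (E (- \<alpha>)) *\<^sub>C E \<alpha>" by (rule root_space_line[OF \<alpha>])
    then show "x \<in> S" using clie.subspace_scale[OF assms(1) assms(3)[OF \<alpha>]] by metis
  qed
qed

text \<open>The operator \<open>ad h \<circ> ad k\<close> is the sum over the roots of \<open>\<beta>(h) \<beta>(k)\<close> times the projection to the line of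
  \<open>E\<^sub>\<beta>\<close>, which has rank one.\<close>

lemma killing_H_trace:
  assumes h: "h \<in> H" and k: "k \<in> H"
  shows "killing h k = (\<Sum>\<beta>\<in>\<Omega>. \<beta> h * \<beta> k)"
proof -
  have lie_exp: "lie h x = (\<Sum>\<beta>\<in>\<Omega>. (\<beta> h * killing x (E (- \<beta>))) *\<^sub>C E \<beta>)" if h: "h \<in> H" for h x
  proof -
    define y where "y = x - (\<Sum>\<alpha>\<in>\<Omega>. killing x (E (- \<alpha>)) *\<^sub>C E \<alpha>)"
    have "lie h y = 0" using H_abelian[OF h root_expansion] by (simp add: y_def)
    moreover have "x = y + (\<Sum>\<alpha>\<in>\<Omega>. killing x (E (- \<alpha>)) *\<^sub>C E \<alpha>)" by (simp add: y_def)
    ultimately have "lie h x = (\<Sum>\<alpha>\<in>\<Omega>. lie h (killing x (E (- \<alpha>)) *\<^sub>C E \<alpha>))"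
      by (metis lie_add_right add_0 lie_sum_right)
    then show ?thesis by (simp add: lie_scaleC_right lie_H_E[OF h] scaleC_scaleC mult.commute)
  qed
  have "lie h (lie k x) = (\<Sum>\<beta>\<in>\<Omega>. (\<beta> h * \<beta> k) *\<^sub>C (killing x (E (- \<beta>)) *\<^sub>C E \<beta>))" for x
    by (subst lie_exp[OF k])
      (simp add: lie_sum_right lie_scaleC_right lie_H_E[OF h] scaleC_scaleC mult_ac)
  then have "killing h k = endo_trace (\<lambda>x. \<Sum>\<beta>\<in>\<Omega>. (\<beta> h * \<beta> k) *\<^sub>C (killing x (E (- \<beta>)) *\<^sub>C E \<beta>))"
    unfolding killing_def[of h] by simp
  also have "\<dots> = (\<Sum>\<beta>\<in>\<Omega>. \<beta> h * \<beta> k * killing (E \<beta>) (E (- \<beta>)))"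
    by (simp only: endo_trace_sum endo_trace_scale endo_trace_rank_one[OF killing_hom_left])
  also have "\<dots> = (\<Sum>\<beta>\<in>\<Omega>. \<beta> h * \<beta> k)" by (rule sum.cong) (simp_all add: killing_E)
  finally show ?thesis .
qed

lemma inner_sym: "\<alpha> \<in> \<Omega> \<Longrightarrow> \<beta> \<in> \<Omega> \<Longrightarrow> \<alpha> (tvec \<beta>) = \<beta> (tvec \<alpha>)"
  using killing_tvec[of \<alpha> "tvec \<beta>"] killing_tvec[of \<beta> "tvec \<alpha>"] tvec_H
    killing_sym[of "tvec \<alpha>" "tvec \<beta>"] by simp

text \<open>By \<open>killing_H_trace\<close> and \<open>weight_integral\<close> the number \<open>a = \<alpha>(tvec \<alpha>)\<close> satisfies \<open>4a = a\<^sup>2 \<Sum> z\<^sub>\<beta>\<^sup>2\<close> with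
  integers \<open>z\<^sub>\<beta>\<close>.\<close>

lemma inner_self:
  assumes \<alpha>: "\<alpha> \<in> \<Omega>"
  obtains r where "r > 0" "\<alpha> (tvec \<alpha>) = of_real r"
proof -
  let ?a = "\<alpha> (tvec \<alpha>)"
  have "\<forall>\<beta>\<in>\<Omega>. \<exists>z :: int. 2 * \<beta> (tvec \<alpha>) = of_int z * ?a"
    using weight_integral[OF \<alpha>] by metis
  then obtain z :: "('g \<Rightarrow> complex) \<Rightarrow> int" where z: "\<And>\<beta>. \<beta> \<in> \<Omega> \<Longrightarrow> 2 * \<beta> (tvec \<alpha>) = of_int (z \<beta>) * ?a"
    by metis
  define s where "s = (\<Sum>\<beta>\<in>\<Omega>. (of_int (z \<beta>))\<^sup>2 :: real)"
  have "?a = (\<Sum>\<beta>\<in>\<Omega>. \<beta> (tvec \<alpha>) * \<beta> (tvec \<alpha>))"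
    using killing_H_trace[OF tvec_H[OF \<alpha>] tvec_H[OF \<alpha>]] killing_tvec[OF \<alpha> tvec_H[OF \<alpha>]] by simp
  then have "4 * ?a = (\<Sum>\<beta>\<in>\<Omega>. (2 * \<beta> (tvec \<alpha>)) * (2 * \<beta> (tvec \<alpha>)))"
    by (simp add: sum_distrib_left)
  also have "\<dots> = (\<Sum>\<beta>\<in>\<Omega>. (of_int (z \<beta>) * ?a) * (of_int (z \<beta>) * ?a))"
    by (rule sum.cong) (simp_all add: z)
  also have "\<dots> = of_real s * (?a * ?a)"
    by (simp add: s_def sum_distrib_left sum_distrib_right power2_eq_square mult_ac)
  finally have "?a * (of_real s * ?a - 4) = 0" by (simp add: algebra_simps)
  then have eq: "of_real s * ?a = 4" using root_tvec_nonzero[OF \<alpha>] by simp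
  have "s \<ge> 0" unfolding s_def by (simp add: sum_nonneg)
  moreover have "s \<noteq> 0" using eq by auto
  ultimately have "s > 0" by simp
  moreover have "?a = of_real (4 / s)" using eq \<open>s \<noteq> 0\<close> by (simp add: field_simps)
  ultimately show ?thesis using that[of "4 / s"] by simp
qed

lemma inner_real: "\<alpha> \<in> \<Omega> \<Longrightarrow> \<beta> \<in> \<Omega> \<Longrightarrow> \<beta> (tvec \<alpha>) = of_real (Re (\<beta> (tvec \<alpha>)))"
proof -
  assume \<alpha>: "\<alpha> \<in> \<Omega>" and \<beta>: "\<beta> \<in> \<Omega>"
  obtain z :: int where z: "2 * \<beta> (tvec \<alpha>) = of_int z * \<alpha> (tvec \<alpha>)" using weight_integral[OF \<alpha> \<beta>] .
  obtain r where r: "\<alpha> (tvec \<alpha>) = of_real r" using inner_self[OF \<alpha>] .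
  have "\<beta> (tvec \<alpha>) = of_real (of_int z * r / 2)" using z r by (simp add: field_simps)
  then show ?thesis by (metis Re_complex_of_real)
qed

lemma simple_subset: "simple_roots P \<subseteq> P" "simple_roots P \<subseteq> \<Omega>"
  using P_subset by (auto simp: simple_roots_def)

lemma simple_diff:
  assumes "\<alpha> \<in> simple_roots P" "\<beta> \<in> simple_roots P"
  shows "\<alpha> - \<beta> \<notin> \<Omega>"
proof
  assume "\<alpha> - \<beta> \<in> \<Omega>"
  then have "\<alpha> - \<beta> \<in> P \<or> \<beta> - \<alpha> \<in> P" using root_cases[of "\<alpha> - \<beta>"] by simp
  moreover have "\<alpha> = \<beta> + (\<alpha> - \<beta>)" "\<beta> = \<alpha> + (\<beta> - \<alpha>)" by simp_all
  ultimately show False using assms unfolding simple_roots_def by blast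
qed

text \<open>A difference of simple roots is not a root, so \<open>E\<^sub>\<alpha>\<close> is a lowest vector for the string of \<open>\<beta>\<close>.\<close>

lemma simple_inner_nonpos:
  assumes \<alpha>: "\<alpha> \<in> simple_roots P" and \<beta>: "\<beta> \<in> simple_roots P" and "\<alpha> \<noteq> \<beta>"
  shows "Re (\<alpha> (tvec \<beta>)) \<le> 0"
proof -
  have r: "\<alpha> \<in> \<Omega>" "\<beta> \<in> \<Omega>" using simple_subset \<alpha> \<beta> by auto
  have "lie (E (- \<beta>)) (E \<alpha>) = 0"
    by (rule lie_E_E_zero[OF root_minus[OF r(2)] r(1)])
      (use simple_diff[OF \<alpha> \<beta>] \<open>\<alpha> \<noteq> \<beta>\<close> in simp_all)
  then obtain n where n: "2 * \<alpha> (tvec \<beta>) + of_nat n * \<beta> (tvec \<beta>) = 0"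
    using string_length[OF r(2) root_dual[OF r(1)] E_root_space[OF r(1)] E_nonzero[OF r(1)]] by metis
  obtain b where b: "b > 0" "\<beta> (tvec \<beta>) = of_real b" using inner_self[OF r(2)] .
  have "Re (2 * \<alpha> (tvec \<beta>) + of_nat n * \<beta> (tvec \<beta>)) = 0" using n by simp
  then have "2 * Re (\<alpha> (tvec \<beta>)) + real n * b = 0" by (simp add: b(2))
  moreover have "real n * b \<ge> 0" using b(1) by simp
  ultimately show ?thesis by linarith
qed

lemma finite_simple: "finite (simple_roots P)"
  using finite_subset[OF simple_subset(2) finite_roots] .

lemma dual_sum:
  assumes "\<beta> \<in> dual_space H" "\<And>i. i \<in> I \<Longrightarrow> f i \<in> H"
  shows "\<beta> (\<Sum>i\<in>I. c i *\<^sub>C f i) = (\<Sum>i\<in>I. c i * \<beta> (f i))"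
proof -
  have "\<beta> (0 *\<^sub>C 0) = 0 * \<beta> 0"
    using assms(1) clie.subspace_0[OF H_sub] unfolding dual_space_def by blast
  then have z: "\<beta> 0 = 0" by simp
  show ?thesis using assms(2)
  proof (induction I rule: infinite_finite_induct)
    case (insert i I)
    have "(\<Sum>i\<in>I. c i *\<^sub>C f i) \<in> H" "c i *\<^sub>C f i \<in> H" "f i \<in> H"
      using insert by (auto intro!: clie.subspace_sum clie.subspace_scale H_sub)
    then have "\<beta> (c i *\<^sub>C f i + (\<Sum>i\<in>I. c i *\<^sub>C f i)) = c i * \<beta> (f i) + \<beta> (\<Sum>i\<in>I. c i *\<^sub>C f i)"
      using assms(1) by (simp add: dual_space_def)
    then show ?case using insert by simp
  qed (simp_all add: z)
qed

text \<open>The classical obtuse angle argument. Split the relation as \<open>u = w\<close> with nonnegative coefficients \<open>q\<close> and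
  \<open>r\<close> of disjoint support. Then \<open>\<kappa>(u, u)\<close> is at most 0 because different simple roots have nonpositive
  inner product, and at least 0 as a sum of squares, so \<open>u = 0\<close>; but all simple roots are positive on
  the regular element that defines the positive system. The hypothesis is stated for the
  values on the vectors \<open>tvec j\<close> only, because there the roots are real: this lets the lemma be
  applied to the real and imaginary parts of a complex relation.\<close>

lemma simple_combination_nonpos:
  fixes p :: "('g \<Rightarrow> complex) \<Rightarrow> real"
  assumes p: "\<And>j. j \<in> simple_roots P \<Longrightarrow> (\<Sum>i\<in>simple_roots P. of_real (p i) * i (tvec j)) = 0"
    and i: "i \<in> simple_roots P"
  shows "p i \<le> 0"
proof -
  let ?S = "simple_roots P"
  define q where "q i = max (p i) 0" for i
  define r where "r i = max (- p i) 0" for i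
  define u where "u = (\<Sum>i\<in>?S. of_real (q i) *\<^sub>C tvec i)"
  define w where "w = (\<Sum>i\<in>?S. of_real (r i) *\<^sub>C tvec i)"
  have S: "j \<in> \<Omega>" "tvec j \<in> H" if "j \<in> ?S" for j
    using that simple_subset tvec_H by auto
  have uH: "u \<in> H" unfolding u_def by (intro clie.subspace_sum clie.subspace_scale H_sub S(2))
  have eval: "\<beta> u = (\<Sum>i\<in>?S. of_real (q i) * \<beta> (tvec i))" 
    "\<beta> w = (\<Sum>i\<in>?S. of_real (r i) * \<beta> (tvec i))" if "\<beta> \<in> \<Omega>" for \<beta>
    unfolding u_def w_def by (rule dual_sum[OF root_dual[OF that] S(2)]; assumption)+
  have uw: "j u = j w" if j: "j \<in> ?S" for j
  proof -
    have "j u - j w = (\<Sum>i\<in>?S. of_real (p i) * j (tvec i))"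
      unfolding eval[OF S(1)[OF j]] sum_subtractf[symmetric]
      by (rule sum.cong) (auto simp: q_def r_def max_def)
    also have "\<dots> = (\<Sum>i\<in>?S. of_real (p i) * i (tvec j))"
      by (rule sum.cong) (simp_all add: inner_sym[OF S(1)[OF j] S(1)])
    finally show ?thesis using p[OF j] by simp
  qed
  have "killing u u = (\<Sum>i\<in>?S. of_real (q i) * killing u (tvec i))"
    by (subst (2) u_def) (simp add: killing_simps)
  also have "\<dots> = (\<Sum>i\<in>?S. of_real (q i) * i w)"
    by (rule sum.cong) (simp_all add: killing_tvec[OF S(1) uH] uw)
  also have "\<dots> = (\<Sum>i\<in>?S. \<Sum>k\<in>?S. of_real (q i * r k) * i (tvec k))"
    by (rule sum.cong) (simp_all add: eval(2) S(1) sum_distrib_left mult_ac)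
  finally have "Re (killing u u) = (\<Sum>i\<in>?S. \<Sum>k\<in>?S. q i * r k * Re (i (tvec k)))" by simp
  also have "\<dots> \<le> 0"
  proof (intro sum_nonpos)
    fix i k assume "i \<in> ?S" "k \<in> ?S"
    show "q i * r k * Re (i (tvec k)) \<le> 0"
    proof (cases "i = k")
      case True
      then show ?thesis by (auto simp: q_def r_def max_def)
    next
      case False
      then have "Re (i (tvec k)) \<le> 0" using simple_inner_nonpos \<open>i \<in> ?S\<close> \<open>k \<in> ?S\<close> by blast
      moreover have "0 \<le> q i * r k" by (simp add: q_def r_def)
      ultimately show ?thesis by (rule mult_nonneg_nonpos[rotated])
    qed
  qed
  finally have le: "Re (killing u u) \<le> 0" .
  have real: "\<beta> u = of_real (Re (\<beta> u))" if "\<beta> \<in> \<Omega>" for \<beta>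
  proof -
    have "\<beta> u = (\<Sum>i\<in>?S. of_real (q i * Re (\<beta> (tvec i))))"
      unfolding eval(1)[OF that]
    proof (rule sum.cong)
      fix i assume "i \<in> ?S"
      then show "of_real (q i) * \<beta> (tvec i) = of_real (q i * Re (\<beta> (tvec i)))"
        by (subst inner_real[OF S(1) that]) simp_all
    qed simp
    then have "\<beta> u = of_real (\<Sum>i\<in>?S. q i * Re (\<beta> (tvec i)))" by simp
    then show ?thesis by simp
  qed
  have "killing u u = of_real (\<Sum>\<beta>\<in>\<Omega>. (Re (\<beta> u))\<^sup>2)"
    unfolding killing_H_trace[OF uH uH] of_real_sum
  proof (rule sum.cong)
    fix \<beta> assume "\<beta> \<in> \<Omega>"
    then show "\<beta> u * \<beta> u = of_real ((Re (\<beta> u))\<^sup>2)"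
      using real[of \<beta>] by (metis of_real_mult power2_eq_square)
  qed simp
  then have "(\<Sum>\<beta>\<in>\<Omega>. (Re (\<beta> u))\<^sup>2) \<le> 0" using le by simp
  then have "(\<Sum>\<beta>\<in>\<Omega>. (Re (\<beta> u))\<^sup>2) = 0" by (meson order_antisym sum_nonneg zero_le_power2)
  then have "\<forall>\<beta>\<in>\<Omega>. (Re (\<beta> u))\<^sup>2 = 0" by (simp add: sum_nonneg_eq_0_iff finite_roots)
  then have "\<beta> u = 0" if "\<beta> \<in> \<Omega>" for \<beta> using real[OF that] that by simp
  then have u0: "u = 0" by (rule roots_separate[OF uH])
  obtain t where t: "t \<in> H" "P = {\<alpha> \<in> \<Omega>. 0 < Re (\<alpha> t)}"
    using positive by (auto simp: positive_system_def)
  have "0 = killing t u" by (simp add: u0 killing_simps)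
  also have "\<dots> = (\<Sum>i\<in>?S. of_real (q i) * i t)"
    unfolding u_def by (simp add: killing_simps killing_tvec[OF S(1) t(1)])
  finally have "(\<Sum>i\<in>?S. of_real (q i) * i t) = 0" by simp
  then have "Re (\<Sum>i\<in>?S. of_real (q i) * i t) = 0" by simp
  then have sum0: "(\<Sum>i\<in>?S. q i * Re (i t)) = 0" by simp
  have pos: "Re (i t) > 0" if "i \<in> ?S" for i using that simple_subset t(2) by auto
  have "\<forall>i\<in>?S. q i * Re (i t) = 0"
  proof (subst sum_nonneg_eq_0_iff[OF finite_simple, symmetric])
    show "0 \<le> q i * Re (i t)" if "i \<in> ?S" for i
      using pos[OF that] by (simp add: q_def)
  qed (fact sum0)
  then have "q i = 0" using i pos[OF i] by auto
  then show ?thesis by (simp add: q_def max_def split: if_splits)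
qed

lemma simple_independent: "cfun.independent (simple_roots P)"
proof (rule cfun.independent_if_scalars_zero[OF finite_simple])
  let ?S = "simple_roots P"
  fix f x assume s: "(\<Sum>x\<in>?S. fscale (f x) x) = 0" and x: "x \<in> ?S"
  have z: "(\<Sum>i\<in>?S. f i * i h) = 0" for h
  proof -
    have "(\<Sum>x\<in>?S. fscale (f x) x) h = (\<Sum>i\<in>?S. f i * i h)"
      by (simp add: sum_apply fscale_def)
    then show ?thesis using s by simp
  qed
  have part: "(\<Sum>i\<in>?S. of_real (g (f i)) * i (tvec j)) = 0"
    if j: "j \<in> ?S" and g: "g = Re \<or> g = Im" for j g
  proof -
    have r: "i (tvec j) = of_real (Re (i (tvec j)))" if "i \<in> ?S" for i
      using inner_real simple_subset that j by blast
    have "(\<Sum>i\<in>?S. of_real (g (f i)) * i (tvec j)) = (\<Sum>i\<in>?S. of_real (g (f i) * Re (i (tvec j))))"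
    proof (rule sum.cong)
      fix i assume "i \<in> ?S"
      then show "of_real (g (f i)) * i (tvec j) = of_real (g (f i) * Re (i (tvec j)))"
        by (subst r) simp_all
    qed simp
    also have "\<dots> = of_real (\<Sum>i\<in>?S. g (f i) * Re (i (tvec j)))" by simp
    also have "(\<Sum>i\<in>?S. g (f i) * Re (i (tvec j))) = (\<Sum>i\<in>?S. g (f i * of_real (Re (i (tvec j)))))"
      using g by auto
    also have "\<dots> = (\<Sum>i\<in>?S. g (f i * i (tvec j)))"
      by (rule sum.cong) (simp_all flip: r)
    also have "\<dots> = g (\<Sum>i\<in>?S. f i * i (tvec j))" using g by auto
    also have "\<dots> = 0" using g by (auto simp: z)
    finally show ?thesis by simp
  qed
  have "g (f x) = 0" if g: "g = Re \<or> g = Im" for g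
  proof (rule order_antisym)
    show "g (f x) \<le> 0" by (rule simple_combination_nonpos[OF part[OF _ g] x])
    have "- g (f x) \<le> 0"
      by (rule simple_combination_nonpos[OF _ x]) (simp add: part[OF _ g] sum_negf)
    then show "0 \<le> g (f x)" by simp
  qed
  then show "f x = 0" by (simp add: complex_eq_iff)
qed

lemma positive_induct [consumes 1, case_names simple add]:
  assumes "\<alpha> \<in> P" and simple: "\<And>\<alpha>. \<alpha> \<in> simple_roots P \<Longrightarrow> Q \<alpha>"
    and add: "\<And>\<beta> \<gamma>. \<beta> \<in> P \<Longrightarrow> \<gamma> \<in> P \<Longrightarrow> \<beta> + \<gamma> \<in> P \<Longrightarrow> Q \<beta> \<Longrightarrow> Q \<gamma> \<Longrightarrow> Q (\<beta> + \<gamma>)"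
  shows "Q \<alpha>"
proof -
  obtain t where t: "t \<in> H" "P = {\<alpha> \<in> \<Omega>. 0 < Re (\<alpha> t)}"
    using positive by (auto simp: positive_system_def)
  let ?m = "\<lambda>\<alpha>. card {\<beta> \<in> P. Re (\<beta> t) < Re (\<alpha> t)}"
  have fin: "finite P" using finite_subset[OF P_subset finite_roots] .
  have m: "?m \<beta> < ?m \<alpha>" if "\<beta> \<in> P" "Re (\<beta> t) < Re (\<alpha> t)" for \<alpha> \<beta>
    by (rule psubset_card_mono) (use that fin in auto)
  show ?thesis using assms(1)
  proof (induction "?m \<alpha>" arbitrary: \<alpha> rule: less_induct)
    case less
    show ?case
    proof (cases "\<alpha> \<in> simple_roots P")
      case True
      then show ?thesis by (rule simple)
    next
      case False
      then obtain \<beta> \<gamma> where d: "\<beta> \<in> P" "\<gamma> \<in> P" "\<alpha> = \<beta> + \<gamma>"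
        using less.prems by (auto simp: simple_roots_def)
      have lt: "Re (\<beta> t) < Re (\<alpha> t)" "Re (\<gamma> t) < Re (\<alpha> t)" using d t(2) by auto
      have "Q \<beta>" by (rule less.hyps) (fact m[where \<beta> = \<beta> and \<alpha> = \<alpha>, OF d(1) lt(1)], fact d(1))
      moreover have "Q \<gamma>" by (rule less.hyps) (fact m[where \<beta> = \<gamma> and \<alpha> = \<alpha>, OF d(2) lt(2)], fact d(2))
      ultimately show ?thesis using add[OF d(1,2)] d(3) less.prems by simp
    qed
  qed
qed

abbreviation coef :: "('g \<Rightarrow> complex) \<Rightarrow> ('g \<Rightarrow> complex) \<Rightarrow> complex" where
  "coef \<equiv> cfun.representation (simple_roots P)"

lemma positive_coefs:
  assumes "\<alpha> \<in> P"
  shows "\<alpha> \<in> cfun.span (simple_roots P) \<and> (\<forall>i. \<exists>n :: nat. coef \<alpha> i = of_nat n)"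
  using assms
proof (induction rule: positive_induct)
  case (simple \<alpha>)
  have "\<exists>n :: nat. coef \<alpha> i = of_nat n" for i
    using cfun.representation_basis[OF simple_independent simple]
    by (cases "i = \<alpha>") (auto intro: exI[of _ 1] exI[of _ 0])
  then show ?case using simple by (simp add: cfun.span_base)
next
  case (add \<beta> \<gamma>)
  have "\<exists>n :: nat. coef (\<beta> + \<gamma>) i = of_nat n" for i
  proof -
    obtain m n :: nat where "coef \<beta> i = of_nat m" "coef \<gamma> i = of_nat n" using add.IH by blast
    then have "coef (\<beta> + \<gamma>) i = of_nat (m + n)"
      using add.IH by (simp add: cfun.representation_add[OF simple_independent])
    then show ?thesis by blast
  qed
  then show ?case using add.IH cfun.span_add by blast
qed

lemma root_span: "\<alpha> \<in> \<Omega> \<Longrightarrow> \<alpha> \<in> cfun.span (simple_roots P)"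
  using root_cases[of \<alpha>] positive_coefs cfun.span_neg[of "- \<alpha>"] by auto

lemma coef_span_subset:
  assumes "\<Delta> \<subseteq> simple_roots P" "v \<in> cfun.span \<Delta>" "i \<notin> \<Delta>"
  shows "coef v i = 0"
  using cfun.representation_extend[OF simple_independent assms(2,1)]
    cfun.representation_ne_zero[of \<Delta> v i] assms(3) by auto

lemma span_by_coef:
  assumes "v \<in> cfun.span (simple_roots P)" "\<And>i. i \<notin> \<Delta> \<Longrightarrow> coef v i = 0"
  shows "v \<in> cfun.span \<Delta>"
proof -
  have "v = (\<Sum>b | coef v b \<noteq> 0. fscale (coef v b) b)"
    using cfun.sum_nonzero_representation_eq[OF simple_independent assms(1)] by simp
  also have "\<dots> \<in> cfun.span \<Delta>"
    using assms(2) by (intro cfun.span_sum cfun.span_scale cfun.span_base) auto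
  finally show ?thesis .
qed

lemma span_summand:
  assumes \<Delta>: "\<Delta> \<subseteq> simple_roots P" and "\<beta> \<in> P" "\<gamma> \<in> P" "\<beta> + \<gamma> \<in> cfun.span \<Delta>"
  shows "\<beta> \<in> cfun.span \<Delta>"
proof (rule span_by_coef)
  show "\<beta> \<in> cfun.span (simple_roots P)" using positive_coefs[OF assms(2)] by blast
  fix i assume "i \<notin> \<Delta>"
  then have z: "coef (\<beta> + \<gamma>) i = 0" using coef_span_subset[OF \<Delta> assms(4)] by blast
  obtain m n :: nat where mn: "coef \<beta> i = of_nat m" "coef \<gamma> i = of_nat n"
    using positive_coefs assms(2,3) by meson
  then have "of_nat (m + n) = (0 :: complex)"
    using z positive_coefs assms(2,3) by (simp add: cfun.representation_add[OF simple_independent])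
  then have "m = 0" by (metis add_is_0 of_nat_eq_0_iff)
  then show "coef \<beta> i = 0" using mn by simp
qed

end

section \<open>Two consequences of simplicity for root systems\<close>

context rooted_algebra
begin

text \<open>If neither \<open>\<gamma> - \<alpha>\<close> nor \<open>\<alpha> + \<beta> + \<gamma>\<close> is zero or a root, then \<open>E\<^sub>\<gamma>\<close> commutes with \<open>E\<^sub>-\<^sub>\<alpha>\<close> and \<open>E\<^sub>\<alpha>\<^sub>+\<^sub>\<beta>\<close>, hence with their
  bracket, a nonzero multiple of \<open>E\<^sub>\<beta>\<close>; so \<open>\<beta> + \<gamma>\<close> is not a root.\<close>

lemma root_commute:
  assumes \<alpha>: "\<alpha> \<in> \<Omega>" and \<beta>: "\<beta> \<in> \<Omega>" and \<alpha>\<beta>: "\<alpha> + \<beta> \<in> \<Omega>" and \<gamma>: "\<gamma> \<in> \<Omega>" and \<beta>\<gamma>: "\<beta> + \<gamma> \<in> \<Omega>"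
  shows "\<gamma> - \<alpha> \<in> insert 0 \<Omega> \<or> \<alpha> + \<beta> + \<gamma> \<in> insert 0 \<Omega>"
proof (rule ccontr)
  assume "\<not> ?thesis"
  then have n: "\<gamma> + - \<alpha> \<notin> \<Omega>" "\<gamma> + - \<alpha> \<noteq> 0" "\<gamma> + (\<alpha> + \<beta>) \<notin> \<Omega>" "\<gamma> + (\<alpha> + \<beta>) \<noteq> 0"
    by (auto simp: ac_simps)
  have \<alpha>': "- \<alpha> \<in> \<Omega>" by (rule root_minus[OF \<alpha>])
  have \<beta>_eq: "- \<alpha> + (\<alpha> + \<beta>) = \<beta>" by simp
  have "lie (E \<gamma>) (lie (E (- \<alpha>)) (E (\<alpha> + \<beta>))) = 0"
    using lie_E_E_zero[OF \<gamma> \<alpha>' n(1,2)] lie_E_E_zero[OF \<gamma> \<alpha>\<beta> n(3,4)]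
    by (simp only: lie_derivation[of "E \<gamma>"] lie_zero_left lie_zero_right add_0)
  moreover have "\<exists>N. N \<noteq> 0 \<and> lie (E (- \<alpha>)) (E (\<alpha> + \<beta>)) = N *\<^sub>C E \<beta>"
    using lie_E_E[OF \<alpha>' \<alpha>\<beta>] structure_constant_nonzero[OF \<alpha>' \<alpha>\<beta>] \<beta> unfolding \<beta>_eq by blast
  then obtain N where "N \<noteq> 0" "lie (E (- \<alpha>)) (E (\<alpha> + \<beta>)) = N *\<^sub>C E \<beta>" by blast
  ultimately have "lie (E \<gamma>) (E \<beta>) = 0" by (simp add: lie_scaleC_right)
  moreover have "\<gamma> + \<beta> \<in> \<Omega>" using \<beta>\<gamma> by (simp add: add.commute)
  ultimately show False using lie_E_E_nonzero[OF \<gamma> \<beta>] by blast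
qed

text \<open>The closure condition makes the subalgebra generated by the \<open>E\<^sub>\<alpha>\<close>, \<open>\<alpha> \<in> X\<close>, an ideal, hence everything.
  A root \<open>\<beta>\<close> outside \<open>X \<union> Y\<close> would have \<open>E\<^sub>\<beta>\<close> commuting with the generators, hence central. This
  replaces arguments with the connectedness of the Dynkin diagram.\<close>

lemma roots_exhausted:
  assumes X: "X \<subseteq> \<Omega>" "X \<noteq> {}" "\<And>\<alpha>. \<alpha> \<in> X \<Longrightarrow> - \<alpha> \<in> X"
    and closed: "\<And>\<alpha> \<beta>. \<alpha> \<in> X \<Longrightarrow> \<beta> \<in> \<Omega> \<Longrightarrow> \<alpha> + \<beta> \<in> \<Omega> \<Longrightarrow> \<beta> \<in> X \<or> \<beta> \<in> Y \<and> \<alpha> + \<beta> \<in> X"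
  shows "\<Omega> \<subseteq> X \<union> Y"
proof
  let ?J = "lie_generated (E ` X)"
  have sub: "clie.subspace ?J" "\<And>u v. u \<in> ?J \<Longrightarrow> v \<in> ?J \<Longrightarrow> lie u v \<in> ?J"
    using lie_subalgebra_generated[of "E ` X"] by (auto simp: lie_subalgebra_def)
  have EJ: "E \<alpha> \<in> ?J" if "\<alpha> \<in> X" for \<alpha> using that by (simp add: lie_generated_base)
  have "x \<in> {x. \<forall>y\<in>?J. lie x y \<in> ?J}" for x
  proof (rule UNIV_by_root_vectors)
    show "clie.subspace {x. \<forall>y\<in>?J. lie x y \<in> ?J}"
      using sub(1) by (auto simp: clie.subspace_def lie_add_left lie_scaleC_left)
    show "H \<subseteq> {x. \<forall>y\<in>?J. lie x y \<in> ?J}"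
    proof (intro subsetI CollectI ballI)
      fix h y assume h: "h \<in> H" and y: "y \<in> ?J"
      show "lie h y \<in> ?J"
      proof (rule lie_generated_normalized[OF _ y])
        fix e assume "e \<in> E ` X"
        then obtain \<alpha> where \<alpha>: "\<alpha> \<in> X" "e = E \<alpha>" by blast
        then show "lie h e \<in> ?J"
          using X(1) lie_H_E[OF h, of \<alpha>] clie.subspace_scale[OF sub(1) EJ] by auto
      qed
    qed
    fix \<beta> assume \<beta>: "\<beta> \<in> \<Omega>"
    show "E \<beta> \<in> {x. \<forall>y\<in>?J. lie x y \<in> ?J}"
    proof (cases "\<beta> \<in> X")
      case True
      then show ?thesis using sub(2) EJ by blast
    next
      case False
      show ?thesis
      proof (intro CollectI ballI)
        fix y assume y: "y \<in> ?J"
        show "lie (E \<beta>) y \<in> ?J"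
        proof (rule lie_generated_normalized[OF _ y])
          fix e assume "e \<in> E ` X"
          then obtain \<alpha> where \<alpha>: "\<alpha> \<in> X" "e = E \<alpha>" by blast
          have \<alpha>\<Omega>: "\<alpha> \<in> \<Omega>" using \<alpha>(1) X(1) by blast
          have nz: "\<beta> + \<alpha> \<noteq> 0"
          proof
            assume "\<beta> + \<alpha> = 0"
            then have "\<beta> = - \<alpha>" by (simp add: eq_neg_iff_add_eq_0)
            then show False using X(3)[OF \<alpha>(1)] False by simp
          qed
          show "lie (E \<beta>) e \<in> ?J"
          proof (cases "\<beta> + \<alpha> \<in> \<Omega>")
            case True
            then have "\<beta> + \<alpha> \<in> X" using closed[OF \<alpha>(1) \<beta>] False by (simp add: add.commute)
            then show ?thesis
              using lie_E_E[OF \<beta> \<alpha>\<Omega> True] clie.subspace_scale[OF sub(1) EJ] \<alpha>(2) by metis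
          next
            case False
            then show ?thesis
              using lie_E_E_zero[OF \<beta> \<alpha>\<Omega> False nz] \<alpha>(2) clie.subspace_0[OF sub(1)] by simp
          qed
        qed
      qed
    qed
  qed
  then have ideal: "lie x y \<in> ?J" if "y \<in> ?J" for x y using that by blast
  have "lie_ideal ?J"
    using ideal sub(1) by (simp add: lie_ideal_def clie.subspace_def)
  moreover obtain \<alpha> where "\<alpha> \<in> X" using X(2) by blast
  then have "?J \<noteq> {0}" using EJ[of \<alpha>] E_nonzero[of \<alpha>] X(1) by auto
  ultimately have J: "?J = UNIV" using simple by blast
  fix \<beta> assume \<beta>: "\<beta> \<in> \<Omega>"
  show "\<beta> \<in> X \<union> Y"
  proof (rule ccontr)
    assume n: "\<beta> \<notin> X \<union> Y"
    have "lie_generated (E ` X) \<subseteq> {y. lie (E \<beta>) y = 0}"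
    proof (rule lie_generated_least)
      show "lie_subalgebra {y. lie (E \<beta>) y = 0}"
        using centralizer_subspace by (auto simp: lie_subalgebra_def lie_derivation[of "E \<beta>"])
      show "E ` X \<subseteq> {y. lie (E \<beta>) y = 0}"
      proof safe
        fix \<alpha> assume \<alpha>: "\<alpha> \<in> X"
        have "\<beta> + \<alpha> \<notin> \<Omega>" using closed[OF \<alpha> \<beta>] n by (auto simp: add.commute)
        moreover have "\<beta> + \<alpha> \<noteq> 0" using X(3)[OF \<alpha>] n by (auto simp: add_eq_0_iff2)
        ultimately show "lie (E \<beta>) (E \<alpha>) = 0"
          using lie_E_E_zero[OF \<beta>] \<alpha> X(1) by blast
      qed
    qed
    then have "E \<beta> = 0" using J center_trivial by blast
    then show False using E_nonzero[OF \<beta>] by simp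
  qed
qed

end

section \<open>The Levi subalgebra and the projection of roots\<close>

locale orbit_algebra = rooted_algebra H P E
  for H :: "'g :: simple_complex_lie_algebra set" and P E +
  fixes \<Gamma> :: "('g \<Rightarrow> complex) set" and l :: "('g \<Rightarrow> complex) \<Rightarrow> complex"
  assumes simple_part: "\<Gamma> \<subseteq> simple_roots P" and form: "orbit_form H P \<Gamma> l"
begin

abbreviation \<Lambda> :: "('g \<Rightarrow> complex) set" where "\<Lambda> \<equiv> levi_roots H \<Gamma>"
abbreviation \<Theta> :: "('g \<Rightarrow> complex) set" where "\<Theta> \<equiv> \<Omega> - \<Lambda>"
abbreviation \<LL> :: "'g set" where "\<LL> \<equiv> levi H E \<Gamma>"

lemma levi_root_minus: "\<gamma> \<in> \<Lambda> \<Longrightarrow> - \<gamma> \<in> \<Lambda>"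
  using root_minus cfun.span_neg[of \<gamma> \<Gamma>] by (auto simp: levi_roots_def)

lemma levi_root_add: "\<gamma> \<in> \<Lambda> \<Longrightarrow> \<delta> \<in> \<Lambda> \<Longrightarrow> \<gamma> + \<delta> \<in> \<Omega> \<Longrightarrow> \<gamma> + \<delta> \<in> \<Lambda>"
  by (auto simp: levi_roots_def intro: cfun.span_add)

lemma compl_minus: "\<alpha> \<in> \<Theta> \<Longrightarrow> - \<alpha> \<in> \<Theta>"
  using root_minus levi_root_minus[of "- \<alpha>"] by auto

lemma compl_add_levi: "\<alpha> \<in> \<Theta> \<Longrightarrow> \<gamma> \<in> \<Lambda> \<Longrightarrow> \<alpha> + \<gamma> \<in> \<Omega> \<Longrightarrow> \<alpha> + \<gamma> \<in> \<Theta>"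
  using levi_root_add[of "\<alpha> + \<gamma>" "- \<gamma>"] levi_root_minus[of \<gamma>] by auto

lemma compl_add_levi_nonzero: "\<alpha> \<in> \<Theta> \<Longrightarrow> \<gamma> \<in> \<Lambda> \<Longrightarrow> \<alpha> + \<gamma> \<noteq> 0"
  using levi_root_minus[of \<gamma>] by (auto simp: add_eq_0_iff2)

lemma levi_subalgebra: "lie_subalgebra \<LL>"
  unfolding levi_def by (rule lie_subalgebra_generated)

lemma H_levi: "H \<subseteq> \<LL>"
  unfolding levi_def by (auto intro: lie_generated_base)

text \<open>A positive root that is not simple is a sum of two positive roots; both are in the span of \<open>\<Gamma>\<close> if their
  sum is, since the coefficients in simple roots are natural numbers. So induction applies.\<close>

lemma E_levi: "\<gamma> \<in> \<Lambda> \<Longrightarrow> E \<gamma> \<in> \<LL>"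
proof -
  have J: "clie.subspace \<LL>" "\<And>u v. u \<in> \<LL> \<Longrightarrow> v \<in> \<LL> \<Longrightarrow> lie u v \<in> \<LL>"
    using levi_subalgebra by (auto simp: lie_subalgebra_def)
  have sum: "E (\<beta> + \<gamma>) \<in> \<LL>" if "\<beta> \<in> \<Omega>" "\<gamma> \<in> \<Omega>" "\<beta> + \<gamma> \<in> \<Omega>" "E \<beta> \<in> \<LL>" "E \<gamma> \<in> \<LL>" for \<beta> \<gamma>
  proof -
    let ?N = "killing (lie (E \<beta>) (E \<gamma>)) (E (- (\<beta> + \<gamma>)))"
    have "(1 / ?N) *\<^sub>C lie (E \<beta>) (E \<gamma>) = E (\<beta> + \<gamma>)"
      using structure_constant_nonzero[OF that(1-3)]
      by (subst lie_E_E[OF that(1-3)]) (simp add: scaleC_scaleC scaleC_one)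
    then show ?thesis using J(2)[OF that(4,5)] clie.subspace_scale[OF J(1)] by metis
  qed
  have pos: "\<gamma> \<in> cfun.span \<Gamma> \<longrightarrow> E \<gamma> \<in> \<LL> \<and> E (- \<gamma>) \<in> \<LL>" if "\<gamma> \<in> P" for \<gamma>
    using that
  proof (induction rule: positive_induct)
    case (simple \<gamma>)
    have "\<gamma> \<in> \<Gamma>" if "\<gamma> \<in> cfun.span \<Gamma>"
    proof (rule ccontr)
      assume "\<gamma> \<notin> \<Gamma>"
      then have "coef \<gamma> \<gamma> = 0" by (rule coef_span_subset[OF simple_part that])
      then show False using cfun.representation_basis[OF simple_independent simple] by simp
    qed
    then have "\<gamma> \<in> cfun.span \<Gamma> \<Longrightarrow> E \<gamma> \<in> E ` \<Gamma> \<and> E (- \<gamma>) \<in> (\<lambda>\<alpha>. E (- \<alpha>)) ` \<Gamma>" by blast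
    then show ?case unfolding levi_def by (blast intro: lie_generated_base)
  next
    case (add \<beta> \<gamma>)
    show ?case
    proof
      assume s: "\<beta> + \<gamma> \<in> cfun.span \<Gamma>"
      have "\<beta> \<in> cfun.span \<Gamma>" by (rule span_summand[OF simple_part add.hyps(1,2) s])
      moreover have "\<gamma> \<in> cfun.span \<Gamma>"
        by (rule span_summand[OF simple_part add.hyps(2,1)]) (use s in \<open>simp add: add.commute\<close>)
      ultimately have IH: "E \<beta> \<in> \<LL>" "E (- \<beta>) \<in> \<LL>" "E \<gamma> \<in> \<LL>" "E (- \<gamma>) \<in> \<LL>"
        using add.IH by blast+
      have r: "\<beta> \<in> \<Omega>" "\<gamma> \<in> \<Omega>" "\<beta> + \<gamma> \<in> \<Omega>" using add.hyps P_subset by auto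
      have eq: "- (\<beta> + \<gamma>) = - \<beta> + - \<gamma>" by simp
      have "E (- (\<beta> + \<gamma>)) \<in> \<LL>"
        unfolding eq using r(3)[THEN root_minus, unfolded eq]
        by (intro sum IH root_minus r)
      then show "E (\<beta> + \<gamma>) \<in> \<LL> \<and> E (- (\<beta> + \<gamma>)) \<in> \<LL>" using sum[OF r IH(1,3)] by blast
    qed
  qed
  assume "\<gamma> \<in> \<Lambda>"
  then have \<gamma>: "\<gamma> \<in> \<Omega>" "\<gamma> \<in> cfun.span \<Gamma>" by (auto simp: levi_roots_def)
  show ?thesis
    using root_cases[OF \<gamma>(1)] pos[of \<gamma>] pos[of "- \<gamma>"] \<gamma>(2) cfun.span_neg[OF \<gamma>(2)] by auto
qed

text \<open>The Levi subalgebra is no larger than the sum of \<open>H\<close> and the root spaces of the Levi roots, because that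
  sum is a subalgebra; \<open>H_levi\<close> and \<open>E_levi\<close> give the other inclusion.\<close>

lemma levi_least:
  assumes S: "clie.subspace S" "H \<subseteq> S" "\<And>\<gamma>. \<gamma> \<in> \<Lambda> \<Longrightarrow> E \<gamma> \<in> S"
  shows "\<LL> \<subseteq> S"
proof -
  let ?B = "H \<union> E ` \<Lambda>"
  have gen: "lie x y \<in> clie.span ?B" if x: "x \<in> ?B" and y: "y \<in> ?B" for x y
  proof -
    have HE: "lie h (E \<gamma>) \<in> clie.span ?B" if "h \<in> H" "\<gamma> \<in> \<Lambda>" for h \<gamma>
    proof -
      have "E \<gamma> \<in> ?B" "\<gamma> \<in> \<Omega>" using that(2) by (auto simp: levi_roots_def)
      then show ?thesis by (simp only: lie_H_E[OF that(1)] clie.span_scale clie.span_base)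
    qed
    have EE: "lie (E \<gamma>) (E \<delta>) \<in> clie.span ?B" if g: "\<gamma> \<in> \<Lambda>" "\<delta> \<in> \<Lambda>" for \<gamma> \<delta>
    proof -
      have r: "\<gamma> \<in> \<Omega>" "\<delta> \<in> \<Omega>" using that by (auto simp: levi_roots_def)
      consider "\<delta> = - \<gamma>" | "\<gamma> + \<delta> \<in> \<Omega>" | "\<gamma> + \<delta> \<noteq> 0" "\<gamma> + \<delta> \<notin> \<Omega>"
        by (auto simp: add_eq_0_iff)
      then show ?thesis
      proof cases
        case 1
        then show ?thesis using tvec_H[OF r(1)] by (auto simp: tvec_def intro: clie.span_base)
      next
        case 2
        then have "E (\<gamma> + \<delta>) \<in> ?B" using levi_root_add[OF g] by blast
        then show ?thesis
          by (subst lie_E_E[OF r 2]) (intro clie.span_scale clie.span_base)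
      next
        case 3
        then show ?thesis using lie_E_E_zero[OF r] by (simp add: clie.span_zero)
      qed
    qed
    have EH: "lie (E \<gamma>) h \<in> clie.span ?B" if "h \<in> H" "\<gamma> \<in> \<Lambda>" for h \<gamma>
      using clie.span_neg[OF HE[OF that]] lie_swap[of "E \<gamma>" h] by simp
    show ?thesis
      using x y by (elim UnE imageE) (simp_all only: HE EE EH H_abelian clie.span_zero)
  qed
  have 1: "lie x y \<in> clie.span ?B" if x: "x \<in> clie.span ?B" and y: "y \<in> ?B" for x y
    using x
  proof (induction rule: clie.span_induct_alt)
    case base
    then show ?case by (simp add: clie.span_zero)
  next
    case (step c x z)
    then show ?case using gen[OF step(1) y]
      by (simp add: lie_add_left lie_scaleC_left clie.span_add clie.span_scale)
  qed
  have "lie x y \<in> clie.span ?B" if x: "x \<in> clie.span ?B" and y: "y \<in> clie.span ?B" for x y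
    using y
  proof (induction rule: clie.span_induct_alt)
    case base
    then show ?case by (simp add: clie.span_zero)
  next
    case (step c y z)
    then show ?case using 1[OF x step(1)]
      by (simp add: lie_add_right lie_scaleC_right clie.span_add clie.span_scale)
  qed
  then have "lie_subalgebra (clie.span ?B)" by (simp add: lie_subalgebra_def)
  moreover have "H \<union> E ` \<Gamma> \<union> (\<lambda>\<alpha>. E (- \<alpha>)) ` \<Gamma> \<subseteq> clie.span ?B"
  proof -
    have "\<Gamma> \<subseteq> \<Lambda>" using simple_part simple_subset by (auto simp: levi_roots_def cfun.span_base)
    then show ?thesis using levi_root_minus by (auto intro!: clie.span_base)
  qed
  ultimately have "\<LL> \<subseteq> clie.span ?B" unfolding levi_def by (rule lie_generated_least)
  moreover have "clie.span ?B \<subseteq> S" by (rule clie.span_minimal) (use S in auto)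
  ultimately show ?thesis by blast
qed

lemma projection_unique:
  assumes "v \<in> cfun.span (simple_roots P - \<Gamma>)" "v \<in> cfun.span \<Gamma>"
  shows "v = 0"
proof -
  have z: "coef v i = 0" for i
    using coef_span_subset[OF Diff_subset assms(1), of i] coef_span_subset[OF simple_part assms(2), of i]
    by blast
  have "v \<in> cfun.span (simple_roots P)" using assms(2) cfun.span_mono[OF simple_part] by blast
  then have "v \<in> cfun.span {}" by (rule span_by_coef) (rule z)
  then show ?thesis by (simp only: cfun.span_empty singleton_iff)
qed

lemma root_proj_eq:
  assumes "\<beta> \<in> cfun.span (simple_roots P - \<Gamma>)" "\<alpha> - \<beta> \<in> cfun.span \<Gamma>"
  shows "root_proj P \<Gamma> \<alpha> = \<beta>"
  unfolding root_proj_def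
proof (rule the_equality)
  fix \<beta>' assume \<beta>': "\<beta>' \<in> cfun.span (simple_roots P - \<Gamma>) \<and> \<alpha> - \<beta>' \<in> cfun.span \<Gamma>"
  have eq: "(\<alpha> - \<beta>) - (\<alpha> - \<beta>') = \<beta>' - \<beta>" by (simp add: fun_eq_iff)
  have "\<beta>' - \<beta> \<in> cfun.span \<Gamma>"
    using cfun.span_diff[OF assms(2) conjunct2[OF \<beta>']] unfolding eq .
  then have "\<beta>' - \<beta> = 0"
    by (rule projection_unique[OF cfun.span_diff[OF conjunct1[OF \<beta>'] assms(1)]])
  then show "\<beta>' = \<beta>" by (simp only: right_minus_eq)
qed (rule conjI[OF assms])

lemma root_proj_span:
  assumes "\<alpha> \<in> \<Omega>"
  shows "root_proj P \<Gamma> \<alpha> \<in> cfun.span (simple_roots P - \<Gamma>)"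
    "\<alpha> - root_proj P \<Gamma> \<alpha> \<in> cfun.span \<Gamma>"
proof -
  have "\<alpha> \<in> cfun.span ((simple_roots P - \<Gamma>) \<union> \<Gamma>)"
    using root_span[OF assms] simple_part by (metis Diff_partition Un_commute)
  then obtain \<beta> \<gamma> where d: "\<alpha> = \<beta> + \<gamma>" "\<beta> \<in> cfun.span (simple_roots P - \<Gamma>)" "\<gamma> \<in> cfun.span \<Gamma>"
    unfolding cfun.span_Un by blast
  then have "root_proj P \<Gamma> \<alpha> = \<beta>" by (intro root_proj_eq) auto
  then show "root_proj P \<Gamma> \<alpha> \<in> cfun.span (simple_roots P - \<Gamma>)"
    "\<alpha> - root_proj P \<Gamma> \<alpha> \<in> cfun.span \<Gamma>" using d by auto
qed

definition lam :: "('g \<Rightarrow> complex) \<Rightarrow> complex" where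
  "lam \<alpha> = l (root_proj P \<Gamma> \<alpha>)"

lemma l_linear: "linear_form_on (cfun.span (simple_roots P - \<Gamma>)) l"
  using form by (simp add: orbit_form_def)

lemma lam_add:
  assumes "\<alpha> \<in> \<Omega>" "\<beta> \<in> \<Omega>"
  shows "lam (\<alpha> + \<beta>) = lam \<alpha> + lam \<beta>"
proof -
  have "root_proj P \<Gamma> (\<alpha> + \<beta>) = root_proj P \<Gamma> \<alpha> + root_proj P \<Gamma> \<beta>"
  proof (rule root_proj_eq)
    have "\<alpha> + \<beta> - (root_proj P \<Gamma> \<alpha> + root_proj P \<Gamma> \<beta>) =
        (\<alpha> - root_proj P \<Gamma> \<alpha>) + (\<beta> - root_proj P \<Gamma> \<beta>)" by simp
    also have "\<dots> \<in> cfun.span \<Gamma>" by (intro cfun.span_add root_proj_span assms)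
    finally show "\<alpha> + \<beta> - (root_proj P \<Gamma> \<alpha> + root_proj P \<Gamma> \<beta>) \<in> cfun.span \<Gamma>" .
  qed (intro cfun.span_add root_proj_span assms)
  then show ?thesis using l_linear root_proj_span(1) assms by (simp add: lam_def linear_form_on_def)
qed

lemma l_zero: "l 0 = 0"
proof -
  have "l (fscale 0 0) = 0 * l 0"
    using l_linear cfun.span_zero unfolding linear_form_on_def by blast
  then show ?thesis by simp
qed

lemma lam_levi: "\<gamma> \<in> \<Lambda> \<Longrightarrow> lam \<gamma> = 0"
  using root_proj_eq[of 0 \<gamma>] by (simp add: lam_def levi_roots_def l_zero cfun.span_zero)

lemma lam_minus: "\<alpha> \<in> \<Omega> \<Longrightarrow> lam (- \<alpha>) = - lam \<alpha>"
proof -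
  assume \<alpha>: "\<alpha> \<in> \<Omega>"
  have "root_proj P \<Gamma> 0 = 0" by (rule root_proj_eq) (simp_all add: cfun.span_zero)
  then have "lam (\<alpha> + - \<alpha>) = 0" by (simp add: lam_def l_zero)
  then show ?thesis using lam_add[OF \<alpha> root_minus[OF \<alpha>]] by (simp add: eq_neg_iff_add_eq_0 add.commute)
qed

lemma lam_nonzero:
  assumes "\<alpha> \<in> \<Theta>"
  shows "lam \<alpha> \<noteq> 0"
proof -
  have "root_proj P \<Gamma> \<alpha> \<noteq> 0"
    using root_proj_span(2)[of \<alpha>] assms by (auto simp: levi_roots_def)
  then have "root_proj P \<Gamma> \<alpha> \<in> quasiroots H P \<Gamma>" using assms by (auto simp: quasiroots_def)
  then show ?thesis using form by (simp add: lam_def orbit_form_def)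
qed

end

section \<open>The coefficient equations\<close>

context orbit_algebra
begin

text \<open>The last condition says that the value at \<open>\<alpha> + \<beta>\<close> is the mean of the values at \<open>\<alpha>\<close> and \<open>\<beta>\<close> with weights
  given by \<open>\<lambda>\<close>. So if two of the three values agree, all three do.\<close>

definition averaging :: "(('g \<Rightarrow> complex) \<Rightarrow> complex) \<Rightarrow> bool" where
  "averaging D \<longleftrightarrow> (\<forall>\<alpha>\<in>\<Theta>. D (- \<alpha>) = D \<alpha>)
     \<and> (\<forall>\<alpha>\<in>\<Theta>. \<forall>\<gamma>\<in>\<Lambda>. \<alpha> + \<gamma> \<in> \<Omega> \<longrightarrow> D (\<alpha> + \<gamma>) = D \<alpha>)
     \<and> (\<forall>\<alpha>\<in>\<Theta>. \<forall>\<beta>\<in>\<Theta>. \<alpha> + \<beta> \<in> \<Theta> \<longrightarrow>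
          D (\<alpha> + \<beta>) * lam (\<alpha> + \<beta>) = D \<alpha> * lam \<alpha> + D \<beta> * lam \<beta>)"

lemma averaging_minus: "averaging D \<Longrightarrow> \<alpha> \<in> \<Theta> \<Longrightarrow> D (- \<alpha>) = D \<alpha>"
  unfolding averaging_def by blast

lemma averaging_levi: "averaging D \<Longrightarrow> \<alpha> \<in> \<Theta> \<Longrightarrow> \<gamma> \<in> \<Lambda> \<Longrightarrow> \<alpha> + \<gamma> \<in> \<Omega> \<Longrightarrow> D (\<alpha> + \<gamma>) = D \<alpha>"
  unfolding averaging_def by blast

lemma averaging_eq_iff:
  assumes D: "averaging D" and "\<alpha> \<in> \<Theta>" "\<beta> \<in> \<Theta>" "\<alpha> + \<beta> \<in> \<Theta>"
  shows "D (\<alpha> + \<beta>) = D \<beta> \<longleftrightarrow> D \<alpha> = D \<beta>"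
proof -
  have "D (\<alpha> + \<beta>) * lam (\<alpha> + \<beta>) = D \<alpha> * lam \<alpha> + D \<beta> * lam \<beta>"
    using assms unfolding averaging_def by blast
  moreover have lam: "lam (\<alpha> + \<beta>) = lam \<alpha> + lam \<beta>" using lam_add assms by blast
  ultimately have "(D (\<alpha> + \<beta>) - D \<beta>) * lam (\<alpha> + \<beta>) = (D \<alpha> - D \<beta>) * lam \<alpha>"
    by (simp add: algebra_simps)
  then show ?thesis using lam_nonzero[OF assms(2)] lam_nonzero[OF assms(4)] by auto
qed

lemma averaging_levi_sum:
  assumes D: "averaging D" and "\<alpha> \<in> \<Theta>" "\<beta> \<in> \<Theta>" "\<alpha> + \<beta> \<in> insert 0 \<Lambda>"
  shows "D \<alpha> = D \<beta>"
proof (cases "\<alpha> + \<beta> = 0")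
  case True
  then have "\<beta> = - \<alpha>" by (simp add: eq_neg_iff_add_eq_0 add.commute)
  then show ?thesis using averaging_minus[OF D assms(2)] by simp
next
  case False
  have "D (- \<alpha> + (\<alpha> + \<beta>)) = D (- \<alpha>)"
    by (rule averaging_levi[OF D compl_minus[OF assms(2)]]) (use assms False in auto)
  then show ?thesis using averaging_minus[OF D assms(2)] by simp
qed

text \<open>The roots where \<open>D\<close> takes a given value satisfy the hypotheses of \<open>roots_exhausted\<close>.\<close>

lemma averaging_constant:
  assumes D: "averaging D"
    and adj: "\<And>\<alpha> \<beta>. \<alpha> \<in> \<Theta> \<Longrightarrow> \<beta> \<in> \<Theta> \<Longrightarrow> \<alpha> + \<beta> \<in> \<Theta> \<Longrightarrow> D \<alpha> = D \<beta>"
  shows "\<exists>s. \<forall>\<alpha>\<in>\<Theta>. D \<alpha> = s"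
proof (cases "\<Theta> = {}")
  case False
  then obtain \<alpha>0 where \<alpha>0: "\<alpha>0 \<in> \<Theta>" by blast
  define X where "X = {\<alpha> \<in> \<Theta>. D \<alpha> = D \<alpha>0}"
  have "\<Omega> \<subseteq> X \<union> \<Lambda>"
  proof (rule roots_exhausted)
    show "X \<subseteq> \<Omega>" "X \<noteq> {}" using \<alpha>0 by (auto simp: X_def)
    show "- \<alpha> \<in> X" if "\<alpha> \<in> X" for \<alpha>
    proof -
      have "\<alpha> \<in> \<Theta>" "D \<alpha> = D \<alpha>0" using that by (simp_all add: X_def)
      then show ?thesis unfolding X_def using compl_minus averaging_minus[OF D] by auto
    qed
    fix \<alpha> \<beta> assume \<alpha>: "\<alpha> \<in> X" and \<beta>: "\<beta> \<in> \<Omega>" and s: "\<alpha> + \<beta> \<in> \<Omega>"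
    have \<alpha>': "\<alpha> \<in> \<Theta>" "D \<alpha> = D \<alpha>0" using \<alpha> by (auto simp: X_def)
    show "\<beta> \<in> X \<or> \<beta> \<in> \<Lambda> \<and> \<alpha> + \<beta> \<in> X"
    proof (cases "\<beta> \<in> \<Lambda>")
      case True
      then show ?thesis
        using compl_add_levi[OF \<alpha>'(1) True s] averaging_levi[OF D \<alpha>'(1) True s] \<alpha>' by (simp add: X_def)
    next
      case False
      then have \<beta>': "\<beta> \<in> \<Theta>" using \<beta> by blast
      have "D \<alpha> = D \<beta>"
        using adj[OF \<alpha>'(1) \<beta>'] averaging_levi_sum[OF D \<alpha>'(1) \<beta>'] s by blast
      then show ?thesis using \<beta>' \<alpha>' by (simp add: X_def)
    qed
  qed
  then have "\<forall>\<alpha>\<in>\<Theta>. D \<alpha> = D \<alpha>0" by (auto simp: X_def)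
  then show ?thesis by blast
qed auto

text \<open>A sum in \<open>\<Theta>\<close> would contradict the dichotomy, and a sum that is a Levi root or zero would make both
  functions agree at \<open>\<alpha>\<close> and \<open>\<beta>\<close>.\<close>

lemma separated_roots:
  assumes D: "averaging D" and D': "averaging D'"
    and dich: "\<And>\<alpha> \<beta>. \<alpha> \<in> \<Theta> \<Longrightarrow> \<beta> \<in> \<Theta> \<Longrightarrow> \<alpha> + \<beta> \<in> \<Theta> \<Longrightarrow> D \<alpha> = D \<beta> \<longleftrightarrow> D' \<alpha> \<noteq> D' \<beta>"
    and \<alpha>: "\<alpha> \<in> \<Theta>" and \<beta>: "\<beta> \<in> \<Theta>" and ne: "D \<alpha> \<noteq> D \<beta>" "D' \<alpha> \<noteq> D' \<beta>"
  shows "\<alpha> + \<beta> \<notin> insert 0 \<Omega>"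
  using dich[OF \<alpha> \<beta>] averaging_levi_sum[OF D \<alpha> \<beta>] ne by blast

text \<open>The pair \<open>\<alpha>, \<beta>\<close> is of the first kind. If \<open>\<beta>, \<gamma>\<close> were of the second, then both functions would
  separate \<open>\<gamma>\<close> from \<open>-\<alpha>\<close> and from \<open>\<alpha> + \<beta>\<close>, so that neither \<open>\<gamma> - \<alpha>\<close> nor \<open>\<alpha> + \<beta> + \<gamma>\<close> could be a root, against
  \<open>root_commute\<close>.\<close>

lemma no_mixed_root:
  assumes D: "averaging D" and D': "averaging D'"
    and dich: "\<And>\<alpha> \<beta>. \<alpha> \<in> \<Theta> \<Longrightarrow> \<beta> \<in> \<Theta> \<Longrightarrow> \<alpha> + \<beta> \<in> \<Theta> \<Longrightarrow> D \<alpha> = D \<beta> \<longleftrightarrow> D' \<alpha> \<noteq> D' \<beta>"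
    and \<alpha>: "\<alpha> \<in> \<Theta>" and \<beta>: "\<beta> \<in> \<Theta>" and \<gamma>: "\<gamma> \<in> \<Theta>"
    and \<alpha>\<beta>: "\<alpha> + \<beta> \<in> \<Theta>" and \<beta>\<gamma>: "\<beta> + \<gamma> \<in> \<Theta>" and eq: "D \<alpha> = D \<beta>"
  shows "D' \<beta> \<noteq> D' \<gamma>"
proof
  assume eq': "D' \<beta> = D' \<gamma>"
  have ne: "D' \<alpha> \<noteq> D' \<beta>" "D \<beta> \<noteq> D \<gamma>"
    using dich[OF \<alpha> \<beta> \<alpha>\<beta>] dich[OF \<beta> \<gamma> \<beta>\<gamma>] eq eq' by auto
  have "- \<alpha> + \<gamma> \<notin> insert 0 \<Omega>"
    by (rule separated_roots[OF D D' dich compl_minus[OF \<alpha>] \<gamma>])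
      (use ne eq eq' averaging_minus[OF D \<alpha>] averaging_minus[OF D' \<alpha>] in auto)
  moreover have "\<alpha> + \<beta> + \<gamma> \<notin> insert 0 \<Omega>"
    by (rule separated_roots[OF D D' dich \<alpha>\<beta> \<gamma>])
      (use ne eq eq' averaging_eq_iff[OF D \<alpha> \<beta> \<alpha>\<beta>] averaging_eq_iff[OF D' \<alpha> \<beta> \<alpha>\<beta>] in auto)
  moreover have "- \<alpha> + \<gamma> = \<gamma> - \<alpha>" by simp
  ultimately show False
    using root_commute[of \<alpha> \<beta> \<gamma>] \<alpha> \<beta> \<gamma> \<alpha>\<beta> \<beta>\<gamma> by auto
qed

text \<open>If some pair is of the second kind, the roots that occur in such pairs satisfy the hypotheses of
  \<open>roots_exhausted\<close>, so every root outside the Levi roots occurs in one; by \<open>no_mixed_root\<close> all pairs are then of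
  the second kind.\<close>

lemma averaging_dichotomy:
  assumes D: "averaging D" and D': "averaging D'"
    and dich: "\<And>\<alpha> \<beta>. \<alpha> \<in> \<Theta> \<Longrightarrow> \<beta> \<in> \<Theta> \<Longrightarrow> \<alpha> + \<beta> \<in> \<Theta> \<Longrightarrow> D \<alpha> = D \<beta> \<longleftrightarrow> D' \<alpha> \<noteq> D' \<beta>"
  shows "(\<exists>s. \<forall>\<alpha>\<in>\<Theta>. D \<alpha> = s) \<or> (\<exists>s. \<forall>\<alpha>\<in>\<Theta>. D' \<alpha> = s)"
proof -
  define X where "X = {\<alpha> \<in> \<Theta>. \<exists>\<beta>\<in>\<Theta>. \<alpha> + \<beta> \<in> \<Theta> \<and> D' \<alpha> = D' \<beta>}"
  show ?thesis
  proof (cases "X = {}")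
    case True
    have "\<exists>s. \<forall>\<alpha>\<in>\<Theta>. D \<alpha> = s"
    proof (rule averaging_constant[OF D])
      fix \<alpha> \<beta> assume a: "\<alpha> \<in> \<Theta>" "\<beta> \<in> \<Theta>" "\<alpha> + \<beta> \<in> \<Theta>"
      then have "D' \<alpha> \<noteq> D' \<beta>" using True unfolding X_def by blast
      then show "D \<alpha> = D \<beta>" using dich[OF a] by blast
    qed
    then show ?thesis ..
  next
    case False
    have minusX: "- \<alpha> \<in> X" if \<alpha>X: "\<alpha> \<in> X" for \<alpha>
    proof -
      obtain \<beta> where \<beta>: "\<alpha> \<in> \<Theta>" "\<beta> \<in> \<Theta>" "\<alpha> + \<beta> \<in> \<Theta>" "D' \<alpha> = D' \<beta>"
        using \<alpha>X unfolding X_def by blast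
      have "- \<alpha> + - \<beta> = - (\<alpha> + \<beta>)" by simp
      then have "- \<alpha> + - \<beta> \<in> \<Theta>" using compl_minus[OF \<beta>(3)] by metis
      moreover have "D' (- \<alpha>) = D' (- \<beta>)"
        using averaging_minus[OF D' \<beta>(1)] averaging_minus[OF D' \<beta>(2)] \<beta>(4) by metis
      ultimately show ?thesis using compl_minus \<beta>(1,2) unfolding X_def by blast
    qed
    have XI: "\<alpha> \<in> X" if "\<alpha> \<in> \<Theta>" "\<beta> \<in> \<Theta>" "\<alpha> + \<beta> \<in> \<Theta>" "D' \<alpha> = D' \<beta>" for \<alpha> \<beta>
      using that unfolding X_def by blast
    have leviX: "\<alpha> + \<delta> \<in> X" if \<alpha>X: "\<alpha> \<in> X" and \<delta>: "\<delta> \<in> \<Lambda>" and s: "\<alpha> + \<delta> \<in> \<Omega>" for \<alpha> \<delta>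
    proof -
      obtain \<beta> where \<beta>: "\<alpha> \<in> \<Theta>" "\<beta> \<in> \<Theta>" "\<alpha> + \<beta> \<in> \<Theta>" "D' \<alpha> = D' \<beta>"
        using \<alpha>X unfolding X_def by blast
      have \<alpha>\<delta>: "\<alpha> + \<delta> \<in> \<Theta>" "D' (\<alpha> + \<delta>) = D' \<alpha>"
        using compl_add_levi[OF \<beta>(1) \<delta> s] averaging_levi[OF D' \<beta>(1) \<delta> s] by auto
      have \<delta>': "- \<delta> \<in> \<Lambda>" "\<delta> \<in> \<Omega>" using levi_root_minus[OF \<delta>] \<delta> by (auto simp: levi_roots_def)
      have nz: "\<delta> - \<beta> \<noteq> 0" using \<beta>(2) \<delta> by auto
      have nz': "\<beta> + \<alpha> + \<delta> \<noteq> 0"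
        using compl_add_levi_nonzero[OF \<beta>(3) \<delta>] unfolding add.commute[of \<beta> \<alpha>] .
      have "\<beta> + \<alpha> \<in> \<Omega>" using \<beta>(3) by (simp add: add.commute)
      then have "\<delta> - \<beta> \<in> insert 0 \<Omega> \<or> \<beta> + \<alpha> + \<delta> \<in> insert 0 \<Omega>"
        using root_commute[of \<beta> \<alpha> \<delta>] \<beta> \<delta>' s by blast
      \<comment> \<open>A partner of \<open>\<alpha> + \<delta>\<close> is \<open>\<beta> - \<delta>\<close> or \<open>\<beta>\<close>.\<close>
      then consider "\<delta> - \<beta> \<in> \<Omega>" | "\<beta> + \<alpha> + \<delta> \<in> \<Omega>" using nz nz' by blast
      then show ?thesis
      proof cases
        case 1
        have "- (\<delta> - \<beta>) = \<beta> + - \<delta>" by simp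
        then have r: "\<beta> + - \<delta> \<in> \<Omega>" using root_minus[OF 1] by metis
        have eq: "(\<alpha> + \<delta>) + (\<beta> + - \<delta>) = \<alpha> + \<beta>" by simp
        show ?thesis
        proof (rule XI[OF \<alpha>\<delta>(1) compl_add_levi[OF \<beta>(2) \<delta>'(1) r]])
          show "(\<alpha> + \<delta>) + (\<beta> + - \<delta>) \<in> \<Theta>" unfolding eq by (rule \<beta>(3))
          show "D' (\<alpha> + \<delta>) = D' (\<beta> + - \<delta>)"
            unfolding \<alpha>\<delta>(2) averaging_levi[OF D' \<beta>(2) \<delta>'(1) r] by (rule \<beta>(4))
        qed
      next
        case 2
        have eq: "(\<alpha> + \<delta>) + \<beta> = \<beta> + \<alpha> + \<delta>" "\<alpha> + \<beta> + \<delta> = \<beta> + \<alpha> + \<delta>" by (simp_all add: add_ac)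
        show ?thesis
        proof (rule XI[OF \<alpha>\<delta>(1) \<beta>(2)])
          show "(\<alpha> + \<delta>) + \<beta> \<in> \<Theta>"
            using compl_add_levi[OF \<beta>(3) \<delta>] 2 unfolding eq by blast
          show "D' (\<alpha> + \<delta>) = D' \<beta>" unfolding \<alpha>\<delta>(2) by (rule \<beta>(4))
        qed
      qed
    qed
    have "\<Omega> \<subseteq> X \<union> \<Lambda>"
    proof (rule roots_exhausted[OF _ False minusX])
      show "X \<subseteq> \<Omega>" by (auto simp: X_def)
      fix \<alpha> \<delta> assume \<alpha>X: "\<alpha> \<in> X" and \<delta>: "\<delta> \<in> \<Omega>" and s: "\<alpha> + \<delta> \<in> \<Omega>"
      obtain \<beta> where \<beta>: "\<alpha> \<in> \<Theta>" "\<beta> \<in> \<Theta>" "\<alpha> + \<beta> \<in> \<Theta>" "D' \<alpha> = D' \<beta>"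
        using \<alpha>X unfolding X_def by blast
      consider "\<delta> \<in> \<Lambda>" | "\<delta> \<in> \<Theta>" "\<alpha> + \<delta> \<in> \<Theta>" | "\<delta> \<in> \<Theta>" "\<alpha> + \<delta> \<in> \<Lambda>" using \<delta> s by blast
      then show "\<delta> \<in> X \<or> \<delta> \<in> \<Lambda> \<and> \<alpha> + \<delta> \<in> X"
      proof cases
        case 1
        then show ?thesis using leviX[OF \<alpha>X 1 s] by blast
      next
        case 2
        have s': "\<delta> + \<alpha> \<in> \<Theta>" using 2(2) by (simp add: add.commute)
        have "D \<delta> \<noteq> D \<alpha>"
          using no_mixed_root[OF D D' dich 2(1) \<beta>(1,2) s' \<beta>(3)] \<beta>(4) by blast
        then have "D' \<delta> = D' \<alpha>" using dich[OF 2(1) \<beta>(1) s'] by blast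
        then show ?thesis using XI[OF 2(1) \<beta>(1) s'] by blast
      next
        case 3
        have eq: "- \<alpha> + (\<alpha> + \<delta>) = \<delta>" by simp
        have "\<delta> \<in> X" using leviX[OF minusX[OF \<alpha>X] 3(2)] \<delta> unfolding eq .
        then show ?thesis ..
      qed
    qed
    then have all: "\<alpha> \<in> X" if "\<alpha> \<in> \<Theta>" for \<alpha> using that by blast
    have "\<exists>s. \<forall>\<alpha>\<in>\<Theta>. D' \<alpha> = s"
    proof (rule averaging_constant[OF D'])
      fix \<alpha> \<beta> assume a: "\<alpha> \<in> \<Theta>" "\<beta> \<in> \<Theta>" "\<alpha> + \<beta> \<in> \<Theta>"
      obtain \<gamma> where \<gamma>: "\<gamma> \<in> \<Theta>" "\<beta> + \<gamma> \<in> \<Theta>" "D' \<beta> = D' \<gamma>" using all[OF a(2)] unfolding X_def by blast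
      have "D \<alpha> \<noteq> D \<beta>" using no_mixed_root[OF D D' dich a(1,2) \<gamma>(1) a(3) \<gamma>(2)] \<gamma>(3) by blast
      then show "D' \<alpha> = D' \<beta>" using dich[OF a] by blast
    qed
    then show ?thesis ..
  qed
qed

definition admissible :: "(('g \<Rightarrow> complex) \<Rightarrow> complex) \<Rightarrow> bool" where
  "admissible c \<longleftrightarrow> (\<forall>\<alpha>\<in>\<Omega>. c (- \<alpha>) = - c \<alpha>) \<and> (\<forall>\<alpha>\<in>\<Lambda>. c \<alpha> = 0)
     \<and> (\<forall>\<alpha>\<in>\<Theta>. \<forall>\<gamma>\<in>\<Lambda>. \<alpha> + \<gamma> \<in> \<Omega> \<longrightarrow> c (\<alpha> + \<gamma>) = c \<alpha>)"

definition kks_coef :: "('g \<Rightarrow> complex) \<Rightarrow> complex" where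
  "kks_coef \<alpha> = (if \<alpha> \<in> \<Theta> then 1 / lam \<alpha> else 0)"

text \<open>For odd \<open>c\<close> and \<open>d\<close> this is the sum of \<open>c\<^sub>i d\<^sub>j\<close> over \<open>i \<noteq> j\<close>, where \<open>i\<close> and \<open>j\<close> range over the roots
  \<open>\<alpha>\<close>, \<open>\<beta>\<close> and \<open>-(\<alpha> + \<beta>)\<close>.\<close>

definition triple_sum ::
    "(('g \<Rightarrow> complex) \<Rightarrow> complex) \<Rightarrow> (('g \<Rightarrow> complex) \<Rightarrow> complex) \<Rightarrow> ('g \<Rightarrow> complex) \<Rightarrow> ('g \<Rightarrow> complex) \<Rightarrow> complex"
  where "triple_sum c d \<alpha> \<beta> =
    c \<alpha> * d \<beta> + c \<beta> * d \<alpha> - c (\<alpha> + \<beta>) * (d \<alpha> + d \<beta>) - d (\<alpha> + \<beta>) * (c \<alpha> + c \<beta>)"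

lemma lam_add_levi: "\<alpha> \<in> \<Theta> \<Longrightarrow> \<gamma> \<in> \<Lambda> \<Longrightarrow> lam (\<alpha> + \<gamma>) = lam \<alpha>"
  using lam_add[of \<alpha> \<gamma>] lam_levi[of \<gamma>] by (simp add: levi_roots_def)

lemma kks_admissible: "admissible kks_coef"
  unfolding admissible_def
proof (intro conjI ballI impI)
  fix \<alpha> assume \<alpha>: "\<alpha> \<in> \<Omega>"
  have "- \<alpha> \<in> \<Theta> \<longleftrightarrow> \<alpha> \<in> \<Theta>"
    using compl_minus[of \<alpha>] compl_minus[of "- \<alpha>"] by (simp only: minus_minus) blast
  then show "kks_coef (- \<alpha>) = - kks_coef \<alpha>"
    unfolding kks_coef_def by (cases "\<alpha> \<in> \<Theta>") (simp_all only: if_True if_False lam_minus[OF \<alpha>] divide_minus_right minus_zero)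
next
  fix \<alpha> \<gamma> assume a: "\<alpha> \<in> \<Theta>" "\<gamma> \<in> \<Lambda>" "\<alpha> + \<gamma> \<in> \<Omega>"
  then show "kks_coef (\<alpha> + \<gamma>) = kks_coef \<alpha>"
    using compl_add_levi[OF a] lam_add_levi[OF a(1,2)] by (simp only: kks_coef_def if_True)
qed (simp add: kks_coef_def)

text \<open>Multiply by \<open>\<lambda>(\<alpha>) \<lambda>(\<beta>) \<lambda>(\<alpha> + \<beta>)\<close>.\<close>

lemma kks_triple_sum:
  assumes "\<alpha> \<in> \<Theta>" "\<beta> \<in> \<Theta>" "\<alpha> + \<beta> \<in> \<Theta>"
  shows "triple_sum c kks_coef \<alpha> \<beta> = 0 \<longleftrightarrow>
    c (\<alpha> + \<beta>) * (lam (\<alpha> + \<beta>))\<^sup>2 = c \<alpha> * (lam \<alpha>)\<^sup>2 + c \<beta> * (lam \<beta>)\<^sup>2"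
proof -
  have alg: "(x * (1 / b) + y * (1 / a) - z * (1 / a + 1 / b) - 1 / (a + b) * (x + y)) * (a * b * (a + b)) =
      x * a\<^sup>2 + y * b\<^sup>2 - z * (a + b)\<^sup>2" if "a \<noteq> 0" "b \<noteq> 0" "a + b \<noteq> 0" for a b x y z :: complex
  proof -
    have "1 / (a + b) * (x + y) * (a * b * (a + b)) = (x + y) * (a * b)" using that(3) by simp
    moreover have "(x * (1 / b) + y * (1 / a) - z * (1 / a + 1 / b)) * (a * b * (a + b)) =
        (x * a + y * b - z * (a + b)) * (a + b)"
      using that(1,2) by (simp add: field_simps)
    ultimately show ?thesis
      by (simp only: left_diff_distrib) (simp add: algebra_simps power2_eq_square)
  qed
  have lam: "lam (\<alpha> + \<beta>) = lam \<alpha> + lam \<beta>" using lam_add assms by blast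
  have nz: "lam \<alpha> \<noteq> 0" "lam \<beta> \<noteq> 0" "lam \<alpha> + lam \<beta> \<noteq> 0"
    using assms[THEN lam_nonzero] lam by auto
  have "triple_sum c kks_coef \<alpha> \<beta> * (lam \<alpha> * lam \<beta> * (lam \<alpha> + lam \<beta>)) =
      c \<alpha> * (lam \<alpha>)\<^sup>2 + c \<beta> * (lam \<beta>)\<^sup>2 - c (\<alpha> + \<beta>) * (lam \<alpha> + lam \<beta>)\<^sup>2"
    using alg[OF nz] assms by (simp only: triple_sum_def kks_coef_def if_True lam)
  then have "triple_sum c kks_coef \<alpha> \<beta> = 0 \<longleftrightarrow>
      c \<alpha> * (lam \<alpha>)\<^sup>2 + c \<beta> * (lam \<beta>)\<^sup>2 - c (\<alpha> + \<beta>) * (lam \<alpha> + lam \<beta>)\<^sup>2 = 0"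
    using nz by (metis mult_eq_0_iff)
  then show ?thesis unfolding lam by auto
qed

lemma kks_kks: "\<alpha> \<in> \<Theta> \<Longrightarrow> \<beta> \<in> \<Theta> \<Longrightarrow> \<alpha> + \<beta> \<in> \<Theta> \<Longrightarrow> triple_sum kks_coef kks_coef \<alpha> \<beta> = 0"
  using lam_nonzero lam_add by (subst kks_triple_sum) (auto simp: kks_coef_def power2_eq_square)

definition solution :: "complex \<Rightarrow> (('g \<Rightarrow> complex) \<Rightarrow> complex) \<Rightarrow> bool" where
  "solution K c \<longleftrightarrow> admissible c \<and> (\<forall>\<alpha>\<in>\<Theta>. \<forall>\<beta>\<in>\<Theta>. \<alpha> + \<beta> \<in> \<Theta> \<longrightarrow>
     triple_sum c c \<alpha> \<beta> = - 2 * K\<^sup>2 \<and> triple_sum c kks_coef \<alpha> \<beta> = 0)"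

lemma solution_averaging:
  assumes c: "solution K c" and d: "solution K d"
  shows "averaging (\<lambda>\<alpha>. (c \<alpha> - d \<alpha>) * lam \<alpha>)" "averaging (\<lambda>\<alpha>. (c \<alpha> + d \<alpha>) * lam \<alpha>)"
proof -
  have "averaging (\<lambda>\<alpha>. (c \<alpha> + e * d \<alpha>) * lam \<alpha>)" for e
    unfolding averaging_def
  proof (intro conjI ballI impI)
    fix \<alpha> assume "\<alpha> \<in> \<Theta>"
    then show "(c (- \<alpha>) + e * d (- \<alpha>)) * lam (- \<alpha>) = (c \<alpha> + e * d \<alpha>) * lam \<alpha>"
      using c d lam_minus by (simp add: solution_def admissible_def algebra_simps)
  next
    fix \<alpha> \<gamma> assume a: "\<alpha> \<in> \<Theta>" "\<gamma> \<in> \<Lambda>" "\<alpha> + \<gamma> \<in> \<Omega>"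
    then have "lam (\<alpha> + \<gamma>) = lam \<alpha>" by (intro lam_add_levi)
    then show "(c (\<alpha> + \<gamma>) + e * d (\<alpha> + \<gamma>)) * lam (\<alpha> + \<gamma>) = (c \<alpha> + e * d \<alpha>) * lam \<alpha>"
      using c d a by (simp add: solution_def admissible_def)
  next
    fix \<alpha> \<beta> assume a: "\<alpha> \<in> \<Theta>" "\<beta> \<in> \<Theta>" "\<alpha> + \<beta> \<in> \<Theta>"
    have "c (\<alpha> + \<beta>) * (lam (\<alpha> + \<beta>))\<^sup>2 = c \<alpha> * (lam \<alpha>)\<^sup>2 + c \<beta> * (lam \<beta>)\<^sup>2"
      "d (\<alpha> + \<beta>) * (lam (\<alpha> + \<beta>))\<^sup>2 = d \<alpha> * (lam \<alpha>)\<^sup>2 + d \<beta> * (lam \<beta>)\<^sup>2"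
      using c d a kks_triple_sum[OF a] unfolding solution_def by blast+
    then show "(c (\<alpha> + \<beta>) + e * d (\<alpha> + \<beta>)) * lam (\<alpha> + \<beta>) * lam (\<alpha> + \<beta>) =
        (c \<alpha> + e * d \<alpha>) * lam \<alpha> * lam \<alpha> + (c \<beta> + e * d \<beta>) * lam \<beta> * lam \<beta>"
      by (simp add: power2_eq_square distrib_right mult.assoc) (simp add: algebra_simps)
  qed
  from this[of "- 1"] this[of 1]
  show "averaging (\<lambda>\<alpha>. (c \<alpha> - d \<alpha>) * lam \<alpha>)" "averaging (\<lambda>\<alpha>. (c \<alpha> + d \<alpha>) * lam \<alpha>)" by simp_all
qed

text \<open>Multiply the quadratic equation by \<open>\<lambda>(\<alpha> + \<beta>)\<^sup>2\<close> and eliminate \<open>c (\<alpha> + \<beta>)\<close> by additivity of \<open>c \<lambda>\<^sup>2\<close>.\<close>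

lemma solution_square:
  assumes c: "solution K c" and a: "\<alpha> \<in> \<Theta>" "\<beta> \<in> \<Theta>" "\<alpha> + \<beta> \<in> \<Theta>"
  shows "(c \<alpha> * lam \<alpha> - c \<beta> * lam \<beta>)\<^sup>2 = K\<^sup>2 * (lam \<alpha> + lam \<beta>)\<^sup>2"
proof -
  have lam: "lam (\<alpha> + \<beta>) = lam \<alpha> + lam \<beta>" using lam_add a by blast
  have 1: "c (\<alpha> + \<beta>) * (lam \<alpha> + lam \<beta>)\<^sup>2 = c \<alpha> * (lam \<alpha>)\<^sup>2 + c \<beta> * (lam \<beta>)\<^sup>2"
    using c a kks_triple_sum[OF a] unfolding solution_def lam by blast
  have "triple_sum c c \<alpha> \<beta> = - 2 * K\<^sup>2" using c a unfolding solution_def by blast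
  then have "2 * (c \<alpha> * c \<beta> - c (\<alpha> + \<beta>) * (c \<alpha> + c \<beta>)) = 2 * (- (K\<^sup>2))"
    by (simp add: triple_sum_def algebra_simps)
  then have 2: "c \<alpha> * c \<beta> - c (\<alpha> + \<beta>) * (c \<alpha> + c \<beta>) = - (K\<^sup>2)" by (simp only: mult_cancel_left) simp
  have "- (K\<^sup>2) * (lam \<alpha> + lam \<beta>)\<^sup>2 =
      c \<alpha> * c \<beta> * (lam \<alpha> + lam \<beta>)\<^sup>2 - c (\<alpha> + \<beta>) * (lam \<alpha> + lam \<beta>)\<^sup>2 * (c \<alpha> + c \<beta>)"
    unfolding 2[symmetric] by (simp add: algebra_simps)
  also have "\<dots> = - (c \<alpha> * lam \<alpha> - c \<beta> * lam \<beta>)\<^sup>2"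
    unfolding 1 by (simp add: power2_eq_square algebra_simps)
  finally show ?thesis by simp
qed

lemma solution_unique:
  assumes K: "K \<noteq> 0" and c: "solution K c" and d: "solution K d"
  shows "\<exists>s. (\<forall>\<alpha>\<in>\<Omega>. c \<alpha> = d \<alpha> + s * kks_coef \<alpha>) \<or> (\<forall>\<alpha>\<in>\<Omega>. c \<alpha> = - d \<alpha> + s * kks_coef \<alpha>)"
proof -
  let ?D = "\<lambda>\<alpha>. (c \<alpha> - d \<alpha>) * lam \<alpha>" and ?D' = "\<lambda>\<alpha>. (c \<alpha> + d \<alpha>) * lam \<alpha>"
  have "?D \<alpha> = ?D \<beta> \<longleftrightarrow> ?D' \<alpha> \<noteq> ?D' \<beta>" if a: "\<alpha> \<in> \<Theta>" "\<beta> \<in> \<Theta>" "\<alpha> + \<beta> \<in> \<Theta>" for \<alpha> \<beta>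
  proof -
    define x where "x = c \<alpha> * lam \<alpha> - c \<beta> * lam \<beta>"
    define y where "y = d \<alpha> * lam \<alpha> - d \<beta> * lam \<beta>"
    have sq: "x\<^sup>2 = y\<^sup>2" "y\<^sup>2 = K\<^sup>2 * (lam \<alpha> + lam \<beta>)\<^sup>2"
      unfolding x_def y_def solution_square[OF c a] solution_square[OF d a] by (rule refl)+
    have "lam (\<alpha> + \<beta>) = lam \<alpha> + lam \<beta>" using lam_add a by blast
    then have "lam \<alpha> + lam \<beta> \<noteq> 0" using lam_nonzero[OF a(3)] by simp
    then have y: "y \<noteq> 0" using sq(2) K by auto
    have "x = y \<or> x = - y" using sq(1) by (simp add: power2_eq_iff)
    then have "x - y = 0 \<longleftrightarrow> x + y \<noteq> 0" using y by auto
    moreover have "?D \<alpha> - ?D \<beta> = x - y" "?D' \<alpha> - ?D' \<beta> = x + y"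
      by (simp_all add: x_def y_def algebra_simps)
    ultimately show ?thesis by (simp only: eq_iff_diff_eq_0[of "?D \<alpha>"] eq_iff_diff_eq_0[of "?D' \<alpha>"])
  qed
  then have alt: "(\<exists>s. \<forall>\<alpha>\<in>\<Theta>. ?D \<alpha> = s) \<or> (\<exists>s. \<forall>\<alpha>\<in>\<Theta>. ?D' \<alpha> = s)"
    by (rule averaging_dichotomy[OF solution_averaging[OF c d]])
  have zero: "c \<alpha> = 0" "d \<alpha> = 0" if "\<alpha> \<in> \<Lambda>" for \<alpha>
    using c d that by (simp_all add: solution_def admissible_def)
  have "c \<alpha> = e * d \<alpha> + s * kks_coef \<alpha>"
    if "\<forall>\<alpha>\<in>\<Theta>. (c \<alpha> - e * d \<alpha>) * lam \<alpha> = s" "\<alpha> \<in> \<Omega>" for e s \<alpha>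
  proof (cases "\<alpha> \<in> \<Lambda>")
    case False
    then have "\<alpha> \<in> \<Theta>" using that(2) by blast
    then show ?thesis using that(1) lam_nonzero[of \<alpha>] by (auto simp: kks_coef_def field_simps)
  qed (simp add: zero kks_coef_def)
  note family = this
  from alt show ?thesis
  proof (elim disjE exE)
    fix s assume s: "\<forall>\<alpha>\<in>\<Theta>. ?D \<alpha> = s"
    have "c \<alpha> = d \<alpha> + s * kks_coef \<alpha>" if "\<alpha> \<in> \<Omega>" for \<alpha>
      using family[of 1 s \<alpha>] s that by simp
    then show ?thesis by blast
  next
    fix s assume s: "\<forall>\<alpha>\<in>\<Theta>. ?D' \<alpha> = s"
    have "c \<alpha> = - d \<alpha> + s * kks_coef \<alpha>" if "\<alpha> \<in> \<Omega>" for \<alpha>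
      using family[of "- 1" s \<alpha>] s that by simp
    then show ?thesis by blast
  qed
qed

lemma solution_family:
  assumes d: "solution K d" and e: "e\<^sup>2 = 1"
  shows "solution K (\<lambda>\<alpha>. e * d \<alpha> + s * kks_coef \<alpha>)"
  unfolding solution_def
proof (intro conjI ballI impI)
  show "admissible (\<lambda>\<alpha>. e * d \<alpha> + s * kks_coef \<alpha>)"
    using d kks_admissible unfolding solution_def admissible_def by simp
  fix \<alpha> \<beta> assume a: "\<alpha> \<in> \<Theta>" "\<beta> \<in> \<Theta>" "\<alpha> + \<beta> \<in> \<Theta>"
  have d': "triple_sum d d \<alpha> \<beta> = - 2 * K\<^sup>2" "triple_sum d kks_coef \<alpha> \<beta> = 0"
    using d a unfolding solution_def by blast+
  have v: "triple_sum kks_coef kks_coef \<alpha> \<beta> = 0" by (rule kks_kks[OF a])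
  have "triple_sum (\<lambda>\<alpha>. e * d \<alpha> + s * kks_coef \<alpha>) (\<lambda>\<alpha>. e * d \<alpha> + s * kks_coef \<alpha>) \<alpha> \<beta> =
      e\<^sup>2 * triple_sum d d \<alpha> \<beta> + 2 * e * s * triple_sum d kks_coef \<alpha> \<beta>
      + s\<^sup>2 * triple_sum kks_coef kks_coef \<alpha> \<beta>"
    by (simp add: triple_sum_def power2_eq_square algebra_simps)
  then show "triple_sum (\<lambda>\<alpha>. e * d \<alpha> + s * kks_coef \<alpha>) (\<lambda>\<alpha>. e * d \<alpha> + s * kks_coef \<alpha>) \<alpha> \<beta> = - 2 * K\<^sup>2"
    by (simp add: d' v e)
  have "triple_sum (\<lambda>\<alpha>. e * d \<alpha> + s * kks_coef \<alpha>) kks_coef \<alpha> \<beta> =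
      e * triple_sum d kks_coef \<alpha> \<beta> + s * triple_sum kks_coef kks_coef \<alpha> \<beta>"
    by (simp add: triple_sum_def algebra_simps)
  then show "triple_sum (\<lambda>\<alpha>. e * d \<alpha> + s * kks_coef \<alpha>) kks_coef \<alpha> \<beta> = 0"
    by (simp add: d' v)
qed

end

section \<open>Bivectors as skew operators\<close>

lemma wedge_two:
  assumes "\<xi> \<in> dual_space UNIV" "\<eta> \<in> dual_space UNIV"
  shows "wedge [x, y] [\<xi>, \<eta>] = \<xi> x * \<eta> y - \<xi> y * \<eta> x"
proof -
  have set: "{..<2 :: nat} = insert 0 (insert 1 {})" by auto
  show ?thesis
    using assms by (simp add: wedge_def numeral_2_eq_2[symmetric] set sum_over_permutations_insert
        permutation_swap_id sign_swap_id sign_compose sign_id lessThan_Suc)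
qed

lemma wedge_three:
  assumes "\<xi> \<in> dual_space UNIV" "\<eta> \<in> dual_space UNIV" "\<zeta> \<in> dual_space UNIV"
  shows "wedge [x, y, z] [\<xi>, \<eta>, \<zeta>] =
    \<xi> x * (\<eta> y * \<zeta> z - \<zeta> y * \<eta> z) + \<eta> x * (\<zeta> y * \<xi> z - \<xi> y * \<zeta> z)
    + \<zeta> x * (\<xi> y * \<eta> z - \<eta> y * \<xi> z)"
proof -
  have set: "{..<3 :: nat} = insert 0 (insert 1 (insert 2 {}))" by auto
  show ?thesis
    using assms by (simp add: wedge_def numeral_3_eq_3[symmetric] set sum_over_permutations_insert
        permutation_swap_id permutation_compose sign_swap_id sign_compose sign_id transpose_def algebra_simps)
qed


lemma ext_power_invalid:
  assumes "f \<in> ext_power k V" "length \<xi>s \<noteq> k \<or> \<not> set \<xi>s \<subseteq> dual_space UNIV"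
  shows "f \<xi>s = 0"
  using assms(1) unfolding ext_power_def
proof (induction rule: cfun.span_induct_alt)
  case (step c u w)
  obtain xs where xs: "u = wedge xs" "length xs = k" using step(1) by blast
  then have "\<not> (length \<xi>s = length xs \<and> set \<xi>s \<subseteq> dual_space UNIV)" using assms(2) by blast
  then have "u \<xi>s = 0" unfolding xs(1) wedge_def by (rule if_not_P)
  then show ?case using step(2) by (simp add: fscale_def)
qed simp

lemma schouten_sum_left: "schouten (\<Sum>a\<in>A. fscale (c a) (u a)) w = (\<Sum>a\<in>A. fscale (c a) (schouten (u a) w))"
proof -
  have "schouten (u + u') w = schouten u w + schouten u' w" for u u' :: "'a polyvector"
    by (simp add: schouten_def fun_eq_iff sum_apply fscale_def add_divide_distrib algebra_simps sum.distrib)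
  moreover have "schouten (fscale c u) w = fscale c (schouten u w)" for c and u :: "'a polyvector"
    by (simp add: schouten_def fun_eq_iff sum_apply fscale_def algebra_simps sum_distrib_left)
  moreover have "schouten 0 w = 0"
    by (simp add: schouten_def fun_eq_iff sum_apply fscale_def)
  ultimately show ?thesis by (induction A rule: infinite_finite_induct) auto
qed

lemma schouten_sum_right: "schouten w (\<Sum>a\<in>A. fscale (c a) (u a)) = (\<Sum>a\<in>A. fscale (c a) (schouten w (u a)))"
proof -
  have "schouten w (u + u') = schouten w u + schouten w u'" for u u' :: "'a polyvector"
    by (simp add: schouten_def fun_eq_iff sum_apply fscale_def add_divide_distrib algebra_simps sum.distrib)
  moreover have "schouten w (fscale c u) = fscale c (schouten w u)" for c and u :: "'a polyvector"
    by (simp add: schouten_def fun_eq_iff sum_apply fscale_def algebra_simps sum_distrib_left)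
  moreover have "schouten w 0 = 0"
    by (simp add: schouten_def fun_eq_iff sum_apply fscale_def)
  ultimately show ?thesis by (induction A rule: infinite_finite_induct) auto
qed

text \<open>The operator from covectors to vectors that belongs to the bivector \<open>x \<and> y\<close>: pairing its value at \<open>\<xi>\<close>
  with \<open>\<eta>\<close> gives \<open>(x \<and> y)(\<eta>, \<xi>)\<close>.\<close>

definition contract :: "'g :: complex_lie_algebra \<Rightarrow> 'g \<Rightarrow> ('g \<Rightarrow> complex) \<Rightarrow> 'g" where
  "contract x y \<xi> = \<xi> y *\<^sub>C x - \<xi> x *\<^sub>C y"

text \<open>In terms of the operators \<open>S\<close> and \<open>T\<close> of two bivectors, their Schouten bracket is the alternating sum over the
  permutations of the covectors of \<open>\<xi>([S \<eta>, T \<zeta>])\<close>. This form is bilinear in \<open>S\<close> and \<open>T\<close> and so extends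
  to sums of decomposable bivectors.\<close>

lemma schouten_decomp_two:
  assumes \<xi>: "\<xi> \<in> dual_space UNIV" and \<eta>: "\<eta> \<in> dual_space UNIV" and \<zeta>: "\<zeta> \<in> dual_space UNIV"
  shows "schouten_decomp [x1, x2] [y1, y2] [\<xi>, \<eta>, \<zeta>] =
    \<xi> (lie (contract x1 x2 \<eta>) (contract y1 y2 \<zeta>)) - \<xi> (lie (contract x1 x2 \<zeta>) (contract y1 y2 \<eta>))
    + \<eta> (lie (contract x1 x2 \<zeta>) (contract y1 y2 \<xi>)) - \<eta> (lie (contract x1 x2 \<xi>) (contract y1 y2 \<zeta>))
    + \<zeta> (lie (contract x1 x2 \<xi>) (contract y1 y2 \<eta>)) - \<zeta> (lie (contract x1 x2 \<eta>) (contract y1 y2 \<xi>))"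
proof -
  have c: "\<omega> (lie (contract x1 x2 \<theta>) (contract y1 y2 \<rho>)) =
      \<theta> x2 * \<rho> y2 * \<omega> (lie x1 y1) - \<theta> x2 * \<rho> y1 * \<omega> (lie x1 y2)
      - \<theta> x1 * \<rho> y2 * \<omega> (lie x2 y1) + \<theta> x1 * \<rho> y1 * \<omega> (lie x2 y2)"
    if "\<omega> \<in> dual_space UNIV" for \<omega> \<theta> \<rho> :: "'a \<Rightarrow> complex"
    by (simp only: contract_def lie_diff_right module_hom.diff[OF lie_hom_left] lie_scaleC_left
        lie_scaleC_right module_hom.diff[OF dual_space_hom[OF that]]
        module_hom.scale[OF dual_space_hom[OF that]]) (simp add: algebra_simps)
  have "schouten_decomp [x1, x2] [y1, y2] [\<xi>, \<eta>, \<zeta>] =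
      wedge [lie x1 y1, x2, y2] [\<xi>, \<eta>, \<zeta>] - wedge [lie x1 y2, x2, y1] [\<xi>, \<eta>, \<zeta>]
      - wedge [lie x2 y1, x1, y2] [\<xi>, \<eta>, \<zeta>] + wedge [lie x2 y2, x1, y1] [\<xi>, \<eta>, \<zeta>]"
    by (simp add: schouten_decomp_def omit_def fscale_def)
  then show ?thesis
    unfolding wedge_three[OF assms] c[OF \<xi>] c[OF \<eta>] c[OF \<zeta>] by (simp add: algebra_simps)
qed

context rooted_algebra
begin

definition flat :: "'g \<Rightarrow> 'g \<Rightarrow> complex" where
  "flat y = (\<lambda>x. killing x y)"

lemma flat_dual: "flat y \<in> dual_space UNIV"
  unfolding flat_def by (rule hom_dual_space[OF killing_hom_left])

lemma flat_surj: "\<xi> \<in> dual_space UNIV \<Longrightarrow> \<exists>y. \<xi> = flat y"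
  using killing_surj[OF killing_nondegenerate] unfolding flat_def by blast

definition odd_on_roots :: "(('g \<Rightarrow> complex) \<Rightarrow> complex) \<Rightarrow> bool" where
  "odd_on_roots c \<longleftrightarrow> (\<forall>\<alpha>\<in>\<Omega>. c (- \<alpha>) = - c \<alpha>)"

definition bivector :: "(('g \<Rightarrow> complex) \<Rightarrow> complex) \<Rightarrow> 'g polyvector" where
  "bivector c = (\<Sum>\<alpha>\<in>P. fscale (c \<alpha>) (wedge [E \<alpha>, E (- \<alpha>)]))"

text \<open>The operator of \<open>bivector c\<close>, when covectors are identified with vectors by the Killing form, is diagonal in the
  root vectors.\<close>

definition diag :: "(('g \<Rightarrow> complex) \<Rightarrow> complex) \<Rightarrow> 'g \<Rightarrow> 'g" where
  "diag c y = (\<Sum>\<alpha>\<in>\<Omega>. (c \<alpha> * killing y (E (- \<alpha>))) *\<^sub>C E \<alpha>)"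

lemma diag_hom: "module_hom scaleC scaleC (diag c)"
  by unfold_locales (simp_all add: diag_def killing_simps distrib_left scaleC_add_left sum.distrib
      clie.scale_sum_right scaleC_scaleC mult_ac)

lemma diag_H: "h \<in> H \<Longrightarrow> diag c h = 0"
  by (simp add: diag_def killing_H_E root_minus)

lemma diag_E:
  assumes \<alpha>: "\<alpha> \<in> \<Omega>"
  shows "diag c (E \<alpha>) = c \<alpha> *\<^sub>C E \<alpha>"
proof -
  have "diag c (E \<alpha>) = (\<Sum>\<beta>\<in>\<Omega>. if \<beta> = \<alpha> then c \<alpha> *\<^sub>C E \<alpha> else 0)"
    unfolding diag_def by (rule sum.cong) (auto simp: killing_E_E \<alpha> root_minus)
  then show ?thesis using \<alpha> by (simp add: finite_roots)
qed

lemma killing_H_diag: "h \<in> H \<Longrightarrow> killing h (diag c z) = 0"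
  by (simp add: diag_def killing_simps killing_H_E)

lemma finite_P: "finite P"
  using finite_subset[OF P_subset finite_roots] .

lemma sum_roots_split:
  fixes F :: "('g \<Rightarrow> complex) \<Rightarrow> 'b :: comm_monoid_add"
  shows "(\<Sum>\<alpha>\<in>\<Omega>. F \<alpha>) = (\<Sum>\<alpha>\<in>P. F \<alpha> + F (- \<alpha>))"
proof -
  have "\<Omega> = P \<union> uminus ` P"
  proof
    show "\<Omega> \<subseteq> P \<union> uminus ` P" using root_cases by (metis UnI1 UnI2 image_eqI minus_minus subsetI)
    show "P \<union> uminus ` P \<subseteq> \<Omega>" using P_subset root_minus by blast
  qed
  moreover have "P \<inter> uminus ` P = {}" using P_minus by blast
  ultimately have "(\<Sum>\<alpha>\<in>\<Omega>. F \<alpha>) = (\<Sum>\<alpha>\<in>P. F \<alpha>) + (\<Sum>\<alpha>\<in>uminus ` P. F \<alpha>)"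
    using finite_P by (simp add: sum.union_disjoint)
  also have "(\<Sum>\<alpha>\<in>uminus ` P. F \<alpha>) = (\<Sum>\<alpha>\<in>P. F (- \<alpha>))"
    by (subst sum.reindex) (simp_all add: inj_on_def o_def)
  finally show ?thesis by (simp only: sum.distrib)
qed

lemma diag_contract:
  assumes c: "odd_on_roots c"
  shows "(\<Sum>\<alpha>\<in>P. c \<alpha> *\<^sub>C contract (E \<alpha>) (E (- \<alpha>)) (flat y)) = diag c y"
  unfolding diag_def sum_roots_split
proof (rule sum.cong)
  fix \<alpha> assume "\<alpha> \<in> P"
  then have "c (- \<alpha>) = - c \<alpha>" using c P_subset by (auto simp: odd_on_roots_def)
  then show "c \<alpha> *\<^sub>C contract (E \<alpha>) (E (- \<alpha>)) (flat y) =
      (c \<alpha> * killing y (E (- \<alpha>))) *\<^sub>C E \<alpha> + (c (- \<alpha>) * killing y (E (- (- \<alpha>)))) *\<^sub>C E (- \<alpha>)"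
    by (simp add: contract_def flat_def killing_sym[of y] clie.scale_right_diff_distrib scaleC_scaleC)
qed simp

lemma bivector_flat:
  assumes c: "odd_on_roots c"
  shows "bivector c [flat y, flat z] = killing y (diag c z)"
proof -
  have "bivector c [flat y, flat z] = (\<Sum>\<alpha>\<in>P. c \<alpha> * killing y (contract (E \<alpha>) (E (- \<alpha>)) (flat z)))"
    unfolding bivector_def sum_apply fscale_def wedge_two[OF flat_dual flat_dual]
    by (rule sum.cong) (simp_all add: contract_def flat_def killing_simps killing_sym[of y] mult_ac)
  then show ?thesis by (simp add: diag_contract[OF c, symmetric] killing_simps)
qed

lemma bivector_ext_power: "bivector c \<in> ext_power 2 UNIV"
  unfolding bivector_def ext_power_def
proof (intro cfun.span_sum cfun.span_scale cfun.span_base CollectI)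
  show "\<exists>xs. wedge [E \<alpha>, E (- \<alpha>)] = wedge xs \<and> length xs = 2 \<and> set xs \<subseteq> UNIV" for \<alpha>
    by (rule exI[of _ "[E \<alpha>, E (- \<alpha>)]"]) simp
qed

lemma bivector_eqI:
  assumes "f \<in> ext_power 2 V" "g \<in> ext_power 2 W" "\<And>y z. f [flat y, flat z] = g [flat y, flat z]"
  shows "f = g"
proof
  fix \<xi>s :: "('g \<Rightarrow> complex) list"
  show "f \<xi>s = g \<xi>s"
  proof (cases "length \<xi>s = 2 \<and> set \<xi>s \<subseteq> dual_space UNIV")
    case True
    then obtain \<xi> \<eta> where "\<xi>s = [\<xi>, \<eta>]" by (auto simp: length_Suc_conv numeral_2_eq_2)
    moreover obtain y z where "\<xi> = flat y" "\<eta> = flat z"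
      using flat_surj[of \<xi>] flat_surj[of \<eta>] True calculation by auto
    ultimately show ?thesis using assms(3) by simp
  next
    case False
    then have "f \<xi>s = 0" "g \<xi>s = 0" using ext_power_invalid[OF assms(1)] ext_power_invalid[OF assms(2)] by blast+
    then show ?thesis by simp
  qed
qed

lemma bivector_cong: "(\<And>\<alpha>. \<alpha> \<in> \<Omega> \<Longrightarrow> c \<alpha> = d \<alpha>) \<Longrightarrow> bivector c = bivector d"
  unfolding bivector_def using P_subset by (intro sum.cong) auto

lemma bivector_combination: "bivector (\<lambda>\<alpha>. e * c \<alpha> + s * d \<alpha>) = fscale e (bivector c) + fscale s (bivector d)"
  unfolding bivector_def by (simp add: fun_eq_iff sum_apply fscale_def sum.distrib sum_distrib_left algebra_simps)

lemma ext_ad_flat: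
  assumes f: "f \<in> ext_power 2 V"
  shows "ext_ad x f [flat y, flat z] = f [flat (- lie x y), flat z] + f [flat y, flat (- lie x z)]"
proof -
  have "(\<lambda>w. flat y (lie x w)) = flat (- lie x y)" for y
  proof
    fix w
    have "killing (lie x w) y = - killing (lie w x) y" using lie_swap[of x w] by (simp add: killing_simps)
    then show "flat y (lie x w) = flat (- lie x y) w" by (simp add: flat_def killing_invariant killing_simps)
  qed
  then show ?thesis by (simp add: ext_ad_def flat_dual lessThan_Suc)
qed

lemma ext_ad_eq_0_iff:
  assumes f: "f \<in> ext_power 2 V"
  shows "ext_ad x f = 0 \<longleftrightarrow> (\<forall>y z. f [flat (- lie x y), flat z] + f [flat y, flat (- lie x z)] = 0)"
proof
  assume "ext_ad x f = 0"
  then show "\<forall>y z. f [flat (- lie x y), flat z] + f [flat y, flat (- lie x z)] = 0"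
    using ext_ad_flat[OF f, of x] by (metis zero_fun_apply)
next
  assume r: "\<forall>y z. f [flat (- lie x y), flat z] + f [flat y, flat (- lie x z)] = 0"
  show "ext_ad x f = 0"
  proof
    fix \<xi>s :: "('g \<Rightarrow> complex) list"
    show "ext_ad x f \<xi>s = 0 \<xi>s"
    proof (cases "length \<xi>s = 2 \<and> set \<xi>s \<subseteq> dual_space UNIV")
      case True
      then obtain \<xi> \<eta> where "\<xi>s = [\<xi>, \<eta>]" by (auto simp: length_Suc_conv numeral_2_eq_2)
      moreover obtain y z where "\<xi> = flat y" "\<eta> = flat z"
        using flat_surj[of \<xi>] flat_surj[of \<eta>] True calculation by auto
      ultimately show ?thesis using r ext_ad_flat[OF f, of x y z] by simp
    next
      case False
      then have "length \<xi>s \<noteq> 2" if "set \<xi>s \<subseteq> dual_space UNIV" using that by blast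
      then have "ext_ad x f \<xi>s = 0"
        unfolding ext_ad_def using ext_power_invalid[OF f] by (auto intro!: sum.neutral)
      then show ?thesis by simp
    qed
  qed
qed

text \<open>Under the Killing form, invariance of a bivector means that its operator commutes with \<open>ad x\<close>.\<close>

lemma bivector_invariant_iff:
  assumes c: "odd_on_roots c"
  shows "ext_ad x (bivector c) = 0 \<longleftrightarrow> (\<forall>z. diag c (lie x z) = lie x (diag c z))"
proof -
  have e: "bivector c [flat (- lie x y), flat z] + bivector c [flat y, flat (- lie x z)] =
      killing y (lie x (diag c z) - diag c (lie x z))" for y z
  proof -
    have "- killing (lie x y) (diag c z) = killing y (lie x (diag c z))"
      using lie_swap[of x y] killing_invariant[of y x "diag c z"] by (simp add: killing_simps)
    then show ?thesis
      by (simp add: bivector_flat[OF c] killing_simps module_hom.neg[OF diag_hom])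
  qed
  show ?thesis
    unfolding ext_ad_eq_0_iff[OF bivector_ext_power] e
  proof (intro iffI allI)
    fix z assume "\<forall>y z. killing y (lie x (diag c z) - diag c (lie x z)) = 0"
    then have "lie x (diag c z) - diag c (lie x z) = 0" by (intro killing_nondegenerate) blast
    then show "diag c (lie x z) = lie x (diag c z)" by simp
  next
    fix y z assume "\<forall>z. diag c (lie x z) = lie x (diag c z)"
    then show "killing y (lie x (diag c z) - diag c (lie x z)) = 0" by (simp add: killing_simps)
  qed
qed

definition cross :: "(('g \<Rightarrow> complex) \<Rightarrow> complex) \<Rightarrow> (('g \<Rightarrow> complex) \<Rightarrow> complex) \<Rightarrow> 'g \<Rightarrow> 'g \<Rightarrow> 'g \<Rightarrow> complex" where
  "cross c d x y z = killing (lie (diag c y) (diag d z)) x"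

definition trivector :: "(('g \<Rightarrow> complex) \<Rightarrow> complex) \<Rightarrow> (('g \<Rightarrow> complex) \<Rightarrow> complex) \<Rightarrow> 'g \<Rightarrow> 'g \<Rightarrow> 'g \<Rightarrow> complex" where
  "trivector c d x y z = cross c d x y z - cross c d x z y + cross c d y z x - cross c d y x z
     + cross c d z x y - cross c d z y x"

lemma schouten_bivector: "schouten (bivector c) (bivector d) =
    (\<Sum>\<alpha>\<in>P. \<Sum>\<beta>\<in>P. fscale (c \<alpha> * d \<beta>) (schouten_decomp [E \<alpha>, E (- \<alpha>)] [E \<beta>, E (- \<beta>)]))"
proof -
  have "schouten (bivector c) (bivector d) =
     (\<Sum>\<alpha>\<in>P. fscale (c \<alpha>) (\<Sum>\<beta>\<in>P. fscale (d \<beta>) (schouten_decomp [E \<alpha>, E (- \<alpha>)] [E \<beta>, E (- \<beta>)])))"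
    unfolding bivector_def schouten_sum_left by (simp only: schouten_sum_right schouten_wedge)
  then show ?thesis by (simp add: cfun.scale_sum_right)
qed

lemma schouten_bivector_flat:
  assumes c: "odd_on_roots c" and d: "odd_on_roots d"
  shows "schouten (bivector c) (bivector d) [flat x, flat y, flat z] = trivector c d x y z"
proof -
  let ?C = "\<lambda>\<alpha>. contract (E \<alpha>) (E (- \<alpha>))"
  have s: "(\<Sum>\<alpha>\<in>P. \<Sum>\<beta>\<in>P. c \<alpha> * d \<beta> * flat x (lie (?C \<alpha> (flat y)) (?C \<beta> (flat z)))) = cross c d x y z"
    for x y z
    unfolding cross_def diag_contract[OF c, symmetric] diag_contract[OF d, symmetric] flat_def
    by (subst sum.swap) (simp add: lie_sum_left lie_sum_right lie_scaleC_left lie_scaleC_right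
        killing_simps sum_distrib_left mult_ac)
  show ?thesis
    unfolding trivector_def s[symmetric] schouten_bivector
    by (simp only: sum_apply fscale_def schouten_decomp_two[OF flat_dual flat_dual flat_dual]
        distrib_left right_diff_distrib sum.distrib sum_subtractf)
qed

lemma schouten_bivector_invalid:
  assumes "length \<xi>s \<noteq> 3"
  shows "schouten (bivector c) (bivector d) \<xi>s = 0"
proof -
  have "schouten_decomp [x, x'] [y, y'] \<xi>s = 0" for x x' y y' :: 'g
    using assms by (simp add: schouten_decomp_def sum_apply fscale_def omit_def wedge_def lessThan_Suc)
  then show ?thesis by (simp add: schouten_bivector sum_apply fscale_def)
qed

lemma trivector_E:
  assumes r: "\<alpha> \<in> \<Omega>" "\<beta> \<in> \<Omega>" "\<gamma> \<in> \<Omega>"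
  shows "trivector c d (E \<alpha>) (E \<beta>) (E \<gamma>) = killing (lie (E \<alpha>) (E \<beta>)) (E \<gamma>) *
    (c \<alpha> * d \<beta> + c \<beta> * d \<alpha> + c \<alpha> * d \<gamma> + c \<gamma> * d \<alpha> + c \<beta> * d \<gamma> + c \<gamma> * d \<beta>)"
proof -
  let ?k = "\<lambda>x y z. killing (lie (E x) (E y)) (E z)"
  have swap: "?k y x z = - ?k x y z" for x y z
    using lie_swap[of "E y" "E x"] by (simp add: killing_simps)
  have cyc: "?k y z x = ?k x y z" for x y z
    using killing_invariant[of "E x" "E y" "E z"] killing_sym[of "lie (E y) (E z)"] by simp
  have cr: "cross c d (E x) (E y) (E z) = c y * d z * ?k y z x"
    if "x \<in> \<Omega>" "y \<in> \<Omega>" "z \<in> \<Omega>" for x y z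
    using that by (simp add: cross_def diag_E lie_scaleC_left lie_scaleC_right killing_simps)
  have k: "?k \<beta> \<gamma> \<alpha> = ?k \<alpha> \<beta> \<gamma>" "?k \<gamma> \<alpha> \<beta> = ?k \<alpha> \<beta> \<gamma>" "?k \<gamma> \<beta> \<alpha> = - ?k \<alpha> \<beta> \<gamma>"
    "?k \<alpha> \<gamma> \<beta> = - ?k \<alpha> \<beta> \<gamma>" "?k \<beta> \<alpha> \<gamma> = - ?k \<alpha> \<beta> \<gamma>"
    by (rule cyc, metis cyc, metis cyc swap, metis cyc swap, rule swap)
  show ?thesis unfolding trivector_def by (simp only: cr r k) (simp add: algebra_simps)
qed

text \<open>Brackets of invariant bivectors therefore have components on triples with sum zero only.\<close>

lemma killing_triple_zero:
  assumes "\<alpha> \<in> \<Omega>" "\<beta> \<in> \<Omega>" "\<gamma> \<in> \<Omega>" "\<alpha> + \<beta> + \<gamma> \<noteq> 0"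
  shows "killing (lie (E \<alpha>) (E \<beta>)) (E \<gamma>) = 0"
  by (rule root_spaces_orthogonal[OF dual_add[OF root_dual root_dual] root_dual assms(4)
        lie_root_space[OF E_root_space E_root_space] E_root_space]) (rule assms)+

lemma trivector_swap: "trivector c d x y z = - trivector c d y x z" "trivector c d x y z = - trivector c d z y x"
  by (simp_all add: trivector_def)

lemma trivector_subspace: "clie.subspace {x. trivector c d x y z = k * trivector c' d' x y z}"
proof -
  have cross_add: "cross c d (x + x') y z = cross c d x y z + cross c d x' y z"
    "cross c d y (x + x') z = cross c d y x z + cross c d y x' z"
    "cross c d y z (x + x') = cross c d y z x + cross c d y z x'" for c d x x' y z
    by (simp_all only: cross_def killing_simps module_hom.add[OF diag_hom] lie_add_left lie_add_right)
  have cross_scale: "cross c d (a *\<^sub>C x) y z = a * cross c d x y z"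
    "cross c d y (a *\<^sub>C x) z = a * cross c d y x z"
    "cross c d y z (a *\<^sub>C x) = a * cross c d y z x" for c d x y z a
    by (simp_all only: cross_def killing_simps module_hom.scale[OF diag_hom] lie_scaleC_left lie_scaleC_right)
  have add: "trivector c d (x + x') y z = trivector c d x y z + trivector c d x' y z" for c d x x'
    unfolding trivector_def cross_add by simp
  have scale: "trivector c d (a *\<^sub>C x) y z = a * trivector c d x y z" for c d x a
    unfolding trivector_def cross_scale by (simp add: algebra_simps)
  have "trivector c d 0 y z = 0" for c d using scale[of c d 0 0] by simp
  then show ?thesis
    unfolding clie.subspace_def mem_Collect_eq add scale by (simp add: distrib_left)
qed

end


section \<open>Brackets on the orbit and their coefficients\<close>

context orbit_algebra
begin

lemma admissible_odd: "admissible c \<Longrightarrow> odd_on_roots c"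
  by (simp add: admissible_def odd_on_roots_def)

lemma killing_levi_compl:
  assumes "x \<in> \<LL>" "y \<in> clie.span (E ` \<Theta>)"
  shows "killing x y = 0"
proof -
  have "\<LL> \<subseteq> {x. killing x (E \<alpha>) = 0}" if \<alpha>: "\<alpha> \<in> \<Theta>" for \<alpha>
  proof (rule levi_least)
    show "clie.subspace {x. killing x (E \<alpha>) = 0}" by (auto simp: clie.subspace_def killing_simps)
    show "H \<subseteq> {x. killing x (E \<alpha>) = 0}" using \<alpha> by (auto simp: killing_H_E)
    fix \<gamma> assume \<gamma>: "\<gamma> \<in> \<Lambda>"
    then have "\<alpha> \<noteq> - \<gamma>" "\<gamma> \<in> \<Omega>" using levi_root_minus[OF \<gamma>] \<alpha> by (auto simp: levi_roots_def)
    then show "E \<gamma> \<in> {x. killing x (E \<alpha>) = 0}" using \<alpha> by (simp add: killing_E_E)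
  qed
  then have "E ` \<Theta> \<subseteq> {y. killing x y = 0}" using assms(1) by blast
  then have "clie.span (E ` \<Theta>) \<subseteq> {y. killing x y = 0}"
    by (rule clie.span_minimal[OF _ killing_kernel_subspace])
  then show ?thesis using assms(2) by blast
qed

text \<open>The component of \<open>y\<close> in \<open>H\<close> is orthogonal to \<open>H\<close>, where the Killing form is nondegenerate, and the other
  components are read off from the values of \<open>\<kappa>\<close> on root vectors.\<close>

lemma levi_orthogonal:
  assumes y: "\<And>x. x \<in> \<LL> \<Longrightarrow> killing x y = 0"
  shows "y = (\<Sum>\<alpha>\<in>\<Theta>. killing y (E (- \<alpha>)) *\<^sub>C E \<alpha>)"
proof -
  let ?h = "y - (\<Sum>\<alpha>\<in>\<Omega>. killing y (E (- \<alpha>)) *\<^sub>C E \<alpha>)"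
  have "?h = 0"
  proof (rule killing_H_nondegenerate[OF root_expansion])
    fix h assume "h \<in> H"
    then show "killing h ?h = 0" using y H_levi by (auto simp: killing_simps killing_H_E)
  qed
  then have "y = (\<Sum>\<alpha>\<in>\<Omega>. killing y (E (- \<alpha>)) *\<^sub>C E \<alpha>)" by simp
  also have "\<dots> = (\<Sum>\<alpha>\<in>\<Theta>. killing y (E (- \<alpha>)) *\<^sub>C E \<alpha>)"
  proof (rule sum.mono_neutral_right[OF finite_roots Diff_subset], intro ballI)
    fix \<alpha> assume "\<alpha> \<in> \<Omega> - \<Theta>"
    then have "killing (E (- \<alpha>)) y = 0" by (intro y E_levi levi_root_minus) blast
    then show "killing y (E (- \<alpha>)) *\<^sub>C E \<alpha> = 0" by (simp add: killing_sym[of y])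
  qed
  finally show ?thesis .
qed

lemma annihilator_levi: "\<xi> \<in> annihilator \<LL> \<longleftrightarrow> (\<exists>y\<in>clie.span (E ` \<Theta>). \<xi> = flat y)"
proof
  assume \<xi>: "\<xi> \<in> annihilator \<LL>"
  then obtain y where y: "\<xi> = flat y" using flat_surj by (auto simp: annihilator_def)
  have "y = (\<Sum>\<alpha>\<in>\<Theta>. killing y (E (- \<alpha>)) *\<^sub>C E \<alpha>)"
    by (rule levi_orthogonal) (use \<xi> in \<open>auto simp: annihilator_def y flat_def\<close>)
  moreover have "(\<Sum>\<alpha>\<in>\<Theta>. killing y (E (- \<alpha>)) *\<^sub>C E \<alpha>) \<in> clie.span (E ` \<Theta>)"
    by (intro clie.span_sum clie.span_scale clie.span_base) blast
  ultimately show "\<exists>y\<in>clie.span (E ` \<Theta>). \<xi> = flat y" using y by metis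
next
  assume "\<exists>y\<in>clie.span (E ` \<Theta>). \<xi> = flat y"
  then obtain y where "y \<in> clie.span (E ` \<Theta>)" "\<xi> = flat y" by blast
  then show "\<xi> \<in> annihilator \<LL>"
    using killing_levi_compl flat_dual by (auto simp: annihilator_def) (simp add: flat_def)
qed

lemma levi_compl_eq: "levi_compl H P E \<Gamma> = clie.span (E ` \<Theta>)"
proof -
  have "E ` (P - \<Lambda>) \<union> (\<lambda>\<gamma>. E (- \<gamma>)) ` (P - \<Lambda>) = E ` \<Theta>"
  proof
    show "E ` (P - \<Lambda>) \<union> (\<lambda>\<gamma>. E (- \<gamma>)) ` (P - \<Lambda>) \<subseteq> E ` \<Theta>"
      using P_subset compl_minus by blast
    show "E ` \<Theta> \<subseteq> E ` (P - \<Lambda>) \<union> (\<lambda>\<gamma>. E (- \<gamma>)) ` (P - \<Lambda>)"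
    proof
      fix x assume "x \<in> E ` \<Theta>"
      then obtain \<alpha> where \<alpha>: "\<alpha> \<in> \<Theta>" "x = E \<alpha>" by blast
      have "\<alpha> \<in> P \<or> - \<alpha> \<in> P" using \<alpha>(1) root_cases by blast
      moreover have "- \<alpha> \<notin> \<Lambda>" using compl_minus[OF \<alpha>(1)] by blast
      moreover have "x = E (- (- \<alpha>))" using \<alpha>(2) by simp
      ultimately show "x \<in> E ` (P - \<Lambda>) \<union> (\<lambda>\<gamma>. E (- \<gamma>)) ` (P - \<Lambda>)"
        using \<alpha> by blast
    qed
  qed
  then show ?thesis by (simp add: levi_compl_def)
qed

text \<open>Both sides are linear in each of the arguments. By antisymmetry, linearity in the first one is enough.\<close>

lemma trivector_span:
  assumes E: "\<And>\<alpha> \<beta> \<gamma>. \<alpha> \<in> \<Theta> \<Longrightarrow> \<beta> \<in> \<Theta> \<Longrightarrow> \<gamma> \<in> \<Theta> \<Longrightarrow>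
      trivector c d (E \<alpha>) (E \<beta>) (E \<gamma>) = k * trivector c' d' (E \<alpha>) (E \<beta>) (E \<gamma>)"
    and "x \<in> clie.span (E ` \<Theta>)" "y \<in> clie.span (E ` \<Theta>)" "z \<in> clie.span (E ` \<Theta>)"
  shows "trivector c d x y z = k * trivector c' d' x y z"
proof -
  let ?Q = "\<lambda>x y z. trivector c d x y z = k * trivector c' d' x y z"
  have ext: "?Q x y z" if "x \<in> clie.span (E ` \<Theta>)" "\<And>\<alpha>. \<alpha> \<in> \<Theta> \<Longrightarrow> ?Q (E \<alpha>) y z" for x y z
  proof -
    have "clie.span (E ` \<Theta>) \<subseteq> {x. ?Q x y z}"
      by (rule clie.span_minimal[OF _ trivector_subspace]) (use that(2) in blast)
    then show ?thesis using that(1) by blast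
  qed
  have swap: "?Q x y z \<longleftrightarrow> ?Q y x z" "?Q x y z \<longleftrightarrow> ?Q z y x" for x y z
    using trivector_swap[of c d x y z] trivector_swap[of c' d' x y z] by auto
  have 1: "?Q x (E \<beta>) (E \<gamma>)" if "\<beta> \<in> \<Theta>" "\<gamma> \<in> \<Theta>" for \<beta> \<gamma>
    by (rule ext[OF assms(2) E]) (rule that | assumption)+
  have 2: "?Q x y (E \<gamma>)" if "\<gamma> \<in> \<Theta>" for \<gamma>
    unfolding swap(1)[of x y] by (rule ext[OF assms(3)]) (simp only: swap(1)[of _ x] 1 that)
  show ?thesis
    unfolding swap(2)[of x y] by (rule ext[OF assms(4)]) (simp only: swap(2)[of _ y] 2)
qed

text \<open>The bivector \<open>r\<close> has coefficient 1 at all positive roots; as an odd function this is the sign.\<close>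

definition sign_coef :: "('g \<Rightarrow> complex) \<Rightarrow> complex" where
  "sign_coef \<alpha> = (if \<alpha> \<in> P then 1 else - 1)"

lemma sign_coef_odd: "odd_on_roots sign_coef"
  unfolding odd_on_roots_def sign_coef_def using root_cases P_minus by auto

lemma r_bivector_eq: "r_bivector P E = bivector sign_coef"
  unfolding r_bivector_def bivector_def
  by (rule sum.cong) (auto simp: sign_coef_def fscale_def)

text \<open>Among three roots with sum zero both signs occur.\<close>

lemma sign_triple_sum:
  assumes "\<alpha> \<in> \<Omega>" "\<beta> \<in> \<Omega>" "\<alpha> + \<beta> \<in> \<Omega>"
  shows "triple_sum sign_coef sign_coef \<alpha> \<beta> = - 2"
proof -
  have 1: "\<alpha> + \<beta> \<in> P" if "\<alpha> \<in> P" "\<beta> \<in> P" using P_add that assms(3) by blast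
  have 2: "\<alpha> + \<beta> \<notin> P" if "\<alpha> \<notin> P" "\<beta> \<notin> P"
  proof -
    have "- \<alpha> \<in> P" "- \<beta> \<in> P" using root_cases assms that by blast+
    moreover have eq: "- \<alpha> + - \<beta> = - (\<alpha> + \<beta>)" by simp
    ultimately have "- (\<alpha> + \<beta>) \<in> P"
      using P_add[of "- \<alpha>" "- \<beta>"] root_minus[OF assms(3)] unfolding eq by blast
    then show ?thesis using P_minus by blast
  qed
  show ?thesis
    using 1 2 by (cases "\<alpha> \<in> P"; cases "\<beta> \<in> P") (simp_all add: triple_sum_def sign_coef_def)
qed

lemma trivector_triple_sum:
  assumes c: "odd_on_roots c" and d: "odd_on_roots d"
    and r: "\<alpha> \<in> \<Omega>" "\<beta> \<in> \<Omega>" "\<alpha> + \<beta> \<in> \<Omega>"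
  shows "trivector c d (E \<alpha>) (E \<beta>) (E (- (\<alpha> + \<beta>))) =
    killing (lie (E \<alpha>) (E \<beta>)) (E (- (\<alpha> + \<beta>))) * triple_sum c d \<alpha> \<beta>"
proof -
  have m: "c (- (\<alpha> + \<beta>)) = - c (\<alpha> + \<beta>)" "d (- (\<alpha> + \<beta>)) = - d (\<alpha> + \<beta>)"
    using c d r(3) by (simp_all only: odd_on_roots_def)
  show ?thesis
    unfolding trivector_E[OF r(1,2) root_minus[OF r(3)]] m triple_sum_def by (simp add: algebra_simps)
qed

text \<open>The Schouten bracket and \<open>\<phi>\<close> have components proportional to the same structure constants, which are not
  zero, with the factors \<open>triple_sum c d \<alpha> \<beta>\<close> and \<open>-2\<close>.\<close>

lemma orbit_schouten_iff:
  assumes c: "odd_on_roots c" and d: "odd_on_roots d"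
  shows "orbit_schouten H E \<Gamma> (bivector c) (bivector d) = fscale k (phi_orbit H P E \<Gamma>) \<longleftrightarrow>
    (\<forall>\<alpha>\<in>\<Theta>. \<forall>\<beta>\<in>\<Theta>. \<alpha> + \<beta> \<in> \<Theta> \<longrightarrow> triple_sum c d \<alpha> \<beta> = - 2 * k)"
proof
  let ?A = "annihilator \<LL>"
  assume eq: "orbit_schouten H E \<Gamma> (bivector c) (bivector d) = fscale k (phi_orbit H P E \<Gamma>)"
  show "\<forall>\<alpha>\<in>\<Theta>. \<forall>\<beta>\<in>\<Theta>. \<alpha> + \<beta> \<in> \<Theta> \<longrightarrow> triple_sum c d \<alpha> \<beta> = - 2 * k"
  proof (intro ballI impI)
    fix \<alpha> \<beta> assume a: "\<alpha> \<in> \<Theta>" "\<beta> \<in> \<Theta>" "\<alpha> + \<beta> \<in> \<Theta>"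
    have r: "\<alpha> \<in> \<Omega>" "\<beta> \<in> \<Omega>" "\<alpha> + \<beta> \<in> \<Omega>" using a by blast+
    let ?N = "killing (lie (E \<alpha>) (E \<beta>)) (E (- (\<alpha> + \<beta>)))"
    let ?\<xi>s = "[flat (E \<alpha>), flat (E \<beta>), flat (E (- (\<alpha> + \<beta>)))]"
    have "flat (E \<delta>) \<in> ?A" if "\<delta> \<in> \<Theta>" for \<delta>
      unfolding annihilator_levi using that by (blast intro: clie.span_base)
    then have "set ?\<xi>s \<subseteq> ?A" using a compl_minus[OF a(3)] by simp
    then have "schouten (bivector c) (bivector d) ?\<xi>s = k * schouten (bivector sign_coef) (bivector sign_coef) ?\<xi>s"
      using fun_cong[OF eq, of ?\<xi>s]
      by (simp only: orbit_schouten_def phi_orbit_def quot_polyvector_def fscale_def r_bivector_eq if_True)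
    then have "?N * triple_sum c d \<alpha> \<beta> = k * (?N * - 2)"
      by (simp only: schouten_bivector_flat c d sign_coef_odd trivector_triple_sum r sign_triple_sum)
    then have "?N * triple_sum c d \<alpha> \<beta> = ?N * (- 2 * k)" by (simp add: mult_ac)
    then show "triple_sum c d \<alpha> \<beta> = - 2 * k"
      using structure_constant_nonzero[OF r] by (simp only: mult_cancel_left) blast
  qed
next
  let ?A = "annihilator \<LL>"
  assume eq: "\<forall>\<alpha>\<in>\<Theta>. \<forall>\<beta>\<in>\<Theta>. \<alpha> + \<beta> \<in> \<Theta> \<longrightarrow> triple_sum c d \<alpha> \<beta> = - 2 * k"
  have basis: "trivector c d (E \<alpha>) (E \<beta>) (E \<gamma>) = k * trivector sign_coef sign_coef (E \<alpha>) (E \<beta>) (E \<gamma>)"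
    if a: "\<alpha> \<in> \<Theta>" "\<beta> \<in> \<Theta>" "\<gamma> \<in> \<Theta>" for \<alpha> \<beta> \<gamma>
  proof (cases "\<alpha> + \<beta> + \<gamma> = 0")
    case True
    then have g: "\<gamma> = - (\<alpha> + \<beta>)" by (metis add_eq_0_iff)
    have ab: "\<alpha> + \<beta> \<in> \<Theta>" using compl_minus[OF a(3)] unfolding g minus_minus .
    have r: "\<alpha> \<in> \<Omega>" "\<beta> \<in> \<Omega>" "\<alpha> + \<beta> \<in> \<Omega>" using a ab by blast+
    have t: "triple_sum c d \<alpha> \<beta> = - 2 * k" using eq a(1,2) ab by blast
    show ?thesis
      unfolding g trivector_triple_sum[OF c d r] trivector_triple_sum[OF sign_coef_odd sign_coef_odd r]
        t sign_triple_sum[OF r] by simp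
  next
    case False
    have r: "\<alpha> \<in> \<Omega>" "\<beta> \<in> \<Omega>" "\<gamma> \<in> \<Omega>" using a by blast+
    show ?thesis by (simp only: trivector_E[OF r] killing_triple_zero[OF r False]) simp
  qed
  show "orbit_schouten H E \<Gamma> (bivector c) (bivector d) = fscale k (phi_orbit H P E \<Gamma>)"
  proof
    fix \<xi>s :: "('g \<Rightarrow> complex) list"
    have "schouten (bivector c) (bivector d) \<xi>s = k * schouten (bivector sign_coef) (bivector sign_coef) \<xi>s"
      if sub: "set \<xi>s \<subseteq> ?A"
    proof (cases "length \<xi>s = 3")
      case True
      then obtain \<xi> \<eta> \<zeta> where l: "\<xi>s = [\<xi>, \<eta>, \<zeta>]" by (auto simp: length_Suc_conv numeral_3_eq_3)
      obtain x y z where "x \<in> clie.span (E ` \<Theta>)" "\<xi> = flat x" "y \<in> clie.span (E ` \<Theta>)" "\<eta> = flat y"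
        "z \<in> clie.span (E ` \<Theta>)" "\<zeta> = flat z"
        using sub unfolding l by (auto simp: annihilator_levi)
      then show ?thesis
        unfolding l by (simp only: schouten_bivector_flat c d sign_coef_odd trivector_span[OF basis])
    next
      case False
      then show ?thesis by (simp add: schouten_bivector_invalid)
    qed
    then show "orbit_schouten H E \<Gamma> (bivector c) (bivector d) \<xi>s = fscale k (phi_orbit H P E \<Gamma>) \<xi>s"
      by (simp add: orbit_schouten_def phi_orbit_def quot_polyvector_def fscale_def r_bivector_eq)
  qed
qed

text \<open>For a Levi root \<open>\<gamma>\<close>, the operator \<open>ad E\<^sub>\<gamma>\<close> maps the line of \<open>\<alpha>\<close> to that of \<open>\<alpha> + \<gamma>\<close>, where the coefficient is the same.\<close>

lemma diag_commutes_levi: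
  assumes c: "admissible c" and x: "x \<in> \<LL>"
  shows "diag c (lie x z) = lie x (diag c z)"
proof -
  let ?S = "{x. \<forall>z. diag c (lie x z) = lie x (diag c z)}"
  have sub: "clie.subspace {z. diag c (lie x z) = lie x (diag c z)}" for x
    by (auto simp: clie.subspace_def module_hom.zero[OF diag_hom] module_hom.add[OF diag_hom]
        module_hom.scale[OF diag_hom] lie_add_right lie_scaleC_right)
  have "\<LL> \<subseteq> ?S"
  proof (rule levi_least)
    show "clie.subspace ?S"
      by (auto simp: clie.subspace_def module_hom.zero[OF diag_hom] module_hom.add[OF diag_hom]
        module_hom.scale[OF diag_hom] lie_add_left lie_scaleC_left)
    show "H \<subseteq> ?S"
    proof (intro subsetI CollectI allI)
      fix h z assume h: "h \<in> H"
      have "z \<in> {z. diag c (lie h z) = lie h (diag c z)}"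
      proof (rule UNIV_by_root_vectors[OF sub])
        show "H \<subseteq> {z. diag c (lie h z) = lie h (diag c z)}"
          using h by (auto simp: H_abelian diag_H module_hom.zero[OF diag_hom])
        show "E \<alpha> \<in> {z. diag c (lie h z) = lie h (diag c z)}" if "\<alpha> \<in> \<Omega>" for \<alpha>
          using that h by (simp add: lie_H_E diag_E module_hom.scale[OF diag_hom] lie_scaleC_right
              scaleC_scaleC mult.commute)
      qed
      then show "diag c (lie h z) = lie h (diag c z)" by simp
    qed
    fix \<gamma> assume \<gamma>: "\<gamma> \<in> \<Lambda>"
    then have \<gamma>\<Omega>: "\<gamma> \<in> \<Omega>" by (simp add: levi_roots_def)
    have levi0: "c \<delta> = 0" if "\<delta> \<in> \<Lambda>" for \<delta> using c that by (simp add: admissible_def)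
    show "E \<gamma> \<in> ?S"
    proof (intro CollectI allI)
      fix z
      have "z \<in> {z. diag c (lie (E \<gamma>) z) = lie (E \<gamma>) (diag c z)}"
      proof (rule UNIV_by_root_vectors[OF sub])
        show "H \<subseteq> {z. diag c (lie (E \<gamma>) z) = lie (E \<gamma>) (diag c z)}"
        proof
          fix h assume h: "h \<in> H"
          have "lie (E \<gamma>) h = (- \<gamma> h) *\<^sub>C E \<gamma>" using lie_swap[of "E \<gamma>" h] lie_H_E[OF h \<gamma>\<Omega>] by simp
          then have "diag c (lie (E \<gamma>) h) = 0"
            by (simp only: module_hom.scale[OF diag_hom] diag_E[OF \<gamma>\<Omega>] levi0[OF \<gamma>]) simp
          then show "h \<in> {z. diag c (lie (E \<gamma>) z) = lie (E \<gamma>) (diag c z)}" by (simp add: diag_H h)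
        qed
        fix \<alpha> assume \<alpha>: "\<alpha> \<in> \<Omega>"
        consider "\<alpha> = - \<gamma>" | "\<gamma> + \<alpha> \<in> \<Omega>" | "\<gamma> + \<alpha> \<notin> \<Omega>" "\<gamma> + \<alpha> \<noteq> 0" by (metis add_eq_0_iff)
        then have "diag c (lie (E \<gamma>) (E \<alpha>)) = c \<alpha> *\<^sub>C lie (E \<gamma>) (E \<alpha>)"
        proof cases
          case 1
          have "diag c (tvec \<gamma>) = 0" by (rule diag_H[OF tvec_H[OF \<gamma>\<Omega>]])
          moreover have "c \<alpha> = 0" unfolding 1 by (rule levi0[OF levi_root_minus[OF \<gamma>]])
          ultimately show ?thesis unfolding 1 tvec_def by simp
        next
          case 2
          have "c (\<gamma> + \<alpha>) = c \<alpha>"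
          proof (cases "\<alpha> \<in> \<Lambda>")
            case True
            then show ?thesis using levi0 levi_root_add[OF \<gamma> True 2] by simp
          next
            case False
            then have "c (\<alpha> + \<gamma>) = c \<alpha>"
              using c \<alpha> \<gamma> 2 unfolding admissible_def add.commute[of \<gamma>] by blast
            then show ?thesis unfolding add.commute[of \<gamma>] .
          qed
          then show ?thesis
            by (subst (1 2) lie_E_E[OF \<gamma>\<Omega> \<alpha> 2])
              (simp only: module_hom.scale[OF diag_hom] diag_E[OF 2] scaleC_scaleC mult.commute)
        next
          case 3
          then show ?thesis
            using lie_E_E_zero[OF \<gamma>\<Omega> \<alpha>] by (simp add: module_hom.zero[OF diag_hom])
        qed
        then show "E \<alpha> \<in> {z. diag c (lie (E \<gamma>) z) = lie (E \<gamma>) (diag c z)}"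
          by (simp add: diag_E[OF \<alpha>] lie_scaleC_right)
      qed
      then show "diag c (lie (E \<gamma>) z) = lie (E \<gamma>) (diag c z)" by simp
    qed
  qed
  then show ?thesis using x by blast
qed

lemma bivector_invariant:
  assumes c: "admissible c"
  shows "invariant_bracket H P E \<Gamma> (bivector c)"
  unfolding invariant_bracket_def levi_compl_eq
proof (intro conjI ballI)
  show "ext_ad x (bivector c) = 0" if "x \<in> \<LL>" for x
    unfolding bivector_invariant_iff[OF admissible_odd[OF c]]
    using diag_commutes_levi[OF c that] by blast
  have "fscale (c \<alpha>) (wedge [E \<alpha>, E (- \<alpha>)]) \<in> ext_power 2 (clie.span (E ` \<Theta>))" if \<alpha>: "\<alpha> \<in> P" for \<alpha>
  proof (cases "\<alpha> \<in> \<Lambda>")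
    case True
    then have "c \<alpha> = 0" using c by (simp add: admissible_def)
    then show ?thesis by (simp add: ext_power_def cfun.span_zero)
  next
    case False
    then have t: "\<alpha> \<in> \<Theta>" using \<alpha> P_subset by blast
    have "set [E \<alpha>, E (- \<alpha>)] \<subseteq> clie.span (E ` \<Theta>)"
      using t compl_minus[OF t] clie.span_base by (metis empty_set image_eqI list.simps(15) insert_subset empty_subsetI)
    then have "\<exists>xs. wedge [E \<alpha>, E (- \<alpha>)] = wedge xs \<and> length xs = 2 \<and> set xs \<subseteq> clie.span (E ` \<Theta>)"
      by (intro exI[of _ "[E \<alpha>, E (- \<alpha>)]"]) simp
    then show ?thesis unfolding ext_power_def by (intro cfun.span_scale cfun.span_base CollectI)
  qed
  then show "bivector c \<in> ext_power 2 (clie.span (E ` \<Theta>))"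
    unfolding bivector_def ext_power_def by (intro cfun.span_sum)
qed

text \<open>Invariance under \<open>H\<close> leaves only the components at \<open>(\<alpha>, -\<alpha>)\<close>, and invariance under \<open>E\<^sub>\<gamma>\<close> for Levi roots \<open>\<gamma>\<close>
  makes the coefficients at \<open>\<alpha>\<close> and \<open>\<alpha> + \<gamma>\<close> equal. Components that involve the Levi subalgebra vanish because
  the bracket is built from the complement, which is orthogonal to it.\<close>

lemma invariant_bracket_coefs:
  assumes f: "invariant_bracket H P E \<Gamma> f"
  obtains c where "admissible c" "f = bivector c"
proof -
  let ?m = "clie.span (E ` \<Theta>)" and ?B = "\<lambda>y z. f [flat y, flat z]"
  have f2: "f \<in> ext_power 2 ?m" and inv: "\<And>x. x \<in> \<LL> \<Longrightarrow> ext_ad x f = 0"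
    using f by (auto simp: invariant_bracket_def levi_compl_eq)
  have props: "(\<forall>y y' z. ?B (y + y') z = ?B y z + ?B y' z) \<and> (\<forall>a y z. ?B (a *\<^sub>C y) z = a * ?B y z)
      \<and> (\<forall>y z. ?B z y = - ?B y z) \<and> (\<forall>y\<in>\<LL>. \<forall>z. ?B y z = 0)"
    using f2 unfolding ext_power_def
  proof (induction rule: cfun.span_induct_alt)
    case (step c u w)
    obtain xs where xs: "u = wedge xs" "length xs = 2" "set xs \<subseteq> ?m" using step(1) by blast
    obtain p q where pq: "xs = [p, q]" using xs(2) by (auto simp: length_Suc_conv numeral_2_eq_2)
    have m: "p \<in> ?m" "q \<in> ?m" using xs(3) pq by auto
    have u: "u [flat y, flat z] = killing p y * killing q z - killing q y * killing p z" for y z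
      unfolding xs(1) pq wedge_two[OF flat_dual flat_dual] by (simp add: flat_def)
    have z: "killing p y = 0" "killing q y = 0" if "y \<in> \<LL>" for y
      using killing_levi_compl[OF that] m by (simp_all add: killing_sym[of _ y])
    have cu: "(fscale c u + w) \<xi>s = c * u \<xi>s + w \<xi>s" for \<xi>s by (simp add: fscale_def)
    have w: "w [flat (y + y'), flat z] = w [flat y, flat z] + w [flat y', flat z]"
      "w [flat (a *\<^sub>C y), flat z] = a * w [flat y, flat z]"
      "w [flat z, flat y] = - w [flat y, flat z]" "y \<in> \<LL> \<Longrightarrow> w [flat y, flat z] = 0" for a y y' z
      using step(2) by blast+
    show ?case
    proof (intro conjI allI ballI)
      fix y y' z a
      show "(fscale c u + w) [flat (y + y'), flat z] =
          (fscale c u + w) [flat y, flat z] + (fscale c u + w) [flat y', flat z]"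
        unfolding cu u w(1) by (simp add: killing_simps algebra_simps)
      show "(fscale c u + w) [flat (a *\<^sub>C y), flat z] = a * (fscale c u + w) [flat y, flat z]"
        unfolding cu u w(2) by (simp add: killing_simps algebra_simps)
      show "(fscale c u + w) [flat z, flat y] = - (fscale c u + w) [flat y, flat z]"
        unfolding cu u w(3)[of z y] by (simp add: algebra_simps)
      show "(fscale c u + w) [flat y, flat z] = 0" if "y \<in> \<LL>"
        unfolding cu u w(4)[OF that] by (simp add: z that)
    qed
  qed simp
  have B_add: "?B (y + y') z = ?B y z + ?B y' z" and B_scale: "?B (a *\<^sub>C y) z = a * ?B y z"
    and B_skew: "?B z y = - ?B y z" and B_levi: "y \<in> \<LL> \<Longrightarrow> ?B y z = 0" for a y y' z
    using props by blast+
  define c where "c \<alpha> = (if \<alpha> \<in> \<Theta> then ?B (E (- \<alpha>)) (E \<alpha>) else 0)" for \<alpha>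
  have odd: "odd_on_roots c"
    unfolding odd_on_roots_def
  proof
    fix \<alpha> assume "\<alpha> \<in> \<Omega>"
    show "c (- \<alpha>) = - c \<alpha>"
    proof (cases "\<alpha> \<in> \<Theta>")
      case True
      then show ?thesis
        using compl_minus[OF True] B_skew[of "E (- \<alpha>)" "E \<alpha>"] by (simp only: c_def if_True minus_minus)
    next
      case False
      then have "- \<alpha> \<notin> \<Theta>" using compl_minus[of "- \<alpha>"] unfolding minus_minus by blast
      then show ?thesis using False by (simp only: c_def if_False) simp
    qed
  qed
  have weight: "?B (E \<alpha>) (E \<beta>) = 0" if r: "\<alpha> \<in> \<Omega>" "\<beta> \<in> \<Omega>" and ne: "\<alpha> + \<beta> \<noteq> 0" for \<alpha> \<beta>
  proof -
    obtain h where h: "h \<in> H" "(\<alpha> + \<beta>) h \<noteq> 0"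
      using dual_nonzero[OF dual_add[OF root_dual root_dual] ne] r by blast
    have "- lie h (E \<delta>) = (- \<delta> h) *\<^sub>C E \<delta>" if "\<delta> \<in> \<Omega>" for \<delta> using lie_H_E[OF h(1) that] by simp
    moreover have "?B (- lie h (E \<alpha>)) (E \<beta>) + ?B (E \<alpha>) (- lie h (E \<beta>)) = 0"
      using inv[of h] H_levi h(1) ext_ad_eq_0_iff[OF f2, of h] by blast
    moreover have "?B (E \<alpha>) (a *\<^sub>C E \<beta>) = a * ?B (E \<alpha>) (E \<beta>)" for a
      using B_scale[of a "E \<beta>" "E \<alpha>"] B_skew[of "E \<alpha>" "a *\<^sub>C E \<beta>"] B_skew[of "E \<alpha>" "E \<beta>"] by simp
    ultimately have "- (\<alpha> h) * ?B (E \<alpha>) (E \<beta>) + - (\<beta> h) * ?B (E \<alpha>) (E \<beta>) = 0"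
      by (simp only: r B_scale)
    moreover have "(\<alpha> h + \<beta> h) * ?B (E \<alpha>) (E \<beta>) =
        - (- (\<alpha> h) * ?B (E \<alpha>) (E \<beta>) + - (\<beta> h) * ?B (E \<alpha>) (E \<beta>))" by (simp add: algebra_simps)
    ultimately have "(\<alpha> h + \<beta> h) * ?B (E \<alpha>) (E \<beta>) = 0" by (simp only: minus_zero)
    then show ?thesis using h(2) by simp
  qed
  have B0: "?B 0 z = 0" for z using B_scale[of 0 0 z] by simp
  have eq: "?B y z = killing y (diag c z)" for y z
  proof -
    let ?S = "{y. ?B y z = killing y (diag c z)}"
    have S: "clie.subspace {y. ?B y z = killing y (diag c z)}" for z
      by (auto simp: clie.subspace_def B0 B_add B_scale killing_simps)
    have skew: "killing y (diag c z) = - killing z (diag c y)" for y z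
    proof -
      have k: "killing (contract p q (flat z)) y = - killing (contract p q (flat y)) z" for p q
        by (simp add: contract_def flat_def killing_simps)
      have "killing (diag c z) y = - killing (diag c y) z"
        unfolding diag_contract[OF odd, symmetric] killing_simps k by (simp add: sum_negf)
      then show ?thesis by (simp only: killing_sym[of _ "diag c _"])
    qed
    have EE: "?B (E \<alpha>) (E \<beta>) = killing (E \<alpha>) (diag c (E \<beta>))" if r: "\<alpha> \<in> \<Omega>" "\<beta> \<in> \<Omega>" for \<alpha> \<beta>
    proof (cases "\<beta> = - \<alpha>")
      case True
      then have \<alpha>: "\<alpha> = - \<beta>" by simp
      have "killing (E \<alpha>) (diag c (E \<beta>)) = c \<beta>"
        unfolding diag_E[OF r(2)] killing_simps killing_E_E[OF r] using True by simp
      moreover have "?B (E \<alpha>) (E \<beta>) = c \<beta>"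
      proof (cases "\<beta> \<in> \<Theta>")
        case True
        then show ?thesis by (simp only: c_def \<alpha> if_True)
      next
        case False
        then have "\<beta> \<in> \<Lambda>" using r by blast
        then have "?B (E \<beta>) (E \<alpha>) = 0" by (intro B_levi E_levi)
        then show ?thesis using False B_skew[of "E \<alpha>" "E \<beta>"] by (simp only: c_def if_False) simp
      qed
      ultimately show ?thesis by simp
    next
      case False
      then have "\<alpha> + \<beta> \<noteq> 0" by (metis add_eq_0_iff)
      then show ?thesis
        unfolding diag_E[OF r(2)] killing_simps killing_E_E[OF r] using False weight[OF r] by simp
    qed
    have HB: "?B h z = killing h (diag c z)" if "h \<in> H" for h z
      using B_levi[of h z] H_levi that by (auto simp: killing_H_diag)
    have 1: "?B y (E \<beta>) = killing y (diag c (E \<beta>))" if "\<beta> \<in> \<Omega>" for y \<beta>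
    proof -
      have "y \<in> {y. ?B y (E \<beta>) = killing y (diag c (E \<beta>))}"
      proof (rule UNIV_by_root_vectors[OF S])
        show "H \<subseteq> {y. ?B y (E \<beta>) = killing y (diag c (E \<beta>))}" using HB by blast
        show "E \<alpha> \<in> {y. ?B y (E \<beta>) = killing y (diag c (E \<beta>))}" if "\<alpha> \<in> \<Omega>" for \<alpha>
          using EE[OF that \<open>\<beta> \<in> \<Omega>\<close>] by blast
      qed
      then show ?thesis by simp
    qed
    have "y \<in> ?S"
    proof (rule UNIV_by_root_vectors[OF S])
      show "H \<subseteq> ?S" using HB by blast
      fix \<alpha> assume \<alpha>: "\<alpha> \<in> \<Omega>"
      have "?B (E \<alpha>) z = killing (E \<alpha>) (diag c z)"
        unfolding B_skew[of "E \<alpha>" z] 1[OF \<alpha>] skew[of "E \<alpha>" z] ..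
      then show "E \<alpha> \<in> ?S" by simp
    qed
    then show ?thesis by simp
  qed
  have fc: "f = bivector c"
    by (rule bivector_eqI[OF f2 bivector_ext_power]) (simp only: eq bivector_flat[OF odd])
  have "admissible c"
    unfolding admissible_def
  proof (intro conjI ballI impI)
    show "c (- \<alpha>) = - c \<alpha>" if "\<alpha> \<in> \<Omega>" for \<alpha> using odd that by (simp only: odd_on_roots_def)
    show "c \<alpha> = 0" if "\<alpha> \<in> \<Lambda>" for \<alpha> using that by (simp add: c_def)
    fix \<alpha> \<gamma> assume a: "\<alpha> \<in> \<Theta>" "\<gamma> \<in> \<Lambda>" "\<alpha> + \<gamma> \<in> \<Omega>"
    have r: "\<gamma> \<in> \<Omega>" "\<alpha> \<in> \<Omega>" "\<gamma> + \<alpha> \<in> \<Omega>"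
      using a by (auto simp: levi_roots_def add.commute)
    let ?N = "killing (lie (E \<gamma>) (E \<alpha>)) (E (- (\<gamma> + \<alpha>)))"
    have "diag c (lie (E \<gamma>) (E \<alpha>)) = lie (E \<gamma>) (diag c (E \<alpha>))"
      using inv[OF E_levi[OF a(2)]] unfolding fc bivector_invariant_iff[OF odd] by blast
    then have "diag c (?N *\<^sub>C E (\<gamma> + \<alpha>)) = c \<alpha> *\<^sub>C (?N *\<^sub>C E (\<gamma> + \<alpha>))"
      unfolding diag_E[OF r(2)] lie_scaleC_right using lie_E_E[OF r] by metis
    then have "(c (\<gamma> + \<alpha>) * ?N) *\<^sub>C E (\<gamma> + \<alpha>) = (c \<alpha> * ?N) *\<^sub>C E (\<gamma> + \<alpha>)"
      by (simp only: module_hom.scale[OF diag_hom] diag_E[OF r(3)] scaleC_scaleC mult.commute)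
    then have "c (\<gamma> + \<alpha>) * ?N = c \<alpha> * ?N"
      using E_nonzero[OF r(3)] by (simp only: clie.scale_cancel_right) blast
    then have "c (\<gamma> + \<alpha>) = c \<alpha>"
      using structure_constant_nonzero[OF r] by (simp only: mult_cancel_right) blast
    then show "c (\<alpha> + \<gamma>) = c \<alpha>" by (simp only: add.commute)
  qed
  then show ?thesis using that fc by blast
qed

lemma bivector_nondegenerate:
  assumes c: "odd_on_roots c" and nz: "\<And>\<alpha>. \<alpha> \<in> \<Theta> \<Longrightarrow> c \<alpha> \<noteq> 0"
  shows "nondegenerate H E \<Gamma> (bivector c)"
  unfolding nondegenerate_def
proof (intro ballI impI)
  fix \<xi> assume \<xi>: "\<xi> \<in> annihilator \<LL>" and z: "\<forall>\<eta>\<in>annihilator \<LL>. bivector c [\<xi>, \<eta>] = 0"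
  obtain y where y: "y \<in> clie.span (E ` \<Theta>)" "\<xi> = flat y" using \<xi> unfolding annihilator_levi by blast
  have k: "killing y (E (- \<alpha>)) = 0" if \<alpha>: "\<alpha> \<in> \<Theta>" for \<alpha>
  proof -
    have m: "- \<alpha> \<in> \<Theta>" "- \<alpha> \<in> \<Omega>" using compl_minus[OF \<alpha>] by blast+
    have "flat (E (- \<alpha>)) \<in> annihilator \<LL>"
      unfolding annihilator_levi using m(1) by (blast intro: clie.span_base)
    then have "bivector c [flat y, flat (E (- \<alpha>))] = 0" using z y(2) by blast
    then have "c (- \<alpha>) * killing y (E (- \<alpha>)) = 0"
      by (simp only: bivector_flat[OF c] diag_E[OF m(2)] killing_simps)
    then show ?thesis using nz[OF m(1)] by (simp only: mult_eq_0_iff) blast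
  qed
  have "y = (\<Sum>\<alpha>\<in>\<Theta>. killing y (E (- \<alpha>)) *\<^sub>C E \<alpha>)"
    by (rule levi_orthogonal) (rule killing_levi_compl[OF _ y(1)])
  also have "\<dots> = 0"
  proof (rule sum.neutral, rule ballI)
    fix \<alpha> assume "\<alpha> \<in> \<Theta>"
    then show "killing y (E (- \<alpha>)) *\<^sub>C E \<alpha> = 0" using k[of \<alpha>] by simp
  qed
  finally show "\<xi> = 0" unfolding y(2) by (simp add: flat_def killing_simps fun_eq_iff)
qed

lemma kks_bracket_eq: "kks_bracket H P E \<Gamma> l = bivector kks_coef"
proof -
  have "bivector kks_coef = (\<Sum>\<alpha>\<in>P - \<Lambda>. fscale (kks_coef \<alpha>) (wedge [E \<alpha>, E (- \<alpha>)]))"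
    unfolding bivector_def
    by (rule sum.mono_neutral_right[OF finite_P Diff_subset]) (simp add: kks_coef_def)
  also have "\<dots> = kks_bracket H P E \<Gamma> l"
    unfolding kks_bracket_def using P_subset by (intro sum.cong) (auto simp: kks_coef_def lam_def)
  finally show ?thesis by simp
qed

lemma family_nondegenerate:
  assumes c: "admissible c"
  shows "finite {s. \<not> nondegenerate H E \<Gamma> (bivector (\<lambda>\<alpha>. e * c \<alpha> + s * kks_coef \<alpha>))}"
proof (rule finite_subset)
  show "{s. \<not> nondegenerate H E \<Gamma> (bivector (\<lambda>\<alpha>. e * c \<alpha> + s * kks_coef \<alpha>))}
      \<subseteq> (\<lambda>\<alpha>. - (e * c \<alpha> * lam \<alpha>)) ` \<Theta>"
  proof
    fix s assume "s \<in> {s. \<not> nondegenerate H E \<Gamma> (bivector (\<lambda>\<alpha>. e * c \<alpha> + s * kks_coef \<alpha>))}"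
    moreover have "odd_on_roots (\<lambda>\<alpha>. e * c \<alpha> + s * kks_coef \<alpha>)"
      using admissible_odd[OF c] admissible_odd[OF kks_admissible] by (simp add: odd_on_roots_def)
    ultimately obtain \<alpha> where \<alpha>: "\<alpha> \<in> \<Theta>" "e * c \<alpha> + s * kks_coef \<alpha> = 0"
      using bivector_nondegenerate by blast
    then have "s = - (e * c \<alpha> * lam \<alpha>)"
      using lam_nonzero[OF \<alpha>(1)] by (simp add: kks_coef_def field_simps eq_neg_iff_add_eq_0)
    then show "s \<in> (\<lambda>\<alpha>. - (e * c \<alpha> * lam \<alpha>)) ` \<Theta>" using \<alpha>(1) by blast
  qed
qed (simp add: finite_roots)

text \<open>The vanishing of \<open>\<lbrakk>f, v\<rbrakk>\<close> is the case \<open>k = 0\<close> of \<open>orbit_schouten_iff\<close>.\<close>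

lemma bracket_iff_solution:
  "invariant_bracket H P E \<Gamma> f \<and> orbit_schouten H E \<Gamma> f f = fscale (K\<^sup>2) (phi_orbit H P E \<Gamma>)
      \<and> orbit_schouten H E \<Gamma> f (kks_bracket H P E \<Gamma> l) = 0
    \<longleftrightarrow> (\<exists>c. solution K c \<and> f = bivector c)"
proof -
  have zero: "0 = fscale 0 (phi_orbit H P E \<Gamma>)" by (simp add: fscale_def fun_eq_iff)
  have iff: "orbit_schouten H E \<Gamma> (bivector c) (bivector c) = fscale (K\<^sup>2) (phi_orbit H P E \<Gamma>)
      \<and> orbit_schouten H E \<Gamma> (bivector c) (kks_bracket H P E \<Gamma> l) = 0 \<longleftrightarrow> solution K c"
    if c: "admissible c" for c
    unfolding zero kks_bracket_eq orbit_schouten_iff[OF admissible_odd[OF c] admissible_odd[OF c]]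
      orbit_schouten_iff[OF admissible_odd[OF c] admissible_odd[OF kks_admissible]] solution_def
    using c by (simp only: mult_zero_right) blast
  show ?thesis
  proof
    assume f: "invariant_bracket H P E \<Gamma> f \<and> orbit_schouten H E \<Gamma> f f = fscale (K\<^sup>2) (phi_orbit H P E \<Gamma>)
      \<and> orbit_schouten H E \<Gamma> f (kks_bracket H P E \<Gamma> l) = 0"
    then obtain c where c: "admissible c" "f = bivector c" using invariant_bracket_coefs by blast
    then have "solution K c" using iff[OF c(1)] f by blast
    then show "\<exists>c. solution K c \<and> f = bivector c" using c(2) by blast
  next
    assume "\<exists>c. solution K c \<and> f = bivector c"
    then obtain c where c: "solution K c" "f = bivector c" by blast
    then have a: "admissible c" by (simp add: solution_def)
    show "invariant_bracket H P E \<Gamma> f \<and> orbit_schouten H E \<Gamma> f f = fscale (K\<^sup>2) (phi_orbit H P E \<Gamma>)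
      \<and> orbit_schouten H E \<Gamma> f (kks_bracket H P E \<Gamma> l) = 0"
      unfolding c(2) using bivector_invariant[OF a] iff[OF a] c(1) by blast
  qed
qed

end

theorem mainTheorem4:
  fixes H :: "'g :: simple_complex_lie_algebra set"
    and P \<Gamma> :: "('g \<Rightarrow> complex) set"
    and E :: "('g \<Rightarrow> complex) \<Rightarrow> 'g"
    and l :: "('g \<Rightarrow> complex) \<Rightarrow> complex"
    and K :: complex
    and f0 v :: "'g polyvector"
  assumes "cartan_subalgebra H"
    and "positive_system H P"
    and "root_vectors H P E"
    and "\<Gamma> \<subset> simple_roots P"
    and "orbit_form H P \<Gamma> l"
    and "v = kks_bracket H P E \<Gamma> l"
    and "good_orbit H P E \<Gamma> l"
    and "K \<noteq> 0"
    and "invariant_bracket H P E \<Gamma> f0"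
    and "orbit_schouten H E \<Gamma> f0 f0 = fscale (K\<^sup>2) (phi_orbit H P E \<Gamma>)"
    and "orbit_schouten H E \<Gamma> f0 v = 0"
  shows "{f. invariant_bracket H P E \<Gamma> f
            \<and> orbit_schouten H E \<Gamma> f f = fscale (K\<^sup>2) (phi_orbit H P E \<Gamma>)
            \<and> orbit_schouten H E \<Gamma> f v = 0}
          = {f0 + fscale s v | s. True} \<union> {- f0 + fscale s v | s. True}
       \<and> finite {s. \<not> nondegenerate H E \<Gamma> (f0 + fscale s v)}
       \<and> finite {s. \<not> nondegenerate H E \<Gamma> (- f0 + fscale s v)}"
proof -
  have "P \<noteq> {}" using assms(4) by (auto simp: simple_roots_def)
  then interpret orbit_algebra H P E \<Gamma> l
    using assms(1-5) by unfold_locales auto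
  obtain d where d: "solution K d" "f0 = bivector d"
    using bracket_iff_solution[of f0 K] assms(6,9-11) by blast
  have v: "v = bivector kks_coef" using assms(6) kks_bracket_eq by simp
  have plus: "f0 + fscale s v = bivector (\<lambda>\<alpha>. 1 * d \<alpha> + s * kks_coef \<alpha>)" for s
    unfolding bivector_combination d(2) v by (simp add: fscale_def fun_eq_iff)
  have minus: "- f0 + fscale s v = bivector (\<lambda>\<alpha>. - 1 * d \<alpha> + s * kks_coef \<alpha>)" for s
    unfolding bivector_combination d(2) v by (simp add: fscale_def fun_eq_iff)
  have "{f. \<exists>c. solution K c \<and> f = bivector c}
      = {f0 + fscale s v | s. True} \<union> {- f0 + fscale s v | s. True}" (is "?L = ?R")
  proof
    show "?L \<subseteq> ?R"
    proof
      fix f assume "f \<in> ?L"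
      then obtain c where c: "solution K c" "f = bivector c" by blast
      obtain s where "(\<forall>\<alpha>\<in>\<Omega>. c \<alpha> = d \<alpha> + s * kks_coef \<alpha>) \<or> (\<forall>\<alpha>\<in>\<Omega>. c \<alpha> = - d \<alpha> + s * kks_coef \<alpha>)"
        using solution_unique[OF assms(8) c(1) d(1)] by blast
      then have "f = f0 + fscale s v \<or> f = - f0 + fscale s v"
        unfolding plus minus c(2) by (elim disjE) (rule disjI1 disjI2, rule bivector_cong, simp)+
      then show "f \<in> ?R" by blast
    qed
    show "?R \<subseteq> ?L"
      unfolding plus minus using solution_family[OF d(1), of 1] solution_family[OF d(1), of "- 1"] by auto
  qed
  moreover have "admissible d" using d(1) by (simp add: solution_def)
  then have "finite {s. \<not> nondegenerate H E \<Gamma> (f0 + fscale s v)}"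
      "finite {s. \<not> nondegenerate H E \<Gamma> (- f0 + fscale s v)}"
    unfolding plus minus by (rule family_nondegenerate)+
  ultimately show ?thesis
    using bracket_iff_solution[of _ K] assms(6) by simp
qed

end
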